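(* Let $a>0$ and $\hat a=\pi/(2a)$. Let $f,g:\mathbb{R}\to\mathbb{R}$ be bounded and measurable with $K=i[f(P),g(Q)]\ge 0$ and $K\neq 0$, with $f$ and $g$ nondecreasing. If $$\int_{\mathbb{R}} f'(t)e^{2bt}\,dt<\infty\quad\text{for all } b\in(0,\hat a),$$ then $g\in K_{\hat a}$. If in addition $$\int_{\mathbb{R}} g'(t)e^{2bt}\,dt<\infty\quad\text{for all } b\in(0,a),$$ then also $f\in K_a$ (so that $f\in K_a$ and $g\in K_{\hat a}$ with $a\hat a=\pi/2$, i.e. the Kato conjecture holds for the pair $f,g$).
   Context: On $L^2(\mathbb{R})$, $Q$ is multiplication by $x$ and $P=-i\,d/dx$; $f(P)$ and $g(Q)$ are defined by the functional calculus (so $g(Q)$ is multiplication by $g$, and $f(P)=\mathcal{F}^{-1}f(\xi)\mathcal{F}$ with $\mathcal{F}$ the unitary Fourier transform $\hat\psi(\xi)=(2\pi)^{-1/2}\int e^{-i\xi x}\psi(x)\,dx$). $[A,B]=AB-BA$. Positivity of a bounded operator is in the quadratic form sense. When $f,g$ are real, bounded, measurable and $K\ge0$, $K\ne0$, it is known that $f$ and $g$ agree a.e. with absolutely continuous functions with $L^1$ derivatives, which are either both nondecreasing or both nonincreasing; $f$ and $g$ denote these versions and $f',g'$ their derivatives. For $\alpha>0$, $K_\alpha$ is the set of bounded real functions on $\mathbb{R}$ having an analytic continuation to the strip $\{|\mathrm{Im}\,z|<\alpha\}$ that satisfies $\mathrm{Im} f(z)\,\mathrm{Im}\,z\ge 0$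 there. The Kato conjecture is the statement that whenever $f,g$ are real, bounded, measurable and $i[f(P),g(Q)]$ is nonzero and $\ge 0$, there are $\alpha,\hat\alpha>0$ with $\alpha\hat\alpha=\pi/2$ such that either $f\in K_\alpha$, $g\in K_{\hat\alpha}$ or $-f\in K_\alpha$, $-g\in K_{\hat\alpha}$. *)

theory Defs
  imports "HOL-Analysis.Analysis"
begin

section \<open>The Hilbert space of square-integrable functions on the line\<close>

text \<open>Elements of the Hilbert space are represented by functions; equality in the Hilbert space
  is equality almost everywhere.  Operators are functions on representatives.\<close>

definition L2 :: "(real \<Rightarrow> complex) set" where
  "L2 = {\<psi>. \<psi> \<in> borel_measurable lebesgue \<and> integrable lebesgue (\<lambda>x. (cmod (\<psi> x))\<^sup>2)}"

definition l2_inner :: "(real \<Rightarrow> complex) \<Rightarrow> (real \<Rightarrow> complex) \<Rightarrow> complex" where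
  "l2_inner \<phi> \<psi> = (LINT x|lebesgue. cnj (\<phi> x) * \<psi> x)"

type_synonym l2_op = "(real \<Rightarrow> complex) \<Rightarrow> real \<Rightarrow> complex"

definition commutator :: "l2_op \<Rightarrow> l2_op \<Rightarrow> l2_op" where
  "commutator A B \<psi> = (\<lambda>x. A (B \<psi>) x - B (A \<psi>) x)"

definition positive_op :: "l2_op \<Rightarrow> bool" where
  "positive_op A \<longleftrightarrow> (\<forall>\<psi>\<in>L2. l2_inner \<psi> (A \<psi>) \<in> \<real>\<^sub>\<ge>\<^sub>0)"

definition nonzero_op :: "l2_op \<Rightarrow> bool" where
  "nonzero_op A \<longleftrightarrow> (\<exists>\<psi>\<in>L2. \<not> (AE x in lebesgue. A \<psi> x = 0))"


section \<open>The unitary Fourier transform\<close>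

definition fourier_integral :: "(real \<Rightarrow> complex) \<Rightarrow> real \<Rightarrow> complex" where
  "fourier_integral \<psi> \<xi> =
     of_real (1 / sqrt (2 * pi)) * (LINT x|lebesgue. exp (- (\<i> * of_real \<xi> * of_real x)) * \<psi> x)"

text \<open>The transform on the Hilbert space is the limit in mean of the Fourier integrals over
  \<open>{-n..n}\<close>.  The distance is a nonnegative extended integral because the Bochner integral of a
  non-integrable function is 0.\<close>

definition is_fourier_transform :: "(real \<Rightarrow> complex) \<Rightarrow> (real \<Rightarrow> complex) \<Rightarrow> bool" where
  "is_fourier_transform \<psi> \<phi> \<longleftrightarrow> \<phi> \<in> L2 \<and>
     (\<lambda>n::nat. \<integral>\<^sup>+ \<xi>. ennreal ((cmod (\<phi> \<xi> -
        fourier_integral (\<lambda>x. indicator {- real n..real n} x * \<psi> x) \<xi>))\<^sup>2) \<partial>lebesgue)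
     \<longlonglongrightarrow> 0"

text \<open>The choices below are choices of a representative, since on \<open>L2\<close> the transform is unitary
  and hence determined, and invertible, up to null sets.\<close>

definition fourier :: l2_op where
  "fourier \<psi> = (SOME \<phi>. is_fourier_transform \<psi> \<phi>)"

definition inv_fourier :: l2_op where
  "inv_fourier \<phi> = (SOME \<psi>. \<psi> \<in> L2 \<and> (AE \<xi> in lebesgue. fourier \<psi> \<xi> = \<phi> \<xi>))"


section \<open>Functions of position and momentum\<close>

definition fun_Q :: "(real \<Rightarrow> real) \<Rightarrow> l2_op" where
  "fun_Q g \<psi> = (\<lambda>x. of_real (g x) * \<psi> x)"

definition fun_P :: "(real \<Rightarrow> real) \<Rightarrow> l2_op" where
  "fun_P f \<psi> = inv_fourier (\<lambda>\<xi>. of_real (f \<xi>) * fourier \<psi> \<xi>)"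

definition i_commutator :: "(real \<Rightarrow> real) \<Rightarrow> (real \<Rightarrow> real) \<Rightarrow> l2_op" where
  "i_commutator f g \<psi> = (\<lambda>x. \<i> * commutator (fun_P f) (fun_Q g) \<psi> x)"


section \<open>Absolutely continuous versions\<close>

definition abs_continuous_on :: "real set \<Rightarrow> (real \<Rightarrow> real) \<Rightarrow> bool" where
  "abs_continuous_on S F \<longleftrightarrow>
     (\<forall>\<epsilon>>0. \<exists>\<delta>>0. \<forall>I :: (real \<times> real) set.
        finite I \<and> (\<forall>(u, v)\<in>I. u \<le> v \<and> {u..v} \<subseteq> S) \<and>
        pairwise (\<lambda>(u, v) (u', v'). {u<..<v} \<inter> {u'<..<v'} = {}) I \<and>
        (\<Sum>(u, v)\<in>I. v - u) < \<delta>
        \<longrightarrow> (\<Sum>(u, v)\<in>I. \<bar>F v - F u\<bar>) < \<epsilon>)"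

text \<open>\<open>F\<close> is the absolutely continuous version of \<open>f\<close>, with integrable derivative \<open>F'\<close>.
  There is at most one such \<open>F\<close>, and \<open>F'\<close> is unique up to null sets.\<close>

definition ac_version :: "(real \<Rightarrow> real) \<Rightarrow> (real \<Rightarrow> real) \<Rightarrow> (real \<Rightarrow> real) \<Rightarrow> bool" where
  "ac_version f F F' \<longleftrightarrow>
     (AE t in lebesgue. f t = F t) \<and>
     (\<forall>a b. abs_continuous_on {a..b} F) \<and>
     (AE t in lebesgue. (F has_real_derivative F' t) (at t)) \<and>
     integrable lebesgue F'"


section \<open>The Kato classes\<close>

definition kato_class :: "real \<Rightarrow> (real \<Rightarrow> real) set" where
  "kato_class \<alpha> = {h. bounded (range h) \<and>
     (\<exists>\<Phi>. \<Phi> holomorphic_on {z. \<bar>Im z\<bar> < \<alpha>} \<and>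
          (\<forall>x. \<Phi> (of_real x) = of_real (h x)) \<and>
          (\<forall>z. \<bar>Im z\<bar> < \<alpha> \<longrightarrow> Im (\<Phi> z) * Im z \<ge> 0))}"

definition kato_conclusion :: "(real \<Rightarrow> real) \<Rightarrow> (real \<Rightarrow> real) \<Rightarrow> bool" where
  "kato_conclusion f g \<longleftrightarrow>
     (\<exists>\<alpha> \<beta>. \<alpha> > 0 \<and> \<beta> > 0 \<and> \<alpha> * \<beta> = pi / 2 \<and>
        (f \<in> kato_class \<alpha> \<and> g \<in> kato_class \<beta> \<or>
         (\<lambda>x. - f x) \<in> kato_class \<alpha> \<and> (\<lambda>x. - g x) \<in> kato_class \<beta>))"

end

theory Submission
  imports Defs "HOL-Probability.Probability"
begin

text \<open>
  In the momentum representation the operator \<open>K = i[f(P),g(Q)]\<close> is,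
  up to the factor \<open>1/(2 pi)\<close>, the integral operator with kernel
  \<open>(f \<xi> - f \<eta>)/(\<xi> - \<eta>) * \<gamma> (\<eta> - \<xi>)\<close>, where \<open>\<gamma> s\<close> is the integral of \<open>exp (-i s t) g' t\<close>.
  The whole proof reads off information from the positivity of this kernel.

  \<^item> On the diagonal the kernel is \<open>\<gamma> 0 * f' \<xi>\<close>.  Hence nonnegativity of the two by two minors bounds
    \<open>|\<gamma> (\<eta> - \<xi>)|\<^sup>2 ((f \<xi> - f \<eta>)/(\<xi> - \<eta>))\<^sup>2\<close> by a constant times \<open>f' \<xi> * f' \<eta>\<close>, for almost all \<open>\<xi>\<close> and \<open>\<eta>\<close>
    (\<open>determinant_inequality\<close>).  Fix a suitable \<open>\<xi>\<close> and let \<open>\<eta>\<close> tend to infinity: \<open>f \<eta> - f \<xi>\<close> stays away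
    from zero and \<open>f'\<close> has exponential moments of every order below \<open>2 ahat\<close>, so \<open>\<gamma>\<close> must decay
    like \<open>exp (- b |s|)\<close>, in the mean, for every \<open>b < ahat\<close> (\<open>density_transform_decay\<close>).  Decay on the
    positive half line suffices because \<open>\<gamma> (- s)\<close> is the conjugate of \<open>\<gamma> s\<close>.

  \<^item> Fourier inversion then continues \<open>g\<close> to the strip of half width \<open>ahat\<close>
    (\<open>density_transform_inversion\<close>, \<open>strip_extension_holomorphic\<close>).

  \<^item> Put into the quadratic form of the kernel the function \<open>exp (- i z \<xi>)\<close>, the momentum
    representation of a point mass at the complex position \<open>z\<close> with \<open>b = Im z > 0\<close>.  The form takes the
    value \<open>(2 pi / b) * (\<integral> f' t exp (2 b t) dt) * Im (g z)\<close>, and it is nonnegative; so \<open>Im (g z) \<ge> 0\<close>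
    (\<open>Im_strip_extension_nonneg\<close>).

  The position representation of \<open>K\<close> has the same form with \<open>f\<close> and \<open>g\<close> exchanged (up to conjugation of
  the test function).  The argument above is therefore carried out for an abstract pair with positive
  kernel (\<open>kato_class_if_dd_positive\<close>) and used twice.

  The rest of the text connects the operator with the kernel.  The operator is defined through the
  Fourier transform on the Hilbert space, so this transform has to be shown unitary
  (\<open>fourier_inner\<close>, \<open>fourier_surjective\<close>).  The quadratic form of \<open>K\<close> is then
  \<open>2 Im \<langle>g \<psi>, f(P) \<psi>\<rangle>\<close> (\<open>commutator_form\<close>); integrating by parts against \<open>g'\<close>, with an exponential
  damping that avoids principal values, turns it into the double integral
  (\<open>kato_integral_eq_dd_form\<close>).  Finally \<open>f\<close> is recovered from the almost everywhere derivative of its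
  absolutely continuous version by a gauge argument (\<open>abs_continuous_has_integral\<close>).
\<close>


section \<open>Square-integrable functions\<close>

definition l2_sq :: "(real \<Rightarrow> complex) \<Rightarrow> real" where
  "l2_sq \<psi> = (LINT x|lebesgue. (cmod (\<psi> x))\<^sup>2)"

text \<open>Convergence in mean, stated with finite integrals; for members of \<open>L2\<close> it agrees with the
  extended integral in the definition of the Fourier transform.\<close>

definition l2_limit :: "(nat \<Rightarrow> real \<Rightarrow> complex) \<Rightarrow> (real \<Rightarrow> complex) \<Rightarrow> bool" where
  "l2_limit X \<psi> \<longleftrightarrow> (\<lambda>n. l2_sq (\<lambda>x. \<psi> x - X n x)) \<longlonglongrightarrow> 0"

lemma borel_measurable_cnj [measurable]: "cnj \<in> borel_measurable borel"
  by (intro borel_measurable_continuous_onI continuous_intros)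

text \<open>Completeness of Lebesgue measure is what makes a change on a null set harmless here.  The
  operators are choices of representatives, so this is used whenever such a choice is replaced by an
  explicit function.\<close>

lemma lebesgue_measurable_AE_cong:
  fixes f h :: "real \<Rightarrow> 'a::topological_space"
  assumes f: "f \<in> borel_measurable lebesgue" and eq: "AE x in lebesgue. h x = f x"
  shows "h \<in> borel_measurable lebesgue"
proof (rule measurableI)
  fix A :: "'a set" assume A: "A \<in> sets borel"
  show "h -` A \<inter> space lebesgue \<in> sets lebesgue"
    by (rule completion.in_sets_AE[OF _ measurable_sets[OF f A]])
       (use eq in \<open>auto elim: eventually_mono\<close>)
qed auto

lemma L2_measurable [measurable_dest]: "\<psi> \<in> L2 \<Longrightarrow> \<psi> \<in> borel_measurable lebesgue"
  by (simp add: L2_def)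

lemma L2_integrable: "\<psi> \<in> L2 \<Longrightarrow> integrable lebesgue (\<lambda>x. (cmod (\<psi> x))\<^sup>2)"
  by (simp add: L2_def)

lemma L2_dominated:
  assumes "\<phi> \<in> borel_measurable lebesgue" "integrable lebesgue w"
    and "\<And>x. (cmod (\<phi> x))\<^sup>2 \<le> w x"
  shows "\<phi> \<in> L2"
  unfolding L2_def using assms by (auto intro!: Bochner_Integration.integrable_bound[OF assms(2)] simp: order_trans[OF _ abs_ge_self])

lemma L2_bounded_mult:
  assumes "\<psi> \<in> L2" and [measurable]: "m \<in> borel_measurable lebesgue" and "\<And>x. cmod (m x) \<le> C"
  shows "(\<lambda>x. m x * \<psi> x) \<in> L2"
proof (rule L2_dominated)
  note [measurable] = L2_measurable[OF assms(1)]
  show "(\<lambda>x. m x * \<psi> x) \<in> borel_measurable lebesgue" by measurable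
  show "integrable lebesgue (\<lambda>x. C\<^sup>2 * (cmod (\<psi> x))\<^sup>2)"
    using L2_integrable[OF assms(1)] by simp
  show "(cmod (m x * \<psi> x))\<^sup>2 \<le> C\<^sup>2 * (cmod (\<psi> x))\<^sup>2" for x
    by (simp add: norm_mult power_mult_distrib mult_right_mono power_mono assms(3))
qed

lemma L2_cmult: "\<psi> \<in> L2 \<Longrightarrow> (\<lambda>x. c * \<psi> x) \<in> L2"
  by (rule L2_bounded_mult[where C = "cmod c"]) auto

lemma cmod_add_sq_le: "(cmod (a + b))\<^sup>2 \<le> 2 * (cmod a)\<^sup>2 + 2 * (cmod b)\<^sup>2"
proof -
  have "(cmod (a + b))\<^sup>2 \<le> (cmod a + cmod b)\<^sup>2" by (simp add: power_mono norm_triangle_ineq)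
  also have "\<dots> \<le> 2 * (cmod a)\<^sup>2 + 2 * (cmod b)\<^sup>2"
    using sum_squares_ge_zero[of "cmod a - cmod b" 0] by (simp add: power2_eq_square algebra_simps)
  finally show ?thesis .
qed

lemma L2_add:
  assumes "\<phi> \<in> L2" "\<psi> \<in> L2" shows "(\<lambda>x. \<phi> x + \<psi> x) \<in> L2"
  by (rule L2_dominated[where w = "\<lambda>x. 2 * (cmod (\<phi> x))\<^sup>2 + 2 * (cmod (\<psi> x))\<^sup>2"])
     (use assms L2_measurable L2_integrable in \<open>auto simp: cmod_add_sq_le\<close>)

lemma L2_diff:
  assumes "\<phi> \<in> L2" "\<psi> \<in> L2" shows "(\<lambda>x. \<phi> x - \<psi> x) \<in> L2"
  using L2_add[OF assms(1) L2_cmult[OF assms(2), of "-1"]] by simp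

lemma L2_inner_integrable:
  assumes "\<phi> \<in> L2" "\<psi> \<in> L2" shows "integrable lebesgue (\<lambda>x. cnj (\<phi> x) * \<psi> x)"
proof (rule Bochner_Integration.integrable_bound)
  note [measurable] = assms[THEN L2_measurable]
  show "(\<lambda>x. cnj (\<phi> x) * \<psi> x) \<in> borel_measurable lebesgue" by measurable
  show "integrable lebesgue (\<lambda>x. (cmod (\<phi> x))\<^sup>2 + (cmod (\<psi> x))\<^sup>2)"
    using assms L2_integrable by auto
  have "cmod a * cmod b \<le> (cmod a)\<^sup>2 + (cmod b)\<^sup>2" for a b
    using sum_squares_ge_zero[of "cmod a - cmod b" 0] mult_nonneg_nonneg[of "cmod a" "cmod b"]
    by (simp add: power2_eq_square algebra_simps del: mult_nonneg_nonneg zero_le_mult_iff)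
  then show "AE x in lebesgue. norm (cnj (\<phi> x) * \<psi> x) \<le> norm ((cmod (\<phi> x))\<^sup>2 + (cmod (\<psi> x))\<^sup>2)"
    by (simp add: norm_mult)
qed

lemma l2_inner_self: "l2_inner \<psi> \<psi> = of_real (l2_sq \<psi>)"
proof -
  have "(\<lambda>x. cnj (\<psi> x) * \<psi> x) = (\<lambda>x. complex_of_real ((cmod (\<psi> x))\<^sup>2))"
    by (rule ext) (metis complex_norm_square mult.commute of_real_power)
  then show ?thesis unfolding l2_inner_def l2_sq_def by (simp only: integral_complex_of_real)
qed

lemma l2_sq_nonneg [simp]: "0 \<le> l2_sq \<psi>"
  by (simp add: l2_sq_def)

lemma l2_inner_cnj: "l2_inner \<psi> \<phi> = cnj (l2_inner \<phi> \<psi>)"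
proof -
  have "cnj (l2_inner \<phi> \<psi>) = (LINT x|lebesgue. cnj (cnj (\<phi> x) * \<psi> x))"
    unfolding l2_inner_def by (rule Bochner_Integration.integral_cnj[symmetric])
  then show ?thesis by (simp add: l2_inner_def mult.commute)
qed

lemma l2_inner_diff_right:
  assumes "\<phi> \<in> L2" "\<psi> \<in> L2" "\<eta> \<in> L2"
  shows "l2_inner \<phi> (\<lambda>x. \<psi> x - \<eta> x) = l2_inner \<phi> \<psi> - l2_inner \<phi> \<eta>"
  unfolding l2_inner_def
  by (simp add: right_diff_distrib Bochner_Integration.integral_diff assms L2_inner_integrable)

lemma l2_inner_diff_left:
  assumes "\<phi> \<in> L2" "\<psi> \<in> L2" "\<eta> \<in> L2"
  shows "l2_inner (\<lambda>x. \<psi> x - \<eta> x) \<phi> = l2_inner \<psi> \<phi> - l2_inner \<eta> \<phi>"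
  using l2_inner_diff_right[OF assms] l2_inner_cnj[of _ \<phi>] by simp

lemma l2_sq_eq_0:
  assumes "\<psi> \<in> L2" "l2_sq \<psi> = 0" shows "AE x in lebesgue. \<psi> x = 0"
  using assms integral_nonneg_eq_0_iff_AE[OF L2_integrable[OF assms(1)]]
  by (auto simp: l2_sq_def)

lemma L2_cong_AE:
  assumes "\<psi> \<in> L2" "AE x in lebesgue. \<phi> x = \<psi> x" shows "\<phi> \<in> L2"
proof -
  have 1: "\<phi> \<in> borel_measurable lebesgue"
    by (rule lebesgue_measurable_AE_cong) (use assms L2_measurable in auto)
  then show ?thesis using assms unfolding L2_def
    by (auto intro: integrable_cong_AE_imp elim: eventually_mono)
qed

lemma nn_integral_l2_sq:
  assumes "\<psi> \<in> L2" shows "(\<integral>\<^sup>+x. ennreal ((cmod (\<psi> x))\<^sup>2) \<partial>lebesgue) = ennreal (l2_sq \<psi>)"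
  unfolding l2_sq_def using L2_integrable[OF assms] by (simp add: nn_integral_eq_integral)

lemma l2_Cauchy_Schwarz:
  assumes "\<phi> \<in> L2" "\<psi> \<in> L2"
  shows "(cmod (l2_inner \<phi> \<psi>))\<^sup>2 \<le> l2_sq \<phi> * l2_sq \<psi>"
proof -
  note [measurable] = assms[THEN L2_measurable]
  have "cmod (l2_inner \<phi> \<psi>) \<le> (LINT x|lebesgue. cmod (\<phi> x) * cmod (\<psi> x))"
    unfolding l2_inner_def using integral_norm_bound[of lebesgue "\<lambda>x. cnj (\<phi> x) * \<psi> x"]
    by (simp add: norm_mult)
  also have "ennreal \<dots> = (\<integral>\<^sup>+x. ennreal (cmod (\<phi> x)) * ennreal (cmod (\<psi> x)) \<partial>lebesgue)"
    using integrable_norm[OF L2_inner_integrable[OF assms]]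
    by (subst nn_integral_eq_integral[symmetric]) (auto simp: norm_mult ennreal_mult)
  finally have *: "ennreal (cmod (l2_inner \<phi> \<psi>)) \<le> \<dots>" by (simp add: ennreal_leI)
  have "ennreal ((cmod (l2_inner \<phi> \<psi>))\<^sup>2) = (ennreal (cmod (l2_inner \<phi> \<psi>)))\<^sup>2"
    by (simp add: ennreal_power)
  also have "\<dots> \<le> (\<integral>\<^sup>+x. ennreal (cmod (\<phi> x)) * ennreal (cmod (\<psi> x)) \<partial>lebesgue)\<^sup>2"
    using * by (rule power_mono) simp
  also have "\<dots> \<le> (\<integral>\<^sup>+x. (ennreal (cmod (\<phi> x)))\<^sup>2 \<partial>lebesgue) * (\<integral>\<^sup>+x. (ennreal (cmod (\<psi> x)))\<^sup>2 \<partial>lebesgue)"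
    by (rule Cauchy_Schwarz_nn_integral) measurable
  also have "\<dots> = ennreal (l2_sq \<phi> * l2_sq \<psi>)"
    using nn_integral_l2_sq[OF assms(1)] nn_integral_l2_sq[OF assms(2)]
    by (simp add: ennreal_power ennreal_mult)
  finally show ?thesis by (simp add: ennreal_le_iff)
qed

lemma l2_sq_add_le:
  assumes "\<phi> \<in> L2" "\<psi> \<in> L2"
  shows "l2_sq (\<lambda>x. \<phi> x + \<psi> x) \<le> 2 * l2_sq \<phi> + 2 * l2_sq \<psi>"
proof -
  have "l2_sq (\<lambda>x. \<phi> x + \<psi> x) \<le> (LINT x|lebesgue. 2 * (cmod (\<phi> x))\<^sup>2 + 2 * (cmod (\<psi> x))\<^sup>2)"
    unfolding l2_sq_def
    by (rule integral_mono) (use assms L2_add L2_integrable in \<open>auto simp: cmod_add_sq_le\<close>)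
  then show ?thesis unfolding l2_sq_def using assms L2_integrable by simp
qed

lemma l2_inner_limit_right:
  assumes "\<phi> \<in> L2" "\<psi> \<in> L2" "\<And>n. X n \<in> L2" "l2_limit X \<psi>"
  shows "(\<lambda>n. l2_inner \<phi> (X n)) \<longlonglongrightarrow> l2_inner \<phi> \<psi>"
proof -
  have "(\<lambda>n. sqrt (l2_sq \<phi> * l2_sq (\<lambda>x. \<psi> x - X n x))) \<longlonglongrightarrow> sqrt (l2_sq \<phi> * 0)"
    using assms(4) unfolding l2_limit_def by (intro tendsto_intros)
  then have 1: "(\<lambda>n. sqrt (l2_sq \<phi> * l2_sq (\<lambda>x. \<psi> x - X n x))) \<longlonglongrightarrow> 0" by simp
  have "(\<lambda>n. l2_inner \<phi> \<psi> - l2_inner \<phi> (X n)) \<longlonglongrightarrow> 0"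
  proof (rule Lim_null_comparison[OF _ 1], rule always_eventually, rule allI)
    fix n
    have "(cmod (l2_inner \<phi> \<psi> - l2_inner \<phi> (X n)))\<^sup>2 \<le> l2_sq \<phi> * l2_sq (\<lambda>x. \<psi> x - X n x)"
      using l2_Cauchy_Schwarz[OF assms(1) L2_diff[OF assms(2,3)]] assms(1-3)
      by (simp add: l2_inner_diff_right)
    then show "norm (l2_inner \<phi> \<psi> - l2_inner \<phi> (X n)) \<le> sqrt (l2_sq \<phi> * l2_sq (\<lambda>x. \<psi> x - X n x))"
      by (simp add: real_le_rsqrt)
  qed
  from tendsto_diff[OF tendsto_const[of "l2_inner \<phi> \<psi>"] this] show ?thesis by simp
qed

lemma l2_sq_diff_expand:
  assumes "\<phi> \<in> L2" "\<psi> \<in> L2"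
  shows "l2_sq (\<lambda>x. \<phi> x - \<psi> x) = l2_sq \<phi> + l2_sq \<psi> - 2 * Re (l2_inner \<phi> \<psi>)"
proof -
  have "of_real (l2_sq (\<lambda>x. \<phi> x - \<psi> x)) = l2_inner (\<lambda>x. \<phi> x - \<psi> x) (\<lambda>x. \<phi> x - \<psi> x)"
    by (simp add: l2_inner_self)
  also have "\<dots> = of_real (l2_sq \<phi>) - l2_inner \<psi> \<phi> - l2_inner \<phi> \<psi> + of_real (l2_sq \<psi>)"
    using assms unfolding l2_inner_diff_right[OF L2_diff[OF assms] assms]
    by (simp add: l2_inner_diff_left l2_inner_self)
  finally have "l2_sq (\<lambda>x. \<phi> x - \<psi> x) = Re (of_real (l2_sq \<phi>) - l2_inner \<psi> \<phi> - l2_inner \<phi> \<psi> + of_real (l2_sq \<psi>))"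
    by (metis Re_complex_of_real)
  then show ?thesis using l2_inner_cnj[of \<psi> \<phi>] by simp
qed

lemma l2_sq_limit:
  assumes "\<psi> \<in> L2" "\<And>n. X n \<in> L2" "l2_limit X \<psi>"
  shows "(\<lambda>n. l2_sq (X n)) \<longlonglongrightarrow> l2_sq \<psi>"
proof -
  have "(\<lambda>n. l2_sq (\<lambda>x. \<psi> x - X n x) - l2_sq \<psi> + 2 * Re (l2_inner \<psi> (X n))) \<longlonglongrightarrow> 0 - l2_sq \<psi> + 2 * Re (l2_inner \<psi> \<psi>)"
    using assms(3) unfolding l2_limit_def
    by (intro tendsto_intros l2_inner_limit_right assms)
  then show ?thesis using assms by (simp add: l2_sq_diff_expand l2_inner_self)
qed

text \<open>The norms of the \<open>X n\<close> converge, hence are bounded, so the Cauchy--Schwarz inequality controls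
  the change in the second argument uniformly in the first.\<close>

lemma l2_inner_limit:
  assumes "\<phi> \<in> L2" "\<psi> \<in> L2" "\<And>n. X n \<in> L2" "\<And>n. Y n \<in> L2" "l2_limit X \<phi>" "l2_limit Y \<psi>"
  shows "(\<lambda>n. l2_inner (X n) (Y n)) \<longlonglongrightarrow> l2_inner \<phi> \<psi>"
proof -
  have lim: "(\<lambda>n. sqrt (l2_sq (X n)) * sqrt (l2_sq (\<lambda>x. \<psi> x - Y n x))) \<longlonglongrightarrow> sqrt (l2_sq \<phi>) * sqrt 0"
    using assms(6) unfolding l2_limit_def
    by (intro tendsto_mult tendsto_real_sqrt l2_sq_limit assms)
  then have 1: "(\<lambda>n. sqrt (l2_sq (X n) * l2_sq (\<lambda>x. \<psi> x - Y n x))) \<longlonglongrightarrow> 0"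
    by (simp add: real_sqrt_mult)
  have "(\<lambda>n. l2_inner (X n) \<psi> - l2_inner (X n) (Y n)) \<longlonglongrightarrow> 0"
  proof (rule Lim_null_comparison[OF _ 1], rule always_eventually, rule allI)
    fix n
    have "(cmod (l2_inner (X n) \<psi> - l2_inner (X n) (Y n)))\<^sup>2 \<le> l2_sq (X n) * l2_sq (\<lambda>x. \<psi> x - Y n x)"
      using l2_Cauchy_Schwarz[OF assms(3) L2_diff[OF assms(2,4)]] assms(1-4)
      by (simp add: l2_inner_diff_right)
    then show "norm (l2_inner (X n) \<psi> - l2_inner (X n) (Y n)) \<le> sqrt (l2_sq (X n) * l2_sq (\<lambda>x. \<psi> x - Y n x))"
      by (simp add: real_le_rsqrt)
  qed
  moreover have "(\<lambda>n. l2_inner (X n) \<psi>) \<longlonglongrightarrow> l2_inner \<phi> \<psi>"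
    using tendsto_cnj[OF l2_inner_limit_right[OF assms(2,1,3,5)]] by (simp flip: l2_inner_cnj)
  ultimately show ?thesis using tendsto_diff by fastforce
qed

lemma l2_sq_cong_AE:
  assumes "\<psi> \<in> L2" "AE x in lebesgue. \<phi> x = \<psi> x" shows "l2_sq \<phi> = l2_sq \<psi>"
  unfolding l2_sq_def
  by (rule integral_cong_AE) (use assms L2_cong_AE[OF assms] L2_measurable in \<open>auto elim: eventually_mono\<close>)

lemma l2_inner_cong_AE:
  assumes "\<phi> \<in> L2" "\<psi> \<in> L2" "AE x in lebesgue. \<phi>' x = \<phi> x" "AE x in lebesgue. \<psi>' x = \<psi> x"
  shows "l2_inner \<phi>' \<psi>' = l2_inner \<phi> \<psi>"
proof -
  note [measurable] = assms(1,2)[THEN L2_measurable]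
    L2_cong_AE[OF assms(1,3), THEN L2_measurable] L2_cong_AE[OF assms(2,4), THEN L2_measurable]
  show ?thesis unfolding l2_inner_def
  proof (rule integral_cong_AE)
    show "AE x in lebesgue. cnj (\<phi>' x) * \<psi>' x = cnj (\<phi> x) * \<psi> x"
      using assms(3,4) by eventually_elim simp
  qed measurable
qed


section \<open>Gaussian damping of Fourier integrals\<close>

lemma integrable_bounded_kernel:
  fixes A :: "'a::euclidean_space \<Rightarrow> complex" and B :: "'b::euclidean_space \<Rightarrow> complex"
  assumes A: "integrable lborel A" and B: "integrable lborel B"
    and k [measurable]: "case_prod k \<in> borel_measurable (lborel \<Otimes>\<^sub>M lborel)"
    and C: "\<And>s t. cmod (k s t) \<le> C"
  shows "integrable (lborel \<Otimes>\<^sub>M lborel) (\<lambda>(s, t). A s * (k s t * B t))"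
proof (rule integrableI_bounded)
  note [measurable] = borel_measurable_integrable[OF A] borel_measurable_integrable[OF B]
  show meas: "(\<lambda>(s, t). A s * (k s t * B t)) \<in> borel_measurable (lborel \<Otimes>\<^sub>M lborel)" by measurable
  have C0: "0 \<le> C" using C[of undefined undefined] norm_ge_zero order_trans by blast
  have "(\<integral>\<^sup>+z. ennreal (norm (case z of (s, t) \<Rightarrow> A s * (k s t * B t))) \<partial>(lborel \<Otimes>\<^sub>M lborel))
      = (\<integral>\<^sup>+s. \<integral>\<^sup>+t. ennreal (norm (A s * (k s t * B t))) \<partial>lborel \<partial>lborel)"
    using lborel.nn_integral_fst[of "\<lambda>z. ennreal (norm (case z of (s, t) \<Rightarrow> A s * (k s t * B t)))" lborel] meas by simp
  also have "\<dots> \<le> (\<integral>\<^sup>+s. \<integral>\<^sup>+t. ennreal C * ennreal (norm (A s)) * ennreal (norm (B t)) \<partial>lborel \<partial>lborel)"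
  proof (intro nn_integral_mono)
    fix s t
    have "norm (A s * (k s t * B t)) \<le> C * norm (A s) * norm (B t)"
      using mult_right_mono[OF C[of s t], of "norm (A s) * norm (B t)"] by (simp add: norm_mult ac_simps)
    then show "ennreal (norm (A s * (k s t * B t))) \<le> ennreal C * ennreal (norm (A s)) * ennreal (norm (B t))"
      using C0 by (simp add: ennreal_mult[symmetric] ennreal_leI)
  qed
  also have "\<dots> = ennreal C * (\<integral>\<^sup>+s. ennreal (norm (A s)) \<partial>lborel) * (\<integral>\<^sup>+t. ennreal (norm (B t)) \<partial>lborel)"
    by (simp add: nn_integral_cmult nn_integral_multc)
  also have "\<dots> < \<infinity>"
    using A B by (auto simp: integrable_iff_bounded ennreal_mult_less_top)
  finally show "(\<integral>\<^sup>+z. ennreal (norm (case z of (s, t) \<Rightarrow> A s * (k s t * B t))) \<partial>(lborel \<Otimes>\<^sub>M lborel)) < \<infinity>" .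
qed

text \<open>The form of Fubini's theorem used throughout: two integrable factors in separate variables,
  coupled only by a bounded kernel, which is mostly an exponential or an indicator.\<close>

lemma integral_swap_bounded_kernel:
  fixes A :: "'a::euclidean_space \<Rightarrow> complex" and B :: "'b::euclidean_space \<Rightarrow> complex"
  assumes A: "integrable lborel A" and B: "integrable lborel B"
    and k [measurable]: "case_prod k \<in> borel_measurable (lborel \<Otimes>\<^sub>M lborel)"
    and C: "\<And>s t. cmod (k s t) \<le> C"
  shows "(LINT s|lborel. A s * (LINT t|lborel. k s t * B t)) = (LINT t|lborel. B t * (LINT s|lborel. k s t * A s))"
proof -
  have "(LINT s|lborel. A s * (LINT t|lborel. k s t * B t)) = (LINT s|lborel. LINT t|lborel. A s * (k s t * B t))"
    by simp
  also have "\<dots> = (LINT t|lborel. LINT s|lborel. A s * (k s t * B t))"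
    by (rule lborel_pair.Fubini_integral[symmetric]) (rule integrable_bounded_kernel[OF assms])
  also have "\<dots> = (LINT t|lborel. LINT s|lborel. B t * (k s t * A s))" by (simp add: ac_simps)
  finally show ?thesis by simp
qed

lemma integrable_mult_bounded:
  fixes f m :: "'a \<Rightarrow> complex"
  assumes "integrable M f" and [measurable]: "m \<in> borel_measurable M" and "\<And>x. cmod (m x) \<le> C"
  shows "integrable M (\<lambda>x. m x * f x)"
proof (rule Bochner_Integration.integrable_bound)
  show "integrable M (\<lambda>x. C * cmod (f x))" using assms(1) by simp
  note [measurable] = borel_measurable_integrable[OF assms(1)]
  show "(\<lambda>x. m x * f x) \<in> borel_measurable M" by measurable
  have "cmod (m x * f x) \<le> C * cmod (f x)" for x
    using assms(3) by (simp add: norm_mult mult_right_mono)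
  then show "AE x in M. norm (m x * f x) \<le> norm (C * cmod (f x))"
    by (auto intro: order_trans[OF _ abs_ge_self])
qed

text \<open>Fubini's theorem is applied to Lebesgue measure on Borel sets; a square-integrable function is
  therefore replaced by a Borel representative first.\<close>

lemma lebesgue_AE_borel:
  fixes v :: "real \<Rightarrow> complex"
  assumes [measurable]: "v \<in> borel_measurable lebesgue"
  obtains w where "w \<in> borel_measurable borel" "AE x in lebesgue. v x = w x"
proof -
  have "(\<lambda>x. Re (v x)) \<in> borel_measurable (completion lborel)" "(\<lambda>x. Im (v x)) \<in> borel_measurable (completion lborel)"
    by measurable
  then obtain r i where r: "r \<in> borel_measurable lborel" "AE x in lborel. Re (v x) = r x"
    and i: "i \<in> borel_measurable lborel" "AE x in lborel. Im (v x) = i x"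
    using completion_ex_borel_measurable_real by metis
  have "AE x in lebesgue. v x = Complex (r x) (i x)"
    using r(2)[THEN AE_completion] i(2)[THEN AE_completion] by eventually_elim (simp add: complex_eq_iff)
  moreover have "(\<lambda>x. Complex (r x) (i x)) \<in> borel_measurable borel"
    using r i by (simp add: borel_measurable_complex_iff)
  ultimately show ?thesis by (rule that[rotated])
qed

definition gaussian :: "real \<Rightarrow> complex" where
  "gaussian x = complex_of_real (exp (- x\<^sup>2 / 2))"

lemma std_normal_density_gaussian: "complex_of_real (std_normal_density x) = gaussian x / sqrt (2 * pi)"
  by (simp add: gaussian_def std_normal_density_def)

lemma gaussian_measurable [measurable]: "gaussian \<in> borel_measurable borel"
  unfolding gaussian_def by measurable

lemma gaussian_integrable: "integrable lborel gaussian"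
proof -
  have "integrable lborel (\<lambda>x. complex_of_real (std_normal_density x))"
    using integrable_normal_density[of 1 0] by simp
  from integrable_mult_right[OF this, of "sqrt (2*pi)"] show ?thesis
    by (simp add: std_normal_density_gaussian)
qed

lemma gaussian_scaled_integrable: "e > 0 \<Longrightarrow> integrable lborel (\<lambda>x. gaussian (e * x))"
  using lborel_integrable_real_affine[OF gaussian_integrable, of e 0] by simp

text \<open>A rescaling of the characteristic function of the standard normal distribution.\<close>

lemma fourier_gaussian:
  assumes "e > 0"
  shows "(LINT x|lborel. iexp (d * x) * gaussian (e * x)) = sqrt (2 * pi) / e * gaussian (d / e)"
proof -
  have "char std_normal_distribution (d / e) = gaussian (d / e)"
    by (simp add: char_std_normal_distribution gaussian_def)
  moreover have "char std_normal_distribution (d / e) = (LINT x|lborel. std_normal_density x *\<^sub>R iexp (d / e * x))"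
    unfolding char_def by (subst integral_density) auto
  moreover have "\<dots> = (LINT x|lborel. iexp (d / e * x) * gaussian x / sqrt (2 * pi))"
    by (intro Bochner_Integration.integral_cong) (simp_all add: scaleR_conv_of_real std_normal_density_gaussian)
  ultimately have "(LINT x|lborel. iexp (d / e * x) * gaussian x) = sqrt (2 * pi) * gaussian (d / e)"
    by (simp add: field_simps)
  moreover have "(LINT x|lborel. iexp (d / e * x) * gaussian x)
      = \<bar>e\<bar> *\<^sub>R (LINT x|lborel. iexp (d / e * (0 + e * x)) * gaussian (0 + e * x))"
    by (rule lborel_integral_real_affine) (use assms in simp)
  ultimately show ?thesis using assms by (simp add: scaleR_conv_of_real field_simps)
qed

text \<open>The convolution of \<open>w\<close> with the centred normal density of standard deviation \<open>e\<close>, written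
  with a standard normal variable so that the limit \<open>e \<longrightarrow> 0\<close> can be taken under the integral.\<close>

definition smoothing :: "real \<Rightarrow> (real \<Rightarrow> complex) \<Rightarrow> real \<Rightarrow> complex" where
  "smoothing e w x = (LINT z|lborel. complex_of_real (std_normal_density z) * w (x - e * z))"

lemma fourier_integral_lborel:
  assumes "w \<in> borel_measurable borel"
  shows "fourier_integral w \<xi> = (LINT x|lborel. (iexp (- (\<xi> * x)) / sqrt (2 * pi)) * w x)"
proof -
  have "(\<lambda>x. exp (- (\<i> * of_real \<xi> * of_real x)) * w x) \<in> borel_measurable lborel" using assms by measurable
  from integral_completion[OF this] have "fourier_integral w \<xi> = of_real (1 / sqrt (2 * pi)) * (LINT x|lborel. exp (- (\<i> * of_real \<xi> * of_real x)) * w x)"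
    by (simp only: fourier_integral_def)
  then show ?thesis by (simp add: mult.assoc)
qed

lemma fourier_kernel_bound: "cmod (iexp t / complex_of_real (sqrt (2 * pi))) \<le> 1"
proof -
  have "1 \<le> sqrt (2 * pi)" using pi_gt3 by (simp add: real_le_rsqrt)
  then show ?thesis by (simp add: norm_divide)
qed

lemma fourier_integral_measurable [measurable]:
  assumes [measurable]: "w \<in> borel_measurable borel"
  shows "fourier_integral w \<in> borel_measurable borel"
proof -
  have "(\<lambda>\<xi>. LINT x|lborel. (iexp (- (\<xi> * x)) / sqrt (2 * pi)) * w x) \<in> borel_measurable borel"
    by measurable
  then show ?thesis using fourier_integral_lborel[OF assms] by (simp cong: measurable_cong)
qed

lemma fourier_integral_bound:
  assumes w: "integrable lborel w"
  shows "cmod (fourier_integral w \<xi>) \<le> (LINT x|lborel. cmod (w x))"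
proof -
  have wb [measurable]: "w \<in> borel_measurable borel" using borel_measurable_integrable[OF w] by simp
  have "cmod (fourier_integral w \<xi>) \<le> (LINT x|lborel. cmod ((iexp (- (\<xi> * x)) / sqrt (2 * pi)) * w x))"
    unfolding fourier_integral_lborel[OF wb] by (rule integral_norm_bound)
  also have "\<dots> \<le> (LINT x|lborel. cmod (w x))"
  proof (rule integral_mono)
    show "integrable lborel (\<lambda>x. cmod ((iexp (- (\<xi> * x)) / sqrt (2 * pi)) * w x))"
      by (rule integrable_norm, rule integrable_mult_bounded[OF w _ fourier_kernel_bound], measurable)
    show "cmod ((iexp (- (\<xi> * x)) / sqrt (2 * pi)) * w x) \<le> cmod (w x)" for x
      unfolding norm_mult by (rule mult_left_le_one_le[OF norm_ge_zero norm_ge_zero fourier_kernel_bound])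
  qed (use w in simp)
  finally show ?thesis .
qed

text \<open>Without the Gaussian factor the three integrals in \<open>|fourier_integral w|\<^sup>2\<close> may not be
  interchanged.  With it, the integral over the frequency is the Gaussian of \<open>fourier_gaussian\<close>, an
  approximate identity in the difference of the two remaining variables.\<close>

lemma damped_plancherel:
  assumes w: "integrable lborel w" and e: "e > 0"
  shows "(LINT \<xi>|lborel. gaussian (e * \<xi>) * (cnj (fourier_integral w \<xi>) * fourier_integral w \<xi>))
       = (LINT x|lborel. cnj (w x) * smoothing e w x)"
proof -
  have wb [measurable]: "w \<in> borel_measurable borel" using borel_measurable_integrable[OF w] by simp
  let ?E = "\<lambda>\<xi>. gaussian (e * \<xi>)" and ?W = "fourier_integral w" and ?c = "complex_of_real (sqrt (2 * pi))"
  have E: "integrable lborel ?E" using e by (rule gaussian_scaled_integrable)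
  have EW: "integrable lborel (\<lambda>\<xi>. ?W \<xi> * ?E \<xi>)"
    by (rule integrable_mult_bounded[OF E _ fourier_integral_bound[OF w]]) auto
  have cw: "integrable lborel (\<lambda>x. cnj (w x))" using w by simp
  have sm: "(LINT \<xi>|lborel. (iexp (\<xi> * x) / ?c) * (?W \<xi> * ?E \<xi>)) = smoothing e w x" for x
  proof -
    have "(LINT \<xi>|lborel. (iexp (\<xi> * x) / ?c) * (?W \<xi> * ?E \<xi>))
        = (LINT \<xi>|lborel. ?E \<xi> * (LINT y|lborel. (iexp (\<xi> * (x - y)) / (?c * ?c)) * w y))"
    proof (rule Bochner_Integration.integral_cong[OF refl])
      fix \<xi>
      have "(iexp (\<xi> * x) / ?c) * ?W \<xi> = (LINT y|lborel. (iexp (\<xi> * x) / ?c) * ((iexp (- (\<xi> * y)) / ?c) * w y))"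
        by (simp add: fourier_integral_lborel)
      also have "\<dots> = (LINT y|lborel. (iexp (\<xi> * (x - y)) / (?c * ?c)) * w y)"
        by (intro Bochner_Integration.integral_cong refl) (simp add: exp_minus right_diff_distrib exp_diff field_simps)
      finally have eq: "(iexp (\<xi> * x) / ?c) * ?W \<xi> = (LINT y|lborel. (iexp (\<xi> * (x - y)) / (?c * ?c)) * w y)" .
      have "(iexp (\<xi> * x) / ?c) * (?W \<xi> * ?E \<xi>) = ?E \<xi> * ((iexp (\<xi> * x) / ?c) * ?W \<xi>)"
        by (simp only: ac_simps)
      then show "(iexp (\<xi> * x) / ?c) * (?W \<xi> * ?E \<xi>) = ?E \<xi> * (LINT y|lborel. (iexp (\<xi> * (x - y)) / (?c * ?c)) * w y)"
        unfolding eq .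
    qed
    also have "\<dots> = (LINT y|lborel. w y * (LINT \<xi>|lborel. (iexp (\<xi> * (x - y)) / (?c * ?c)) * ?E \<xi>))"
    proof (rule integral_swap_bounded_kernel[OF E w, where C = 1])
      have "1 \<le> 2 * pi" using pi_gt3 by simp
      then show "cmod (iexp (s * (x - t)) / (?c * ?c)) \<le> 1" for s t
        by (simp add: norm_divide flip: of_real_mult)
    qed measurable
    also have "\<dots> = (LINT y|lborel. w y * (gaussian ((x - y) / e) / (e * ?c)))"
    proof (rule Bochner_Integration.integral_cong[OF refl])
      fix y
      have "(LINT \<xi>|lborel. (iexp (\<xi> * (x - y)) / (?c * ?c)) * ?E \<xi>)
          = (LINT \<xi>|lborel. iexp ((x - y) * \<xi>) * ?E \<xi>) / (?c * ?c)"
        by (simp add: mult.commute flip: integral_divide_zero)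
      also have "\<dots> = gaussian ((x - y) / e) / (e * ?c)"
        unfolding fourier_gaussian[OF e] using e by (simp add: field_simps)
      finally show "w y * (LINT \<xi>|lborel. (iexp (\<xi> * (x - y)) / (?c * ?c)) * ?E \<xi>) = w y * (gaussian ((x - y) / e) / (e * ?c))"
        by simp
    qed
    also have "\<dots> = \<bar>- e\<bar> *\<^sub>R (LINT z|lborel. w (x + - e * z) * (gaussian ((x - (x + - e * z)) / e) / (e * ?c)))"
      by (rule lborel_integral_real_affine) (use e in simp)
    also have "\<dots> = (LINT z|lborel. e *\<^sub>R (w (x + - e * z) * (gaussian ((x - (x + - e * z)) / e) / (e * ?c))))"
      using e by simp
    also have "\<dots> = smoothing e w x"
      unfolding smoothing_def
      by (intro Bochner_Integration.integral_cong refl)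
         (use e in \<open>simp add: std_normal_density_gaussian scaleR_conv_of_real field_simps\<close>)
    finally show ?thesis .
  qed
  have "cnj (?W \<xi>) = (LINT x|lborel. (iexp (\<xi> * x) / ?c) * cnj (w x))" for \<xi>
    unfolding fourier_integral_lborel[OF wb]
    by (subst Bochner_Integration.integral_cnj[symmetric]) (simp add: exp_cnj)
  then have "(LINT \<xi>|lborel. ?E \<xi> * (cnj (?W \<xi>) * ?W \<xi>))
      = (LINT \<xi>|lborel. (?W \<xi> * ?E \<xi>) * (LINT x|lborel. (iexp (\<xi> * x) / ?c) * cnj (w x)))"
    by (intro Bochner_Integration.integral_cong refl) (simp add: ac_simps)
  also have "\<dots> = (LINT x|lborel. cnj (w x) * (LINT \<xi>|lborel. (iexp (\<xi> * x) / ?c) * (?W \<xi> * ?E \<xi>)))"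
    by (rule integral_swap_bounded_kernel[OF EW cw _ fourier_kernel_bound]) measurable
  finally show ?thesis by (simp only: sm)
qed


section \<open>The Fourier integral is a contraction\<close>

lemma norm_integral_le_nn_integral:
  fixes f :: "'a \<Rightarrow> 'b::{banach, second_countable_topology}"
  shows "ennreal (norm (integral\<^sup>L M f)) \<le> (\<integral>\<^sup>+x. ennreal (norm (f x)) \<partial>M)"
  by (cases "integrable M f") (auto intro: integral_norm_bound_ennreal simp: not_integrable_integral_eq)

lemma nn_integral_gaussian_weight: "(\<integral>\<^sup>+z. ennreal (std_normal_density z) \<partial>lborel) = 1"
  using nn_integral_eq_integral[of lborel "std_normal_density"] by simp

text \<open>\<open>|w x| |w (x - e z)|\<close> is at most the mean of the two squares, and the integral of each square
  against the normal density is the squared norm of \<open>w\<close>, because Lebesgue measure is invariant under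
  translations.\<close>

lemma smoothing_pairing_bound:
  assumes [measurable]: "w \<in> borel_measurable borel" and e: "e > 0"
  shows "ennreal (cmod (LINT x|lborel. cnj (w x) * smoothing e w x)) \<le> (\<integral>\<^sup>+x. ennreal ((cmod (w x))\<^sup>2) \<partial>lborel)"
proof -
  have half: "ennreal (c * (n * a) + c * (n * b)) = ennreal c * (ennreal n * ennreal a) + ennreal c * (ennreal n * ennreal b)"
    if "0 \<le> c" "0 \<le> n" "0 \<le> a" "0 \<le> b" for c n a b :: real
    using that by (simp add: ennreal_mult)
  let ?n = "\<lambda>z. ennreal (std_normal_density z)" and ?s = "\<lambda>x. ennreal ((cmod (w x))\<^sup>2)"
  let ?N = "\<integral>\<^sup>+x. ?s x \<partial>lborel"
  have "ennreal (cmod (LINT x|lborel. cnj (w x) * smoothing e w x))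
      \<le> (\<integral>\<^sup>+x. ennreal (norm (LINT z|lborel. cnj (w x) * (complex_of_real (std_normal_density z) * w (x - e * z)))) \<partial>lborel)"
    unfolding smoothing_def
    using norm_integral_le_nn_integral[of lborel "\<lambda>x. LINT z|lborel. cnj (w x) * (complex_of_real (std_normal_density z) * w (x - e * z))"]
    by simp
  also have "\<dots> \<le> (\<integral>\<^sup>+x. \<integral>\<^sup>+z. ennreal (norm (cnj (w x) * (complex_of_real (std_normal_density z) * w (x - e * z)))) \<partial>lborel \<partial>lborel)"
    by (intro nn_integral_mono norm_integral_le_nn_integral)
  also have "\<dots> \<le> (\<integral>\<^sup>+x. \<integral>\<^sup>+z. ennreal (1/2) * (?n z * ?s x) + ennreal (1/2) * (?n z * ?s (x - e * z)) \<partial>lborel \<partial>lborel)"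
  proof (intro nn_integral_mono)
    fix x z
    have "0 \<le> (cmod (w x) - cmod (w (x - e * z)))\<^sup>2" by simp
    then have "cmod (w x) * cmod (w (x - e * z)) \<le> 1/2 * (cmod (w x))\<^sup>2 + 1/2 * (cmod (w (x - e * z)))\<^sup>2"
      by (simp add: power2_eq_square algebra_simps)
    from mult_left_mono[OF this normal_density_nonneg[of 0 1 z]]
    have "norm (cnj (w x) * (complex_of_real (std_normal_density z) * w (x - e * z)))
        \<le> 1/2 * (std_normal_density z * (cmod (w x))\<^sup>2) + 1/2 * (std_normal_density z * (cmod (w (x - e * z)))\<^sup>2)"
      by (simp add: norm_mult algebra_simps)
    then show "ennreal (norm (cnj (w x) * (complex_of_real (std_normal_density z) * w (x - e * z))))
        \<le> ennreal (1/2) * (?n z * ?s x) + ennreal (1/2) * (?n z * ?s (x - e * z))"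
      using half[of "1/2" "std_normal_density z" "(cmod (w x))\<^sup>2" "(cmod (w (x - e * z)))\<^sup>2"]
      by (metis ennreal_leI normal_density_nonneg zero_le_power2 zero_le_divide_1_iff zero_le_numeral)
  qed
  also have "\<dots> = ennreal (1/2) * (\<integral>\<^sup>+x. \<integral>\<^sup>+z. ?n z * ?s x \<partial>lborel \<partial>lborel)
      + ennreal (1/2) * (\<integral>\<^sup>+x. \<integral>\<^sup>+z. ?n z * ?s (x - e * z) \<partial>lborel \<partial>lborel)"
    by (simp add: nn_integral_add nn_integral_cmult)
  also have "(\<integral>\<^sup>+x. \<integral>\<^sup>+z. ?n z * ?s x \<partial>lborel \<partial>lborel) = ?N"
    by (simp add: nn_integral_multc nn_integral_gaussian_weight)
  also have "(\<integral>\<^sup>+x. \<integral>\<^sup>+z. ?n z * ?s (x - e * z) \<partial>lborel \<partial>lborel) = (\<integral>\<^sup>+z. \<integral>\<^sup>+x. ?n z * ?s (x - e * z) \<partial>lborel \<partial>lborel)"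
    by (rule lborel_pair.Fubini') measurable
  also have "\<dots> = (\<integral>\<^sup>+z. ?n z * ?N \<partial>lborel)"
  proof (rule nn_integral_cong)
    fix z
    have "(\<integral>\<^sup>+x. ?s (x - e * z) \<partial>lborel) = ?N"
      using nn_integral_real_affine[of ?s 1 "- e * z"] by (simp add: add.commute)
    then show "(\<integral>\<^sup>+x. ?n z * ?s (x - e * z) \<partial>lborel) = ?n z * ?N"
      by (simp add: nn_integral_cmult)
  qed
  also have "\<dots> = ?N"
    by (simp add: nn_integral_multc nn_integral_gaussian_weight)
  also have "ennreal (1/2) * ?N + ennreal (1/2) * ?N = ?N"
  proof -
    have "ennreal (1/2) + ennreal (1/2) = 1" by (subst ennreal_plus[symmetric]) auto
    then show ?thesis unfolding distrib_right[symmetric] by (simp only: mult_1)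
  qed
  finally show ?thesis .
qed

lemma damped_nn_integral:
  assumes w: "integrable lborel w" and e: "e > 0"
  shows "(\<integral>\<^sup>+\<xi>. ennreal (exp (- (e * \<xi>)\<^sup>2 / 2) * (cmod (fourier_integral w \<xi>))\<^sup>2) \<partial>lborel)
       = ennreal (cmod (LINT x|lborel. cnj (w x) * smoothing e w x))"
proof -
  have wb [measurable]: "w \<in> borel_measurable borel" using borel_measurable_integrable[OF w] by simp
  let ?f = "\<lambda>\<xi>. exp (- (e * \<xi>)\<^sup>2 / 2) * (cmod (fourier_integral w \<xi>))\<^sup>2"
  have eq: "gaussian (e * \<xi>) * (cnj (fourier_integral w \<xi>) * fourier_integral w \<xi>) = of_real (?f \<xi>)" for \<xi>
    unfolding gaussian_def of_real_mult complex_norm_square by (simp add: mult.commute)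
  have "integrable lborel (\<lambda>\<xi>. (cnj (fourier_integral w \<xi>) * fourier_integral w \<xi>) * gaussian (e * \<xi>))"
  proof (rule integrable_mult_bounded[OF gaussian_scaled_integrable[OF e]])
    show "cmod (cnj (fourier_integral w x) * fourier_integral w x)
       \<le> (LINT x|lborel. cmod (w x)) * (LINT x|lborel. cmod (w x))" for x
      using fourier_integral_bound[OF w, of x] by (simp add: norm_mult mult_mono)
  qed measurable
  then have "integrable lborel (\<lambda>\<xi>. gaussian (e * \<xi>) * (cnj (fourier_integral w \<xi>) * fourier_integral w \<xi>))"
    by (simp only: mult.commute)
  then have "integrable lborel (\<lambda>\<xi>. complex_of_real (?f \<xi>))" by (simp only: eq)
  then have int: "integrable lborel ?f" by (simp only: complex_of_real_integrable_eq)
  have "(LINT x|lborel. cnj (w x) * smoothing e w x) = (LINT \<xi>|lborel. complex_of_real (?f \<xi>))"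
    unfolding damped_plancherel[OF w e, symmetric] eq ..
  also have "\<dots> = complex_of_real (LINT \<xi>|lborel. ?f \<xi>)" by (rule integral_complex_of_real)
  finally have "cmod (LINT x|lborel. cnj (w x) * smoothing e w x) = (LINT \<xi>|lborel. ?f \<xi>)"
    by (simp add: integral_nonneg)
  then show ?thesis using int by (simp add: nn_integral_eq_integral)
qed

text \<open>Bessel's inequality.  As the damping is removed, Fatou's lemma keeps the bound.  Equality is
  proved for continuous functions first, and this contraction property carries it over to all limits in
  mean.\<close>

lemma fourier_contraction_borel:
  assumes w: "integrable lborel w"
  shows "(\<integral>\<^sup>+\<xi>. ennreal ((cmod (fourier_integral w \<xi>))\<^sup>2) \<partial>lborel) \<le> (\<integral>\<^sup>+x. ennreal ((cmod (w x))\<^sup>2) \<partial>lborel)"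
proof -
  have wb [measurable]: "w \<in> borel_measurable borel" using borel_measurable_integrable[OF w] by simp
  \<comment> \<open>The damping \<open>1/(n+1)\<close> tends to 0.\<close>
  let ?f = "\<lambda>n \<xi>. exp (- (inverse (real (Suc n)) * \<xi>)\<^sup>2 / 2) * (cmod (fourier_integral w \<xi>))\<^sup>2"
  have lim: "(\<lambda>n. ennreal (?f n \<xi>)) \<longlonglongrightarrow> ennreal ((cmod (fourier_integral w \<xi>))\<^sup>2)" for \<xi>
  proof (rule tendsto_ennrealI)
    have "(\<lambda>n. ?f n \<xi>) \<longlonglongrightarrow> exp (- (0 * \<xi>)\<^sup>2 / 2) * (cmod (fourier_integral w \<xi>))\<^sup>2"
      by (intro tendsto_intros LIMSEQ_inverse_real_of_nat) auto
    then show "(\<lambda>n. ?f n \<xi>) \<longlonglongrightarrow> (cmod (fourier_integral w \<xi>))\<^sup>2" by simp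
  qed
  have "(\<integral>\<^sup>+\<xi>. ennreal ((cmod (fourier_integral w \<xi>))\<^sup>2) \<partial>lborel) = (\<integral>\<^sup>+\<xi>. liminf (\<lambda>n. ennreal (?f n \<xi>)) \<partial>lborel)"
    by (intro nn_integral_cong lim_imp_Liminf[OF _ lim, symmetric]) simp
  also have "\<dots> \<le> liminf (\<lambda>n. \<integral>\<^sup>+\<xi>. ennreal (?f n \<xi>) \<partial>lborel)"
    by (rule nn_integral_liminf) measurable
  also have "\<dots> \<le> (\<integral>\<^sup>+x. ennreal ((cmod (w x))\<^sup>2) \<partial>lborel)"
  proof (rule Liminf_le)
    have "(\<integral>\<^sup>+\<xi>. ennreal (?f n \<xi>) \<partial>lborel) \<le> (\<integral>\<^sup>+x. ennreal ((cmod (w x))\<^sup>2) \<partial>lborel)" for n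
      by (subst damped_nn_integral[OF w]) (auto intro!: smoothing_pairing_bound)
    then show "\<forall>\<^sub>F n in sequentially. (\<integral>\<^sup>+\<xi>. ennreal (?f n \<xi>) \<partial>lborel) \<le> (\<integral>\<^sup>+x. ennreal ((cmod (w x))\<^sup>2) \<partial>lborel)"
      by (intro always_eventually allI)
  qed simp
  finally show ?thesis .
qed

text \<open>For bounded continuous \<open>w\<close> the smoothing converges pointwise to \<open>w\<close>, so the damped norms of the
  transform converge to the norm of \<open>w\<close>, and they never exceed the undamped norm.\<close>

lemma fourier_lower_bound_continuous:
  assumes cont: "continuous_on UNIV w" and w: "integrable lborel w" and w2: "integrable lborel (\<lambda>x. (cmod (w x))\<^sup>2)"
    and M: "\<And>x. cmod (w x) \<le> M"
  shows "(\<integral>\<^sup>+x. ennreal ((cmod (w x))\<^sup>2) \<partial>lborel) \<le> (\<integral>\<^sup>+\<xi>. ennreal ((cmod (fourier_integral w \<xi>))\<^sup>2) \<partial>lborel)"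
proof -
  have wb [measurable]: "w \<in> borel_measurable borel" using borel_measurable_integrable[OF w] by simp
  let ?e = "\<lambda>n. inverse (real (Suc n))"
  have dens: "integrable lborel (\<lambda>z. complex_of_real (std_normal_density z))" by simp
  have sm: "(\<lambda>n. smoothing (?e n) w x) \<longlonglongrightarrow> w x" for x
  proof -
    have "(\<lambda>n. LINT z|lborel. w (x - ?e n * z) * complex_of_real (std_normal_density z))
      \<longlonglongrightarrow> (LINT z|lborel. w x * complex_of_real (std_normal_density z))"
    proof (rule integral_dominated_convergence)
      show "integrable lborel (\<lambda>z. M * std_normal_density z)" by simp
      show "AE z in lborel. (\<lambda>n. w (x - ?e n * z) * complex_of_real (std_normal_density z))
           \<longlonglongrightarrow> w x * complex_of_real (std_normal_density z)"
      proof (rule AE_I2, rule tendsto_mult_right)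
        fix z
        have "isCont w x" using cont by (simp add: continuous_on_eq_continuous_at)
        moreover have "(\<lambda>n. x - ?e n * z) \<longlonglongrightarrow> x - 0 * z"
          by (intro tendsto_intros LIMSEQ_inverse_real_of_nat)
        ultimately show "(\<lambda>n. w (x - ?e n * z)) \<longlonglongrightarrow> w x"
          using isCont_tendsto_compose[of x w] by simp
      qed
      show "AE z in lborel. norm (w (x - ?e n * z) * complex_of_real (std_normal_density z)) \<le> M * std_normal_density z" for n
        using M by (simp add: norm_mult mult_right_mono)
    qed measurable
    then show ?thesis by (simp add: smoothing_def mult.commute)
  qed
  have smb: "cmod (smoothing e w x) \<le> M" for e x
  proof -
    have "integrable lborel (\<lambda>z. w (x - e * z) * complex_of_real (std_normal_density z))"
      by (rule integrable_mult_bounded[OF dens _ M]) measurable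
    then have int: "integrable lborel (\<lambda>z. complex_of_real (std_normal_density z) * w (x - e * z))"
      by (simp add: mult.commute)
    have "cmod (smoothing e w x) \<le> (LINT z|lborel. M * std_normal_density z)"
      unfolding smoothing_def
    proof (rule order_trans[OF integral_norm_bound integral_mono[OF integrable_norm[OF int]]])
      show "norm (complex_of_real (std_normal_density z) * w (x - e * z)) \<le> M * std_normal_density z" for z
        using mult_right_mono[OF M normal_density_nonneg, of "x - e * z" 0 1 z] by (simp add: norm_mult mult.commute)
    qed simp
    then show ?thesis by simp
  qed
  have "(\<lambda>n. LINT x|lborel. cnj (w x) * smoothing (?e n) w x) \<longlonglongrightarrow> (LINT x|lborel. cnj (w x) * w x)"
  proof (rule integral_dominated_convergence)
    show "integrable lborel (\<lambda>x. M * cmod (w x))" using w by simp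
    show "AE x in lborel. norm (cnj (w x) * smoothing (?e n) w x) \<le> M * cmod (w x)" for n
      using mult_right_mono[OF smb norm_ge_zero] by (intro AE_I2) (simp add: norm_mult mult.commute)
    show "AE x in lborel. (\<lambda>n. cnj (w x) * smoothing (?e n) w x) \<longlonglongrightarrow> cnj (w x) * w x"
      using sm by (auto intro!: tendsto_intros)
  qed (auto simp: smoothing_def)
  from tendsto_norm[OF this]
  have lim: "(\<lambda>n. ennreal (cmod (LINT x|lborel. cnj (w x) * smoothing (?e n) w x))) \<longlonglongrightarrow> ennreal (cmod (LINT x|lborel. cnj (w x) * w x))"
    by (rule tendsto_ennrealI)
  have "(\<lambda>x. cnj (w x) * w x) = (\<lambda>x. complex_of_real ((cmod (w x))\<^sup>2))"
    by (rule ext) (metis complex_norm_square mult.commute of_real_power)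
  then have "(LINT x|lborel. cnj (w x) * w x) = of_real (LINT x|lborel. (cmod (w x))\<^sup>2)"
    by (simp only: integral_complex_of_real)
  then have "ennreal (cmod (LINT x|lborel. cnj (w x) * w x)) = (\<integral>\<^sup>+x. ennreal ((cmod (w x))\<^sup>2) \<partial>lborel)"
    using w2 by (simp add: nn_integral_eq_integral)
  moreover have "ennreal (cmod (LINT x|lborel. cnj (w x) * smoothing (?e n) w x))
      \<le> (\<integral>\<^sup>+\<xi>. ennreal ((cmod (fourier_integral w \<xi>))\<^sup>2) \<partial>lborel)" for n
    by (subst damped_nn_integral[OF w, symmetric])
       (auto intro!: nn_integral_mono ennreal_leI mult_left_le_one_le)
  ultimately show ?thesis using LIMSEQ_le_const2[OF lim] by auto
qed

text \<open>The functions on which the Fourier integral exists literally and also lands in \<open>L2\<close>.\<close>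

definition L1_L2 :: "(real \<Rightarrow> complex) set" where
  "L1_L2 = {v \<in> L2. integrable lebesgue v}"

lemma L1_L2_D: "v \<in> L1_L2 \<Longrightarrow> v \<in> L2" "v \<in> L1_L2 \<Longrightarrow> integrable lebesgue v"
  by (auto simp: L1_L2_def)

lemma L1_L2_diff: "v \<in> L1_L2 \<Longrightarrow> w \<in> L1_L2 \<Longrightarrow> (\<lambda>x. v x - w x) \<in> L1_L2"
  by (auto simp: L1_L2_def L2_diff)

lemma fourier_kernel_integrable:
  assumes v: "integrable lebesgue v"
  shows "integrable lebesgue (\<lambda>x. exp (- (\<i> * of_real \<xi> * of_real x)) * v x)"
proof (rule integrable_mult_bounded[OF v, where C = 1])
  show "cmod (exp (- (\<i> * of_real \<xi> * of_real x))) \<le> 1" for x by simp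
  have "(\<lambda>x. exp (- (\<i> * of_real \<xi> * complex_of_real x))) \<in> borel_measurable lborel" by measurable
  then show "(\<lambda>x. exp (- (\<i> * of_real \<xi> * complex_of_real x))) \<in> borel_measurable lebesgue"
    by (rule measurable_completion)
qed

lemma fourier_integral_diff:
  assumes "integrable lebesgue v" "integrable lebesgue w"
  shows "fourier_integral (\<lambda>x. v x - w x) \<xi> = fourier_integral v \<xi> - fourier_integral w \<xi>"
  unfolding fourier_integral_def
  by (simp add: right_diff_distrib assms[THEN fourier_kernel_integrable])

lemma fourier_integral_cong_AE:
  assumes "v \<in> borel_measurable lebesgue" "AE x in lebesgue. w x = v x"
  shows "fourier_integral w = fourier_integral v"
proof
  fix \<xi>
  have "w \<in> borel_measurable lebesgue" using lebesgue_measurable_AE_cong[OF assms] .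
  note [measurable] = this assms(1)
  have "(\<lambda>x. exp (- (\<i> * of_real \<xi> * complex_of_real x))) \<in> borel_measurable lborel" by measurable
  then have [measurable]: "(\<lambda>x. exp (- (\<i> * of_real \<xi> * complex_of_real x))) \<in> borel_measurable lebesgue"
    by (rule measurable_completion)
  show "fourier_integral w \<xi> = fourier_integral v \<xi>"
    unfolding fourier_integral_def
    by (intro arg_cong2[where f = "(*)"] refl integral_cong_AE)
       (use assms(2) in \<open>auto elim: eventually_mono\<close>)
qed

lemma L1_L2_borel:
  assumes "v \<in> L1_L2"
  obtains w where "w \<in> borel_measurable borel" "integrable lborel w" "AE x in lebesgue. v x = w x"
    "fourier_integral w = fourier_integral v"
    "(\<integral>\<^sup>+x. ennreal ((cmod (w x))\<^sup>2) \<partial>lborel) = ennreal (l2_sq v)"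
proof -
  note [measurable] = L2_measurable[OF L1_L2_D(1)[OF assms]]
  obtain w where w [measurable]: "w \<in> borel_measurable borel" and eq: "AE x in lebesgue. v x = w x"
    by (rule lebesgue_AE_borel[OF L2_measurable[OF L1_L2_D(1)[OF assms]]])
  have wl: "w \<in> borel_measurable lebesgue" using measurable_completion[of w lborel borel] w by simp
  have "integrable lebesgue w"
    by (rule integrable_cong_AE_imp[OF L1_L2_D(2)[OF assms] wl]) (use eq in auto)
  then have 1: "integrable lborel w" by (simp add: integrable_completion)
  have 2: "fourier_integral w = fourier_integral v"
    by (rule fourier_integral_cong_AE) (use eq in \<open>auto elim: eventually_mono\<close>)
  have "ennreal (l2_sq v) = (\<integral>\<^sup>+x. ennreal ((cmod (v x))\<^sup>2) \<partial>lebesgue)"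
    using nn_integral_l2_sq[OF L1_L2_D(1)[OF assms]] by simp
  also have "\<dots> = (\<integral>\<^sup>+x. ennreal ((cmod (w x))\<^sup>2) \<partial>lebesgue)"
    by (rule nn_integral_cong_AE) (use eq in \<open>auto elim: eventually_mono\<close>)
  also have "\<dots> = (\<integral>\<^sup>+x. ennreal ((cmod (w x))\<^sup>2) \<partial>lborel)" by (rule nn_integral_completion)
  finally show ?thesis using that[OF w 1 eq 2] by simp
qed

lemma fourier_contraction:
  assumes "v \<in> L1_L2"
  shows "fourier_integral v \<in> L2" "l2_sq (fourier_integral v) \<le> l2_sq v"
proof -
  obtain w where w [measurable]: "w \<in> borel_measurable borel" "integrable lborel w" "AE x in lebesgue. v x = w x"
    "fourier_integral w = fourier_integral v"
    "(\<integral>\<^sup>+x. ennreal ((cmod (w x))\<^sup>2) \<partial>lborel) = ennreal (l2_sq v)"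
    using L1_L2_borel[OF assms] .
  have le: "(\<integral>\<^sup>+\<xi>. ennreal ((cmod (fourier_integral v \<xi>))\<^sup>2) \<partial>lborel) \<le> ennreal (l2_sq v)"
    using fourier_contraction_borel[OF w(2)] w(4,5) by simp
  have [measurable]: "fourier_integral v \<in> borel_measurable borel"
    using fourier_integral_measurable[OF w(1)] w(4) by simp
  have "integrable lborel (\<lambda>\<xi>. (cmod (fourier_integral v \<xi>))\<^sup>2)"
    by (rule integrableI_bounded) (use le in \<open>auto intro: le_less_trans\<close>)
  then show L: "fourier_integral v \<in> L2"
    unfolding L2_def using measurable_completion[of "fourier_integral v" lborel borel]
    by (simp add: integrable_completion)
  have "ennreal (l2_sq (fourier_integral v)) \<le> ennreal (l2_sq v)"
    using le nn_integral_l2_sq[OF L] by (simp add: nn_integral_completion)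
  then show "l2_sq (fourier_integral v) \<le> l2_sq v" by (simp add: ennreal_le_iff)
qed

text \<open>By the contraction property the transforms converge in mean along with the functions, and norms are
  continuous under convergence in mean.\<close>

lemma fourier_isometry_limit:
  assumes v: "v \<in> L1_L2" and X: "\<And>n. X n \<in> L1_L2" and lim: "l2_limit X v"
    and iso: "\<And>n. l2_sq (fourier_integral (X n)) = l2_sq (X n)"
  shows "l2_sq (fourier_integral v) = l2_sq v"
proof -
  have eq: "(\<lambda>\<xi>. fourier_integral v \<xi> - fourier_integral (X n) \<xi>) = fourier_integral (\<lambda>x. v x - X n x)" for n
    using v X by (auto simp: fourier_integral_diff L1_L2_D)
  have "l2_limit (\<lambda>n. fourier_integral (X n)) (fourier_integral v)"
    unfolding l2_limit_def
  proof (rule tendsto_sandwich[OF _ _ tendsto_const])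
    show "(\<lambda>n. l2_sq (\<lambda>x. v x - X n x)) \<longlonglongrightarrow> 0" using lim by (simp add: l2_limit_def)
  qed (auto simp: eq intro!: always_eventually fourier_contraction L1_L2_diff v X)
  then have "(\<lambda>n. l2_sq (fourier_integral (X n))) \<longlonglongrightarrow> l2_sq (fourier_integral v)"
    by (intro l2_sq_limit fourier_contraction v X)
  moreover have "(\<lambda>n. l2_sq (X n)) \<longlonglongrightarrow> l2_sq v"
    by (intro l2_sq_limit L1_L2_D v X lim)
  ultimately show ?thesis using LIMSEQ_unique iso by auto
qed


section \<open>Isometry and completeness\<close>

lemma bounded_support_L1_L2:
  assumes [measurable]: "v \<in> borel_measurable lebesgue" and R: "\<And>x. \<bar>x\<bar> > R \<Longrightarrow> v x = 0" and M: "\<And>x. cmod (v x) \<le> M"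
  shows "v \<in> L1_L2"
proof -
  have int: "integrable lebesgue (\<lambda>x. C * indicator {-R..R} x :: real)" for C
    by (intro integrable_mult_right integrable_real_indicator) (auto simp: emeasure_lborel_Icc_eq)
  have "integrable lebesgue v"
  proof (rule Bochner_Integration.integrable_bound[OF int[of M]])
    show "AE x in lebesgue. norm (v x) \<le> norm (M * indicator {-R..R} x)"
      using R M by (auto simp: indicator_def intro!: AE_I2 order_trans[OF M]) 
  qed measurable
  moreover have "v \<in> L2"
  proof (rule L2_dominated[OF assms(1) int[of "M\<^sup>2"]])
    show "(cmod (v x))\<^sup>2 \<le> M\<^sup>2 * indicator {-R..R} x" for x
      using R[of x] M[of x] by (auto simp: indicator_def abs_le_iff not_le power_mono)
  qed
  ultimately show ?thesis by (simp add: L1_L2_def)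
qed

lemma l2_limit_dominated:
  assumes "\<And>n. X n \<in> L2" "v \<in> L2" and W: "integrable lebesgue W"
    and bd: "\<And>n x. (cmod (v x - X n x))\<^sup>2 \<le> W x"
    and lim: "AE x in lebesgue. (\<lambda>n. X n x) \<longlonglongrightarrow> v x"
  shows "l2_limit X v"
proof -
  note [measurable] = assms(1,2)[THEN L2_measurable]
  have "(\<lambda>n. LINT x|lebesgue. (cmod (v x - X n x))\<^sup>2) \<longlonglongrightarrow> (LINT x|(lebesgue :: real measure). 0::real)"
  proof (rule integral_dominated_convergence[OF _ _ W])
    show "AE x in lebesgue. (\<lambda>n. (cmod (v x - X n x))\<^sup>2) \<longlonglongrightarrow> 0"
      using lim
    proof eventually_elim
      fix x assume "(\<lambda>n. X n x) \<longlonglongrightarrow> v x"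
      then have "(\<lambda>n. (cmod (v x - X n x))\<^sup>2) \<longlonglongrightarrow> (cmod (v x - v x))\<^sup>2" by (intro tendsto_intros)
      then show "(\<lambda>n. (cmod (v x - X n x))\<^sup>2) \<longlonglongrightarrow> 0" by simp
    qed
    show "AE x in lebesgue. norm ((cmod (v x - X n x))\<^sup>2) \<le> W x" for n using bd by simp
  qed measurable
  then show ?thesis by (simp add: l2_limit_def l2_sq_def)
qed

lemma fourier_isometry_continuous:
  assumes cont: "continuous_on UNIV w" and R: "\<And>x. \<bar>x\<bar> > R \<Longrightarrow> w x = 0" and M: "\<And>x. cmod (w x) \<le> M"
  shows "l2_sq (fourier_integral w) = l2_sq w"
proof -
  have wb [measurable]: "w \<in> borel_measurable borel" using cont by (rule borel_measurable_continuous_onI)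
  have wl: "w \<in> borel_measurable lebesgue" using measurable_completion[of w lborel borel] wb by simp
  have L: "w \<in> L1_L2" by (rule bounded_support_L1_L2[OF wl R M])
  have 1: "integrable lborel w" using L1_L2_D(2)[OF L] by (simp add: integrable_completion)
  have 2: "integrable lborel (\<lambda>x. (cmod (w x))\<^sup>2)"
    using L2_integrable[OF L1_L2_D(1)[OF L]] by (simp add: integrable_completion)
  have "(\<integral>\<^sup>+x. ennreal ((cmod (w x))\<^sup>2) \<partial>lborel) \<le> (\<integral>\<^sup>+\<xi>. ennreal ((cmod (fourier_integral w \<xi>))\<^sup>2) \<partial>lborel)"
    by (rule fourier_lower_bound_continuous[OF cont 1 2 M])
  then have "ennreal (l2_sq w) \<le> ennreal (l2_sq (fourier_integral w))"
    using nn_integral_l2_sq[OF L1_L2_D(1)[OF L]] nn_integral_l2_sq[OF fourier_contraction(1)[OF L]]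
    by (simp add: nn_integral_completion)
  then have "l2_sq w \<le> l2_sq (fourier_integral w)" by (simp add: ennreal_le_iff)
  with fourier_contraction(2)[OF L] show ?thesis by simp
qed

text \<open>A measurable function is an almost everywhere limit of continuous functions.  Clamping their
  values and cutting them off outside a compact set makes the convergence dominated without changing
  the limit, since \<open>v\<close> itself obeys both bounds.\<close>

lemma fourier_isometry_bounded_support:
  assumes meas: "v \<in> borel_measurable lebesgue" and R: "\<And>x. \<bar>x\<bar> > R \<Longrightarrow> v x = 0" and M: "\<And>x. cmod (v x) \<le> M"
  shows "l2_sq (fourier_integral v) = l2_sq v"
proof -
  \<comment> \<open>A strictly positive bound, so that the clamp may divide by it.\<close>
  define M' where "M' = max M 1"
  have M': "M' > 0" "\<And>x. cmod (v x) \<le> M'" using M by (auto simp: M'_def le_max_iff_disj)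
  have "v measurable_on UNIV" using meas by (simp add: measurable_on_iff_borel_measurable)
  then obtain N g where N: "negligible N" and g: "\<And>n. continuous_on UNIV (g n)"
    and lim: "\<And>x. x \<notin> N \<Longrightarrow> (\<lambda>n. g n x) \<longlonglongrightarrow> v x"
    by (auto simp: measurable_on_def)
  \<comment> \<open>The radial clamp onto the disc of radius \<open>M'\<close>, in a form that is visibly continuous.\<close>
  define clamp where "clamp z = z * complex_of_real (M' / max M' (cmod z))" for z
  define cut where "cut x = max 0 (min 1 (R + 1 - \<bar>x\<bar>))" for x :: real
  define X where "X n x = clamp (g n x) * complex_of_real (cut x)" for n x
  have clamp_cont: "continuous_on UNIV clamp"
    unfolding clamp_def by (intro continuous_intros) (use M' in \<open>auto simp: max_def\<close>)
  have clamp_bd: "cmod (clamp z) \<le> M'" for z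
    using M' by (auto simp: clamp_def norm_mult norm_divide max_def field_simps)
  have clamp_id: "cmod z \<le> M' \<Longrightarrow> clamp z = z" for z
    using M' by (auto simp: clamp_def max_def)
  have Xc: "continuous_on UNIV (X n)" for n
    unfolding X_def cut_def
    by (intro continuous_intros continuous_on_compose2[OF clamp_cont g]) auto
  have X0: "\<bar>x\<bar> > R + 1 \<Longrightarrow> X n x = 0" for n x by (auto simp: X_def cut_def)
  have XM: "cmod (X n x) \<le> M'" for n x
  proof -
    have "cmod (X n x) = cmod (clamp (g n x)) * cut x" by (simp add: X_def norm_mult cut_def)
    also have "\<dots> \<le> M' * 1" using clamp_bd M' by (intro mult_mono) (auto simp: cut_def)
    finally show ?thesis by simp
  qed
  have Xm: "X n \<in> borel_measurable lebesgue" for n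
    using measurable_completion[of "X n" lborel borel] borel_measurable_continuous_onI[OF Xc] by simp
  have XL: "X n \<in> L1_L2" for n by (rule bounded_support_L1_L2[OF Xm X0 XM])
  have vL: "v \<in> L1_L2" by (rule bounded_support_L1_L2[OF meas R M])
  have "l2_limit X v"
  proof (rule l2_limit_dominated)
    show "integrable lebesgue (\<lambda>x. (2 * M')\<^sup>2 * indicator {-(R+1)..R+1} x :: real)"
      by (intro integrable_mult_right integrable_real_indicator) (auto simp: emeasure_lborel_Icc_eq)
    show "(cmod (v x - X n x))\<^sup>2 \<le> (2 * M')\<^sup>2 * indicator {-(R+1)..R+1} x" for n x
    proof (cases "\<bar>x\<bar> > R + 1")
      case True then show ?thesis using R[of x] X0[of x n] by simp
    next
      case False
      have "cmod (v x - X n x) \<le> 2 * M'"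
        using norm_triangle_ineq4[of "v x" "X n x"] M'(2)[of x] XM[of n x] by simp
      from power_mono[OF this norm_ge_zero, of 2] False show ?thesis
        by (simp add: indicator_def abs_le_iff not_less)
    qed
    have "AE x in lebesgue. x \<notin> N" using N by (simp add: negligible_iff_null_sets AE_not_in)
    then show "AE x in lebesgue. (\<lambda>n. X n x) \<longlonglongrightarrow> v x"
    proof eventually_elim
      fix x assume "x \<notin> N"
      have "isCont clamp (v x)" using clamp_cont by (simp add: continuous_on_eq_continuous_at)
      then have "(\<lambda>n. clamp (g n x)) \<longlonglongrightarrow> clamp (v x)"
        by (rule isCont_tendsto_compose[OF _ lim[OF \<open>x \<notin> N\<close>]])
      then have "(\<lambda>n. X n x) \<longlonglongrightarrow> clamp (v x) * complex_of_real (cut x)"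
        unfolding X_def by (rule tendsto_mult_right)
      also have "clamp (v x) * complex_of_real (cut x) = v x"
        using R[of x] clamp_id[OF M'(2)[of x]] by (cases "\<bar>x\<bar> > R") (auto simp: cut_def)
      finally show "(\<lambda>n. X n x) \<longlonglongrightarrow> v x" .
    qed
  qed (use XL vL L1_L2_D in auto)
  moreover have "l2_sq (fourier_integral (X n)) = l2_sq (X n)" for n
    by (rule fourier_isometry_continuous[OF Xc X0 XM])
  ultimately show ?thesis by (intro fourier_isometry_limit[OF vL XL])
qed

lemma fourier_isometry:
  assumes v: "v \<in> L1_L2"
  shows "l2_sq (fourier_integral v) = l2_sq v"
proof -
  note [measurable] = L2_measurable[OF L1_L2_D(1)[OF v]]
  define X where "X n x = (if \<bar>x\<bar> \<le> real n \<and> cmod (v x) \<le> real n then v x else 0)" for n x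
  have [measurable]: "(\<lambda>x::real. x) \<in> borel_measurable lebesgue"
    using measurable_completion[of "\<lambda>x::real. x" lborel borel] by simp
  have Xm: "X n \<in> borel_measurable lebesgue" for n unfolding X_def by measurable
  have X0: "\<bar>x\<bar> > real n \<Longrightarrow> X n x = 0" and XM: "cmod (X n x) \<le> real n" for n x
    by (auto simp: X_def)
  have XL: "X n \<in> L1_L2" for n by (rule bounded_support_L1_L2[OF Xm X0 XM])
  have "l2_limit X v"
  proof (rule l2_limit_dominated[OF L1_L2_D(1)[OF XL] L1_L2_D(1)[OF v] L2_integrable[OF L1_L2_D(1)[OF v]]])
    show "(cmod (v x - X n x))\<^sup>2 \<le> (cmod (v x))\<^sup>2" for n x by (simp add: X_def)
    show "AE x in lebesgue. (\<lambda>n. X n x) \<longlonglongrightarrow> v x"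
    proof (rule AE_I2)
      fix x
      obtain k where "max \<bar>x\<bar> (cmod (v x)) \<le> real k" using real_arch_simple by blast
      then have "\<forall>\<^sub>F n in sequentially. X n x = v x"
        by (auto simp: X_def eventually_sequentially intro!: exI[of _ k])
      then show "(\<lambda>n. X n x) \<longlonglongrightarrow> v x" by (rule tendsto_eventually)
    qed
  qed
  then show ?thesis
    by (rule fourier_isometry_limit[OF v XL]) (rule fourier_isometry_bounded_support[OF Xm X0 XM])
qed

text \<open>The Riesz--Fischer theorem.  Along a subsequence whose increments have squared norm at most
  \<open>(1/4) ^ k\<close>, the increments are absolutely summable almost everywhere; Fatou's lemma then upgrades
  the pointwise limit to a limit in mean of the whole sequence.\<close>

lemma l2_complete:
  assumes X: "\<And>n. X n \<in> L2"
    and cauchy: "\<And>e. e > 0 \<Longrightarrow> \<exists>N. \<forall>m\<ge>N. \<forall>n\<ge>N. l2_sq (\<lambda>x. X m x - X n x) \<le> e"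
  obtains \<psi> where "\<psi> \<in> L2" "l2_limit X \<psi>"
proof -
  note Xm [measurable] = X[THEN L2_measurable]
  have "\<forall>k. \<exists>N. \<forall>m\<ge>N. \<forall>n\<ge>N. l2_sq (\<lambda>x. X m x - X n x) \<le> (1/4) ^ k" using cauchy by simp
  then obtain N where N: "\<And>k m n. m \<ge> N k \<Longrightarrow> n \<ge> N k \<Longrightarrow> l2_sq (\<lambda>x. X m x - X n x) \<le> (1/4) ^ k"
    by metis
  \<comment> \<open>The sum makes the subsequence monotone.\<close>
  define K where "K k = k + (\<Sum>j\<le>k. N j)" for k
  have KN: "N k \<le> K k" and Kmono: "K k \<le> K (Suc k)" and Kk: "k \<le> K k" for k
    by (auto simp: K_def intro: order_trans[OF member_le_sum[of k "{..k}" N]])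
  let ?d = "\<lambda>k x. X (K (Suc k)) x - X (K k) x"
  have d: "l2_sq (?d k) \<le> (1/4) ^ k" for k
    by (rule N) (use KN[of k] Kmono[of k] in auto)
  \<comment> \<open>The weight \<open>2 ^ k\<close> leaves both this sum and the comparison \<open>(1/2) ^ k\<close> below summable.\<close>
  have "(\<integral>\<^sup>+x. (\<Sum>k. ennreal (2 ^ k * (cmod (?d k x))\<^sup>2)) \<partial>lebesgue) = (\<Sum>k. \<integral>\<^sup>+x. ennreal (2 ^ k * (cmod (?d k x))\<^sup>2) \<partial>lebesgue)"
    by (rule nn_integral_suminf) measurable
  also have "\<dots> = (\<Sum>k. ennreal (2 ^ k * l2_sq (?d k)))"
    using X by (intro suminf_cong) (simp add: ennreal_mult nn_integral_cmult nn_integral_l2_sq L2_diff)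
  also have "\<dots> \<le> (\<Sum>k. ennreal ((1/2) ^ k))"
  proof (intro suminf_le allI ennreal_leI)
    fix k :: nat
    have "2 ^ k * l2_sq (?d k) \<le> 2 ^ k * (1/4) ^ k" using d by (intro mult_left_mono) auto
    also have "\<dots> = (1/2) ^ k" by (simp flip: power_mult_distrib)
    finally show "2 ^ k * l2_sq (?d k) \<le> (1/2) ^ k" .
  qed auto
  also have "\<dots> < \<infinity>"
    by (subst suminf_ennreal2) (auto intro: summable_geometric)
  finally have "AE x in lebesgue. (\<Sum>k. ennreal (2 ^ k * (cmod (?d k x))\<^sup>2)) \<noteq> \<infinity>"
    by (intro nn_integral_PInf_AE) auto
  then have conv: "AE x in lebesgue. convergent (\<lambda>k. X (K k) x)"
  proof eventually_elim
    fix x assume fin: "(\<Sum>k. ennreal (2 ^ k * (cmod (?d k x))\<^sup>2)) \<noteq> \<infinity>"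
    have s: "summable (\<lambda>k. 2 ^ k * (cmod (?d k x))\<^sup>2)"
      by (rule summable_suminf_not_top) (use fin in auto)
    have "summable (\<lambda>k. (1/2) ^ k + 2 ^ k * (cmod (?d k x))\<^sup>2)"
      by (intro summable_add s summable_geometric) simp
    then have "summable (\<lambda>k. ?d k x)"
    proof (rule summable_comparison_test[rotated], intro exI allI impI)
      fix k :: nat
      \<comment> \<open>Arithmetic and geometric mean of \<open>(1/2) ^ k\<close> and \<open>2 ^ k * (cmod (?d k x))\<^sup>2\<close>.\<close>
      have "0 \<le> 2 ^ k * (cmod (?d k x) - (1/2) ^ k)\<^sup>2" by simp
      also have "\<dots> = (2 ^ k * (1/2) ^ k) * (1/2) ^ k + 2 ^ k * (cmod (?d k x))\<^sup>2 - 2 * (2 ^ k * (1/2) ^ k) * cmod (?d k x)"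
        by (simp only: power2_eq_square) (simp add: algebra_simps)
      also have "2 ^ k * (1/2 :: real) ^ k = 1" by (simp flip: power_mult_distrib)
      finally have "2 * norm (?d k x) \<le> (1/2) ^ k + 2 ^ k * (cmod (?d k x))\<^sup>2" by simp
      then show "norm (?d k x) \<le> (1/2) ^ k + 2 ^ k * (cmod (?d k x))\<^sup>2"
        using norm_ge_zero[of "?d k x"] by linarith
    qed
    from summable_LIMSEQ[OF this] have "convergent (\<lambda>n. X (K n) x - X (K 0) x)"
      unfolding sum_lessThan_telescope[of "\<lambda>k. X (K k) x"] by (rule convergentI)
    from convergent_add[OF this convergent_const[of "X (K 0) x"]] show "convergent (\<lambda>k. X (K k) x)" by simp
  qed
  define \<psi> where "\<psi> x = lim (\<lambda>k. X (K k) x)" for x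
  have psim [measurable]: "\<psi> \<in> borel_measurable lebesgue" unfolding \<psi>_def by (rule borel_measurable_lim_metric) measurable
  have lim: "AE x in lebesgue. (\<lambda>k. X (K k) x) \<longlonglongrightarrow> \<psi> x"
    using conv by eventually_elim (simp add: \<psi>_def convergent_LIMSEQ_iff)
  have fatou: "(\<integral>\<^sup>+x. ennreal ((cmod (\<psi> x - X m x))\<^sup>2) \<partial>lebesgue) \<le> ennreal e"
    if e: "\<And>n. n \<ge> M \<Longrightarrow> l2_sq (\<lambda>x. X n x - X m x) \<le> e" for m e M
  proof -
    have "(\<integral>\<^sup>+x. ennreal ((cmod (\<psi> x - X m x))\<^sup>2) \<partial>lebesgue)
        = (\<integral>\<^sup>+x. liminf (\<lambda>k. ennreal ((cmod (X (K k) x - X m x))\<^sup>2)) \<partial>lebesgue)"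
    proof (rule nn_integral_cong_AE)
      show "AE x in lebesgue. ennreal ((cmod (\<psi> x - X m x))\<^sup>2) = liminf (\<lambda>k. ennreal ((cmod (X (K k) x - X m x))\<^sup>2))"
        using lim
      proof eventually_elim
        fix x assume "(\<lambda>k. X (K k) x) \<longlonglongrightarrow> \<psi> x"
        then have "(\<lambda>k. ennreal ((cmod (X (K k) x - X m x))\<^sup>2)) \<longlonglongrightarrow> ennreal ((cmod (\<psi> x - X m x))\<^sup>2)"
          by (intro tendsto_intros)
        then show "ennreal ((cmod (\<psi> x - X m x))\<^sup>2) = liminf (\<lambda>k. ennreal ((cmod (X (K k) x - X m x))\<^sup>2))"
          by (rule lim_imp_Liminf[symmetric, rotated]) simp
      qed
    qed
    also have "\<dots> \<le> liminf (\<lambda>k. \<integral>\<^sup>+x. ennreal ((cmod (X (K k) x - X m x))\<^sup>2) \<partial>lebesgue)"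
      by (rule nn_integral_liminf) measurable
    also have "\<dots> \<le> ennreal e"
    proof (rule Liminf_le)
      have "(\<integral>\<^sup>+x. ennreal ((cmod (X (K k) x - X m x))\<^sup>2) \<partial>lebesgue) \<le> ennreal e" if "k \<ge> M" for k
        using e[of "K k"] Kk[of k] that X by (simp add: nn_integral_l2_sq L2_diff ennreal_leI)
      then show "\<forall>\<^sub>F k in sequentially. (\<integral>\<^sup>+x. ennreal ((cmod (X (K k) x - X m x))\<^sup>2) \<partial>lebesgue) \<le> ennreal e"
        by (auto simp: eventually_sequentially)
    qed simp
    finally show ?thesis .
  qed
  have diff: "(\<lambda>x. \<psi> x - X m x) \<in> L2" if e: "\<And>n. n \<ge> M \<Longrightarrow> l2_sq (\<lambda>x. X n x - X m x) \<le> e" for m e M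
  proof -
    have "integrable lebesgue (\<lambda>x. (cmod (\<psi> x - X m x))\<^sup>2)"
    proof (rule integrableI_bounded)
      have "(\<integral>\<^sup>+x. ennreal ((cmod (\<psi> x - X m x))\<^sup>2) \<partial>lebesgue) \<le> ennreal e" by (rule fatou[OF e])
      also have "\<dots> < \<infinity>" by simp
      finally show "(\<integral>\<^sup>+x. ennreal (norm ((cmod (\<psi> x - X m x))\<^sup>2)) \<partial>lebesgue) < \<infinity>" by simp
    qed measurable
    then show ?thesis by (simp add: L2_def)
  qed
  obtain M where M: "\<forall>m\<ge>M. \<forall>n\<ge>M. l2_sq (\<lambda>x. X m x - X n x) \<le> 1" using cauchy[of 1] by auto
  have "(\<lambda>x. (\<psi> x - X M x) + X M x) \<in> L2"
    by (intro L2_add diff[of M M 1] X) (use M in auto)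
  then have psi: "\<psi> \<in> L2" by simp
  moreover have "l2_limit X \<psi>"
    unfolding l2_limit_def
  proof (rule LIMSEQ_I)
    fix r :: real assume "r > 0"
    then obtain N where N: "\<forall>m\<ge>N. \<forall>n\<ge>N. l2_sq (\<lambda>x. X m x - X n x) \<le> r / 2" using cauchy[of "r/2"] by auto
    have "norm (l2_sq (\<lambda>x. \<psi> x - X m x) - 0) < r" if "m \<ge> N" for m
    proof -
      have "ennreal (l2_sq (\<lambda>x. \<psi> x - X m x)) \<le> ennreal (r / 2)"
        using fatou[of N m "r/2"] N that psi X by (simp add: nn_integral_l2_sq L2_diff)
      then show ?thesis using \<open>r > 0\<close> by (simp add: ennreal_le_iff)
    qed
    then show "\<exists>no. \<forall>n\<ge>no. norm (l2_sq (\<lambda>x. \<psi> x - X n x) - 0) < r" by blast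
  qed
  ultimately show ?thesis by (rule that)
qed


section \<open>The Fourier transform on the Hilbert space\<close>

definition trunc :: "(real \<Rightarrow> complex) \<Rightarrow> nat \<Rightarrow> real \<Rightarrow> complex" where
  "trunc \<psi> n = (\<lambda>x. indicator {- real n..real n} x * \<psi> x)"

lemma trunc_L1_L2:
  assumes "\<psi> \<in> L2" shows "trunc \<psi> n \<in> L1_L2"
proof -
  note [measurable] = L2_measurable[OF assms]
  have [measurable]: "(indicator {- real n..real n} :: real \<Rightarrow> complex) \<in> borel_measurable lebesgue"
    using measurable_completion[of "indicator {- real n..real n} :: real \<Rightarrow> complex" lborel borel] by simp
  have L: "trunc \<psi> n \<in> L2"
    unfolding trunc_def by (rule L2_bounded_mult[OF assms, where C = 1]) (measurable, simp add: indicator_def)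
  moreover have "integrable lebesgue (trunc \<psi> n)"
  proof (rule Bochner_Integration.integrable_bound)
    show "integrable lebesgue (\<lambda>x. indicator {- real n..real n} x + (cmod (\<psi> x))\<^sup>2)"
      by (intro Bochner_Integration.integrable_add integrable_real_indicator L2_integrable assms) (auto simp: emeasure_lborel_Icc_eq)
    have "t \<le> 1 + t\<^sup>2" for t :: real
      using zero_le_power2[of "t - 1"] by (simp add: power2_eq_square algebra_simps) (smt (verit) mult_nonneg_nonneg zero_le_square)
    then show "AE x in lebesgue. norm (trunc \<psi> n x) \<le> norm (indicator {- real n..real n} x + (cmod (\<psi> x))\<^sup>2)"
      by (intro AE_I2) (auto simp: trunc_def indicator_def)
  qed (use L L2_measurable in auto)
  ultimately show ?thesis by (simp add: L1_L2_def)
qed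

lemma trunc_L2: "\<psi> \<in> L2 \<Longrightarrow> trunc \<psi> n \<in> L2"
  using trunc_L1_L2 L1_L2_D by blast

lemma trunc_limit:
  assumes "\<psi> \<in> L2" shows "l2_limit (trunc \<psi>) \<psi>"
proof (rule l2_limit_dominated[OF trunc_L2[OF assms] assms L2_integrable[OF assms]])
  show "(cmod (\<psi> x - trunc \<psi> n x))\<^sup>2 \<le> (cmod (\<psi> x))\<^sup>2" for n x by (simp add: trunc_def indicator_def)
  show "AE x in lebesgue. (\<lambda>n. trunc \<psi> n x) \<longlonglongrightarrow> \<psi> x"
  proof (rule AE_I2)
    fix x :: real
    obtain k where "\<bar>x\<bar> \<le> real k" using real_arch_simple by blast
    then have "\<forall>\<^sub>F n in sequentially. trunc \<psi> n x = \<psi> x"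
      by (auto simp: trunc_def eventually_sequentially indicator_def abs_le_iff intro!: exI[of _ k])
    then show "(\<lambda>n. trunc \<psi> n x) \<longlonglongrightarrow> \<psi> x" by (rule tendsto_eventually)
  qed
qed

lemma l2_sq_minus_commute: "l2_sq (\<lambda>x. \<phi> x - \<psi> x) = l2_sq (\<lambda>x. \<psi> x - \<phi> x)"
  unfolding l2_sq_def by (simp add: norm_minus_commute)

lemma l2_sq_triangle:
  assumes "\<phi> \<in> L2" "\<psi> \<in> L2" "\<eta> \<in> L2"
  shows "l2_sq (\<lambda>x. \<phi> x - \<psi> x) \<le> 2 * l2_sq (\<lambda>x. \<eta> x - \<phi> x) + 2 * l2_sq (\<lambda>x. \<eta> x - \<psi> x)"
  using l2_sq_add_le[OF L2_diff[OF assms(1,3)] L2_diff[OF assms(3,2)]]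
  by (simp add: l2_sq_minus_commute[of \<eta> \<phi>])

lemma l2_limit_unique:
  assumes "\<phi> \<in> L2" "\<psi> \<in> L2" "\<And>n. X n \<in> L2" "l2_limit X \<phi>" "l2_limit X \<psi>"
  shows "AE x in lebesgue. \<phi> x = \<psi> x"
proof -
  have "l2_sq (\<lambda>x. \<phi> x - \<psi> x) \<le> 0"
  proof (rule LIMSEQ_le_const)
    show "(\<lambda>n. 2 * l2_sq (\<lambda>x. \<phi> x - X n x) + 2 * l2_sq (\<lambda>x. \<psi> x - X n x)) \<longlonglongrightarrow> 0"
      using tendsto_add[OF tendsto_mult_left[of _ 0 _ 2] tendsto_mult_left[of _ 0 _ 2]] assms(4,5)
      unfolding l2_limit_def by fastforce
    show "\<exists>N. \<forall>n\<ge>N. l2_sq (\<lambda>x. \<phi> x - \<psi> x) \<le> 2 * l2_sq (\<lambda>x. \<phi> x - X n x) + 2 * l2_sq (\<lambda>x. \<psi> x - X n x)"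
      using l2_sq_triangle[OF assms(1,2,3)] l2_sq_minus_commute by metis
  qed
  then have "l2_sq (\<lambda>x. \<phi> x - \<psi> x) = 0" using l2_sq_nonneg by (metis antisym)
  from l2_sq_eq_0[OF L2_diff[OF assms(1,2)] this] show ?thesis by simp
qed

lemma is_fourier_transform_iff:
  assumes "\<psi> \<in> L2"
  shows "is_fourier_transform \<psi> \<phi> \<longleftrightarrow> \<phi> \<in> L2 \<and> l2_limit (\<lambda>n. fourier_integral (trunc \<psi> n)) \<phi>"
proof (cases "\<phi> \<in> L2")
  case True
  have "(\<integral>\<^sup>+\<xi>. ennreal ((cmod (\<phi> \<xi> - fourier_integral (trunc \<psi> n) \<xi>))\<^sup>2) \<partial>lebesgue)
      = ennreal (l2_sq (\<lambda>\<xi>. \<phi> \<xi> - fourier_integral (trunc \<psi> n) \<xi>))" for n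
    by (rule nn_integral_l2_sq) (intro L2_diff True fourier_contraction trunc_L1_L2 assms)
  then show ?thesis using True
    unfolding is_fourier_transform_def l2_limit_def trunc_def[symmetric]
    by (simp add: tendsto_ennreal_iff flip: ennreal_0)
qed (simp add: is_fourier_transform_def)

text \<open>The truncations of \<open>\<psi>\<close> form a Cauchy sequence in mean, and the Fourier integral does not
  increase the distances between them; completeness provides the limit that the choice in the definition needs.\<close>

lemma fourier_transform:
  assumes "\<psi> \<in> L2"
  shows "fourier \<psi> \<in> L2" "l2_limit (\<lambda>n. fourier_integral (trunc \<psi> n)) (fourier \<psi>)"
proof -
  obtain \<phi> where "\<phi> \<in> L2" "l2_limit (\<lambda>n. fourier_integral (trunc \<psi> n)) \<phi>"
  proof (rule l2_complete[of "\<lambda>n. fourier_integral (trunc \<psi> n)"])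
    show "fourier_integral (trunc \<psi> n) \<in> L2" for n by (intro fourier_contraction trunc_L1_L2 assms)
    fix e :: real assume "e > 0"
    have "(\<lambda>n. l2_sq (\<lambda>x. \<psi> x - trunc \<psi> n x)) \<longlonglongrightarrow> 0"
      using trunc_limit[OF assms] by (simp add: l2_limit_def)
    from LIMSEQ_D[OF this, of "e / 4"] \<open>e > 0\<close>
    obtain N where N: "\<And>n. n \<ge> N \<Longrightarrow> l2_sq (\<lambda>x. \<psi> x - trunc \<psi> n x) < e / 4"
      by auto
    have "l2_sq (\<lambda>x. fourier_integral (trunc \<psi> m) x - fourier_integral (trunc \<psi> n) x) \<le> e" if "m \<ge> N" "n \<ge> N" for m n
    proof -
      have "(\<lambda>x. fourier_integral (trunc \<psi> m) x - fourier_integral (trunc \<psi> n) x) = fourier_integral (\<lambda>x. trunc \<psi> m x - trunc \<psi> n x)"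
        using trunc_L1_L2[OF assms] by (auto simp: fourier_integral_diff L1_L2_D)
      then have "l2_sq (\<lambda>x. fourier_integral (trunc \<psi> m) x - fourier_integral (trunc \<psi> n) x) \<le> l2_sq (\<lambda>x. trunc \<psi> m x - trunc \<psi> n x)"
        by (simp add: fourier_contraction L1_L2_diff trunc_L1_L2 assms)
      also have "\<dots> \<le> 2 * l2_sq (\<lambda>x. \<psi> x - trunc \<psi> m x) + 2 * l2_sq (\<lambda>x. \<psi> x - trunc \<psi> n x)"
        by (intro l2_sq_triangle trunc_L2 assms)
      also have "\<dots> \<le> e" using N[OF that(1)] N[OF that(2)] by simp
      finally show ?thesis .
    qed
    then show "\<exists>N. \<forall>m\<ge>N. \<forall>n\<ge>N. l2_sq (\<lambda>x. fourier_integral (trunc \<psi> m) x - fourier_integral (trunc \<psi> n) x) \<le> e"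
      by blast
  qed
  then have "is_fourier_transform \<psi> (fourier \<psi>)"
    unfolding fourier_def using is_fourier_transform_iff[OF assms] by (metis someI_ex)
  then show "fourier \<psi> \<in> L2" "l2_limit (\<lambda>n. fourier_integral (trunc \<psi> n)) (fourier \<psi>)"
    using is_fourier_transform_iff[OF assms] by auto
qed

lemma fourier_trunc_L2: "\<psi> \<in> L2 \<Longrightarrow> fourier_integral (trunc \<psi> n) \<in> L2"
  by (intro fourier_contraction trunc_L1_L2)

lemma fourier_norm:
  assumes "\<psi> \<in> L2" shows "l2_sq (fourier \<psi>) = l2_sq \<psi>"
proof (rule LIMSEQ_unique)
  show "(\<lambda>n. l2_sq (fourier_integral (trunc \<psi> n))) \<longlonglongrightarrow> l2_sq (fourier \<psi>)"
    by (intro l2_sq_limit fourier_transform fourier_trunc_L2 assms)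
  show "(\<lambda>n. l2_sq (fourier_integral (trunc \<psi> n))) \<longlonglongrightarrow> l2_sq \<psi>"
    using l2_sq_limit[OF assms trunc_L2[OF assms] trunc_limit[OF assms]]
    by (simp add: fourier_isometry trunc_L1_L2 assms)
qed

lemma fourier_eq_fourier_integral:
  assumes v: "v \<in> L1_L2" shows "AE \<xi> in lebesgue. fourier v \<xi> = fourier_integral v \<xi>"
proof (rule l2_limit_unique)
  have L: "v \<in> L2" using v by (rule L1_L2_D)
  show "fourier v \<in> L2" "l2_limit (\<lambda>n. fourier_integral (trunc v n)) (fourier v)" using fourier_transform[OF L] by auto
  show "fourier_integral (trunc v n) \<in> L2" for n by (rule fourier_trunc_L2[OF L])
  show "fourier_integral v \<in> L2" by (rule fourier_contraction[OF v])
  have "(\<lambda>\<xi>. fourier_integral v \<xi> - fourier_integral (trunc v n) \<xi>) = fourier_integral (\<lambda>x. v x - trunc v n x)" for n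
    using trunc_L1_L2[OF L] v by (auto simp: fourier_integral_diff L1_L2_D)
  then show "l2_limit (\<lambda>n. fourier_integral (trunc v n)) (fourier_integral v)"
    using trunc_limit[OF L] by (simp add: l2_limit_def fourier_isometry L1_L2_diff trunc_L1_L2 L v)
qed

lemma l2_limit_linear:
  assumes "\<phi> \<in> L2" "\<psi> \<in> L2" "\<And>n. X n \<in> L2" "\<And>n. Y n \<in> L2" "l2_limit X \<phi>" "l2_limit Y \<psi>"
  shows "l2_limit (\<lambda>n x. X n x - c * Y n x) (\<lambda>x. \<phi> x - c * \<psi> x)"
  unfolding l2_limit_def
proof (rule tendsto_sandwich[OF _ _ tendsto_const])
  have sc: "l2_sq (\<lambda>x. c * \<eta> x) = (cmod c)\<^sup>2 * l2_sq \<eta>" for \<eta>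
    by (simp add: l2_sq_def norm_mult power_mult_distrib)
  have "(\<lambda>n. 2 * l2_sq (\<lambda>x. \<phi> x - X n x) + 2 * ((cmod c)\<^sup>2 * l2_sq (\<lambda>x. \<psi> x - Y n x))) \<longlonglongrightarrow> 2 * 0 + 2 * ((cmod c)\<^sup>2 * 0)"
    using assms(5,6) unfolding l2_limit_def by (intro tendsto_intros)
  then show "(\<lambda>n. 2 * l2_sq (\<lambda>x. \<phi> x - X n x) + 2 * ((cmod c)\<^sup>2 * l2_sq (\<lambda>x. \<psi> x - Y n x))) \<longlonglongrightarrow> 0" by simp
  show "\<forall>\<^sub>F n in sequentially. l2_sq (\<lambda>x. \<phi> x - c * \<psi> x - (X n x - c * Y n x))
      \<le> 2 * l2_sq (\<lambda>x. \<phi> x - X n x) + 2 * ((cmod c)\<^sup>2 * l2_sq (\<lambda>x. \<psi> x - Y n x))"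
  proof (rule always_eventually, rule allI)
    fix n
    have "l2_sq (\<lambda>x. (\<phi> x - X n x) + (- c) * (\<psi> x - Y n x)) \<le> 2 * l2_sq (\<lambda>x. \<phi> x - X n x) + 2 * l2_sq (\<lambda>x. (- c) * (\<psi> x - Y n x))"
      by (intro l2_sq_add_le L2_cmult L2_diff assms)
    also have "l2_sq (\<lambda>x. (- c) * (\<psi> x - Y n x)) = (cmod c)\<^sup>2 * l2_sq (\<lambda>x. \<psi> x - Y n x)"
      by (simp add: l2_sq_def norm_mult power_mult_distrib)
    finally show "l2_sq (\<lambda>x. \<phi> x - c * \<psi> x - (X n x - c * Y n x))
      \<le> 2 * l2_sq (\<lambda>x. \<phi> x - X n x) + 2 * ((cmod c)\<^sup>2 * l2_sq (\<lambda>x. \<psi> x - Y n x))"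
      by (simp add: algebra_simps)
  qed
qed auto

lemma fourier_linear:
  assumes "\<phi> \<in> L2" "\<psi> \<in> L2"
  shows "AE \<xi> in lebesgue. fourier (\<lambda>x. \<phi> x - c * \<psi> x) \<xi> = fourier \<phi> \<xi> - c * fourier \<psi> \<xi>"
proof (rule l2_limit_unique)
  let ?d = "\<lambda>x. \<phi> x - c * \<psi> x"
  have d: "?d \<in> L2" by (intro L2_diff L2_cmult assms)
  show "fourier ?d \<in> L2" "l2_limit (\<lambda>n. fourier_integral (trunc ?d n)) (fourier ?d)"
    using fourier_transform[OF d] by auto
  show "fourier_integral (trunc ?d n) \<in> L2" for n by (rule fourier_trunc_L2[OF d])
  show "(\<lambda>\<xi>. fourier \<phi> \<xi> - c * fourier \<psi> \<xi>) \<in> L2" by (intro L2_diff L2_cmult fourier_transform assms)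
  have "fourier_integral (trunc ?d n) = (\<lambda>\<xi>. fourier_integral (trunc \<phi> n) \<xi> - c * fourier_integral (trunc \<psi> n) \<xi>)" for n
  proof
    fix \<xi>
    have 1: "integrable lebesgue (trunc \<phi> n)" "integrable lebesgue (\<lambda>x. c * trunc \<psi> n x)"
      using trunc_L1_L2 assms L1_L2_D by auto
    have "fourier_integral (trunc ?d n) \<xi> = fourier_integral (\<lambda>x. trunc \<phi> n x - c * trunc \<psi> n x) \<xi>"
      by (rule arg_cong[where f = "\<lambda>h. fourier_integral h \<xi>"]) (auto simp: trunc_def algebra_simps)
    also have "\<dots> = fourier_integral (trunc \<phi> n) \<xi> - fourier_integral (\<lambda>x. c * trunc \<psi> n x) \<xi>"
      by (rule fourier_integral_diff[OF 1])
    also have "fourier_integral (\<lambda>x. c * trunc \<psi> n x) \<xi> = c * fourier_integral (trunc \<psi> n) \<xi>"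
      unfolding fourier_integral_def by (simp add: mult.left_commute[of _ c])
    finally show "fourier_integral (trunc ?d n) \<xi> = fourier_integral (trunc \<phi> n) \<xi> - c * fourier_integral (trunc \<psi> n) \<xi>" .
  qed
  then show "l2_limit (\<lambda>n. fourier_integral (trunc ?d n)) (\<lambda>\<xi>. fourier \<phi> \<xi> - c * fourier \<psi> \<xi>)"
    by (simp add: l2_limit_linear fourier_transform fourier_trunc_L2 assms)
qed

text \<open>Polarization: the norm of \<open>\<phi> - c \<psi>\<close> is preserved for every \<open>c\<close>, and \<open>c = 1\<close> and \<open>c = - i\<close>
  determine the real and the imaginary part of the inner product.\<close>

theorem fourier_inner:
  assumes "\<phi> \<in> L2" "\<psi> \<in> L2"
  shows "l2_inner (fourier \<phi>) (fourier \<psi>) = l2_inner \<phi> \<psi>"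
proof -
  have sc: "l2_sq (\<lambda>x. c * \<eta> x) = (cmod c)\<^sup>2 * l2_sq \<eta>" "l2_inner \<phi>' (\<lambda>x. c * \<eta> x) = c * l2_inner \<phi>' \<eta>" for \<phi>' \<eta> c
    by (simp_all add: l2_sq_def norm_mult power_mult_distrib l2_inner_def mult.left_commute[of _ c])
  have "Re (c * l2_inner (fourier \<phi>) (fourier \<psi>)) = Re (c * l2_inner \<phi> \<psi>)" for c
  proof -
    have "l2_sq (\<lambda>\<xi>. fourier \<phi> \<xi> - c * fourier \<psi> \<xi>) = l2_sq (fourier (\<lambda>x. \<phi> x - c * \<psi> x))"
      by (rule l2_sq_cong_AE)
         (use fourier_linear[OF assms, of c] in \<open>auto intro!: fourier_transform L2_diff L2_cmult assms elim: eventually_mono\<close>)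
    also have "\<dots> = l2_sq (\<lambda>x. \<phi> x - c * \<psi> x)"
      by (intro fourier_norm L2_diff L2_cmult assms)
    finally show ?thesis
      using l2_sq_diff_expand[OF assms(1) L2_cmult[OF assms(2), of c]]
        l2_sq_diff_expand[OF fourier_transform(1)[OF assms(1)] L2_cmult[OF fourier_transform(1)[OF assms(2)], of c]]
      by (simp add: sc fourier_norm assms)
  qed
  from this[of 1] this[of "- \<i>"] show ?thesis by (simp add: complex_eq_iff)
qed


section \<open>Surjectivity and functions of momentum\<close>

text \<open>The inverse Fourier integral: the kernel \<open>exp (i x \<xi>)\<close> is the Fourier kernel at the reflected
  point.\<close>

definition inverse_integral :: "(real \<Rightarrow> complex) \<Rightarrow> real \<Rightarrow> complex" where
  "inverse_integral u x = fourier_integral u (- x)"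

lemma reflect_measurable: "(\<lambda>x::real. - x) \<in> lebesgue \<rightarrow>\<^sub>M lebesgue"
proof -
  have "(*\<^sub>R) (- 1) = (\<lambda>x::real. - x)" by auto
  then show ?thesis using lebesgue_measurable_scaling[of "- 1 :: real", where 'a = real] by simp
qed

lemma reflect_L2:
  assumes "\<psi> \<in> L2"
  shows "(\<lambda>x. \<psi> (- x)) \<in> L2" "l2_sq (\<lambda>x. \<psi> (- x)) = l2_sq \<psi>"
proof -
  note m [measurable] = L2_measurable[OF assms]
  have rm [measurable]: "(\<lambda>x. \<psi> (- x)) \<in> borel_measurable lebesgue"
    by (rule measurable_compose[OF reflect_measurable m])
  have nn: "(\<integral>\<^sup>+x. ennreal ((cmod (\<psi> (- x)))\<^sup>2) \<partial>lebesgue) = ennreal (l2_sq \<psi>)"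
    using nn_integral_real_affine_lebesgue[of "\<lambda>x. ennreal ((cmod (\<psi> x))\<^sup>2)" "-1" 0] nn_integral_l2_sq[OF assms]
    by simp
  have "integrable lebesgue (\<lambda>x. (cmod (\<psi> (- x)))\<^sup>2)"
    by (rule integrableI_bounded) (use nn in auto)
  then show L: "(\<lambda>x. \<psi> (- x)) \<in> L2" by (simp add: L2_def)
  show "l2_sq (\<lambda>x. \<psi> (- x)) = l2_sq \<psi>"
    using nn_integral_l2_sq[OF L] nn by simp
qed

lemma AE_reflect:
  assumes "\<phi> \<in> L2" "\<psi> \<in> L2" "AE x in lebesgue. \<phi> x = \<psi> x"
  shows "AE x in lebesgue. \<phi> (- x) = \<psi> (- x)"
proof -
  have d: "(\<lambda>x. \<phi> x - \<psi> x) \<in> L2" by (intro L2_diff assms)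
  have z: "(\<lambda>x::real. 0::complex) \<in> L2" by (simp add: L2_def)
  have "l2_sq (\<lambda>x. \<phi> x - \<psi> x) = l2_sq (\<lambda>x. 0)"
    by (rule l2_sq_cong_AE[OF z]) (use assms(3) in \<open>auto elim: eventually_mono\<close>)
  then have "l2_sq (\<lambda>x. \<phi> (- x) - \<psi> (- x)) = 0" using reflect_L2(2)[OF d] by (simp add: l2_sq_def)
  from l2_sq_eq_0[OF reflect_L2(1)[OF d] this] show ?thesis by simp
qed

lemma cnj_fourier_integral: "cnj (fourier_integral u \<xi>) = inverse_integral (\<lambda>x. cnj (u x)) \<xi>"
proof -
  have "cnj (LINT x|lebesgue. exp (- (\<i> * of_real \<xi> * of_real x)) * u x)
      = (LINT x|lebesgue. cnj (exp (- (\<i> * of_real \<xi> * of_real x)) * u x))"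
    by (rule Bochner_Integration.integral_cnj[symmetric])
  then show ?thesis by (simp add: inverse_integral_def fourier_integral_def exp_cnj)
qed

lemma l2_inner_lborel:
  assumes [measurable]: "\<phi> \<in> borel_measurable borel" "\<psi> \<in> borel_measurable borel"
  shows "l2_inner \<phi> \<psi> = (LINT x|lborel. cnj (\<phi> x) * \<psi> x)"
  unfolding l2_inner_def by (rule integral_completion) measurable

lemma inverse_integral_L2:
  assumes "u \<in> L1_L2" shows "inverse_integral u \<in> L2"
  using reflect_L2(1)[OF fourier_contraction(1)[OF assms]]
  by (simp add: inverse_integral_def[abs_def])

lemma fourier_integral_adjoint:
  assumes a: "a \<in> L1_L2" and b: "b \<in> L1_L2"
  shows "l2_inner (fourier_integral a) b = l2_inner a (inverse_integral b)"
proof -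
  let ?c = "complex_of_real (sqrt (2 * pi))"
  obtain v where v: "v \<in> borel_measurable borel" "integrable lborel v" "AE x in lebesgue. a x = v x"
    "fourier_integral v = fourier_integral a" using L1_L2_borel[OF a] by metis
  obtain w where w: "w \<in> borel_measurable borel" "integrable lborel w" "AE x in lebesgue. b x = w x"
    "fourier_integral w = fourier_integral b" using L1_L2_borel[OF b] by metis
  note [measurable] = v(1) w(1)
  have vL: "v \<in> L2" by (rule L2_cong_AE[OF L1_L2_D(1)[OF a]]) (use v(3) in \<open>auto elim: eventually_mono\<close>)
  have wL: "w \<in> L2" by (rule L2_cong_AE[OF L1_L2_D(1)[OF b]]) (use w(3) in \<open>auto elim: eventually_mono\<close>)
  have cv: "integrable lborel (\<lambda>x. cnj (v x))" using v(2) by simp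
  have im [measurable]: "inverse_integral w \<in> borel_measurable borel"
    unfolding inverse_integral_def[abs_def] by measurable
  have "l2_inner (fourier_integral a) b = l2_inner (fourier_integral v) w"
    by (rule l2_inner_cong_AE) (use wL w v fourier_contraction(1)[OF a] in auto)
  also have "\<dots> = (LINT \<xi>|lborel. cnj (fourier_integral v \<xi>) * w \<xi>)"
    by (rule l2_inner_lborel) measurable
  also have "\<dots> = (LINT \<xi>|lborel. w \<xi> * (LINT x|lborel. (iexp (\<xi> * x) / ?c) * cnj (v x)))"
    unfolding cnj_fourier_integral inverse_integral_def
    by (subst fourier_integral_lborel) (auto simp: mult.commute)
  also have "\<dots> = (LINT x|lborel. cnj (v x) * (LINT \<xi>|lborel. (iexp (\<xi> * x) / ?c) * w \<xi>))"
    by (rule integral_swap_bounded_kernel[OF w(2) cv _ fourier_kernel_bound]) measurable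
  also have "\<dots> = (LINT x|lborel. cnj (v x) * inverse_integral w x)"
    unfolding inverse_integral_def by (subst fourier_integral_lborel) (auto simp: mult.commute)
  also have "\<dots> = l2_inner v (inverse_integral w)"
    by (rule l2_inner_lborel[symmetric]) measurable
  also have "\<dots> = l2_inner a (inverse_integral b)"
    by (rule l2_inner_cong_AE) (use w(4) inverse_integral_L2[OF b] v(3) L1_L2_D(1)[OF a] in \<open>auto simp: inverse_integral_def elim: eventually_mono\<close>)
  finally show ?thesis .
qed

lemma l2_limit_reflect:
  assumes "\<psi> \<in> L2" "\<And>n. X n \<in> L2" "l2_limit X \<psi>"
  shows "l2_limit (\<lambda>n x. X n (- x)) (\<lambda>x. \<psi> (- x))"
  using assms(3) reflect_L2(2)[OF L2_diff[OF assms(1,2)]] by (simp add: l2_limit_def)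

lemma fourier_adjoint:
  assumes a: "a \<in> L2" and b: "b \<in> L2"
  shows "l2_inner (fourier a) b = l2_inner a (\<lambda>x. fourier b (- x))"
proof (rule LIMSEQ_unique)
  show "(\<lambda>n. l2_inner (fourier_integral (trunc a n)) (trunc b n)) \<longlonglongrightarrow> l2_inner (fourier a) b"
    by (intro l2_inner_limit fourier_transform fourier_trunc_L2 trunc_L2 trunc_limit a b)
  have "(\<lambda>n. l2_inner (trunc a n) (\<lambda>x. fourier_integral (trunc b n) (- x))) \<longlonglongrightarrow> l2_inner a (\<lambda>x. fourier b (- x))"
    by (intro l2_inner_limit fourier_transform fourier_trunc_L2 trunc_L2 trunc_limit reflect_L2 l2_limit_reflect a b)
  then show "(\<lambda>n. l2_inner (fourier_integral (trunc a n)) (trunc b n)) \<longlonglongrightarrow> l2_inner a (\<lambda>x. fourier b (- x))"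
    by (simp add: fourier_integral_adjoint trunc_L1_L2 a b inverse_integral_def[abs_def])
qed

text \<open>With \<open>T\<close> the transform and \<open>S\<close> its adjoint, which is \<open>T\<close> followed by reflection, both are
  isometries, so the squared norm of \<open>T S b - b\<close> expands to
  \<open>\<parallel>b\<parallel>\<^sup>2 + \<parallel>b\<parallel>\<^sup>2 - 2 Re \<langle>T S b, b\<rangle>\<close>, and the inner product is \<open>\<langle>S b, S b\<rangle> = \<parallel>b\<parallel>\<^sup>2\<close>.\<close>

theorem fourier_surjective:
  assumes b: "b \<in> L2"
  shows "AE \<xi> in lebesgue. fourier (\<lambda>x. fourier b (- x)) \<xi> = b \<xi>"
proof -
  let ?s = "\<lambda>x. fourier b (- x)"
  have s: "?s \<in> L2" "l2_sq ?s = l2_sq b"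
    using reflect_L2[OF fourier_transform(1)[OF b]] fourier_norm[OF b] by auto
  have "l2_sq (\<lambda>\<xi>. fourier ?s \<xi> - b \<xi>) = l2_sq (fourier ?s) + l2_sq b - 2 * Re (l2_inner (fourier ?s) b)"
    by (rule l2_sq_diff_expand[OF fourier_transform(1)[OF s(1)] b])
  also have "l2_inner (fourier ?s) b = l2_inner ?s ?s" by (rule fourier_adjoint[OF s(1) b])
  finally have "l2_sq (\<lambda>\<xi>. fourier ?s \<xi> - b \<xi>) = 0"
    using s by (simp add: fourier_norm l2_inner_self)
  from l2_sq_eq_0[OF L2_diff[OF fourier_transform(1)[OF s(1)] b] this] show ?thesis by simp
qed

lemma fourier_injective:
  assumes "\<phi> \<in> L2" "\<psi> \<in> L2" "AE \<xi> in lebesgue. fourier \<phi> \<xi> = fourier \<psi> \<xi>"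
  shows "AE x in lebesgue. \<phi> x = \<psi> x"
proof -
  have d: "(\<lambda>x. \<phi> x - 1 * \<psi> x) \<in> L2" by (intro L2_diff L2_cmult assms)
  have "(\<lambda>x::real. 0::complex) \<in> L2" by (simp add: L2_def)
  moreover have "AE \<xi> in lebesgue. fourier (\<lambda>x. \<phi> x - 1 * \<psi> x) \<xi> = 0"
    using fourier_linear[OF assms(1,2), of 1] assms(3) by eventually_elim simp
  ultimately have "l2_sq (fourier (\<lambda>x. \<phi> x - 1 * \<psi> x)) = l2_sq (\<lambda>x. 0)" by (rule l2_sq_cong_AE)
  then have "l2_sq (\<lambda>x. \<phi> x - 1 * \<psi> x) = 0" using fourier_norm[OF d] by (simp add: l2_sq_def)
  from l2_sq_eq_0[OF d this] show ?thesis by simp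
qed

lemma fourier_cong_AE:
  assumes "\<psi> \<in> L2" "AE x in lebesgue. \<phi> x = \<psi> x"
  shows "AE \<xi> in lebesgue. fourier \<phi> \<xi> = fourier \<psi> \<xi>"
proof -
  have phi: "\<phi> \<in> L2" by (rule L2_cong_AE[OF assms])
  have d: "(\<lambda>x. \<phi> x - 1 * \<psi> x) \<in> L2" by (intro L2_diff L2_cmult assms phi)
  have "(\<lambda>x::real. 0::complex) \<in> L2" by (simp add: L2_def)
  then have "l2_sq (\<lambda>x. \<phi> x - 1 * \<psi> x) = l2_sq (\<lambda>x. 0)"
    by (rule l2_sq_cong_AE) (use assms(2) in \<open>auto elim: eventually_mono\<close>)
  then have "l2_sq (fourier (\<lambda>x. \<phi> x - 1 * \<psi> x)) = 0" using fourier_norm[OF d] by (simp add: l2_sq_def)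
  from l2_sq_eq_0[OF fourier_transform(1)[OF d] this] fourier_linear[OF phi assms(1), of 1]
  show ?thesis by eventually_elim simp
qed

lemma fourier_scale:
  assumes "\<psi> \<in> L2"
  shows "AE \<xi> in lebesgue. fourier (\<lambda>x. c * \<psi> x) \<xi> = c * fourier \<psi> \<xi>"
proof -
  have z: "(\<lambda>x::real. 0::complex) \<in> L2" by (simp add: L2_def)
  have "l2_sq (fourier (\<lambda>x. 0)) = 0" using fourier_norm[OF z] by (simp add: l2_sq_def)
  from l2_sq_eq_0[OF fourier_transform(1)[OF z] this] fourier_linear[OF z assms, of "- c"]
  show ?thesis by eventually_elim simp
qed

lemma inv_fourier:
  assumes "\<phi> \<in> L2"
  shows "inv_fourier \<phi> \<in> L2" "AE \<xi> in lebesgue. fourier (inv_fourier \<phi>) \<xi> = \<phi> \<xi>"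
proof -
  have "\<exists>\<psi>. \<psi> \<in> L2 \<and> (AE \<xi> in lebesgue. fourier \<psi> \<xi> = \<phi> \<xi>)"
    using fourier_surjective[OF assms] reflect_L2(1)[OF fourier_transform(1)[OF assms]] by blast
  from someI_ex[OF this] show "inv_fourier \<phi> \<in> L2" "AE \<xi> in lebesgue. fourier (inv_fourier \<phi>) \<xi> = \<phi> \<xi>"
    unfolding inv_fourier_def by auto
qed

lemma fourier_inverse_integral:
  assumes u: "u \<in> L1_L2"
  shows "AE \<xi> in lebesgue. fourier (inverse_integral u) \<xi> = u \<xi>"
proof -
  have L: "u \<in> L2" by (rule L1_L2_D(1)[OF u])
  have "AE x in lebesgue. inverse_integral u x = fourier u (- x)"
    using AE_reflect[OF fourier_transform(1)[OF L] fourier_contraction(1)[OF u] fourier_eq_fourier_integral[OF u]]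
    by eventually_elim (simp add: inverse_integral_def)
  from fourier_cong_AE[OF reflect_L2(1)[OF fourier_transform(1)[OF L]] this] fourier_surjective[OF L]
  show ?thesis by eventually_elim simp
qed

context
  fixes f :: "real \<Rightarrow> real"
  assumes f_meas [measurable]: "f \<in> borel_measurable lebesgue" and f_bdd: "bounded (range f)"
begin

lemma bounded_multiplier_L2: "\<psi> \<in> L2 \<Longrightarrow> (\<lambda>x. complex_of_real (f x) * \<psi> x) \<in> L2"
proof -
  assume psi: "\<psi> \<in> L2"
  obtain C where "\<And>x. \<bar>f x\<bar> \<le> C" using f_bdd by (auto simp: bounded_iff)
  then show ?thesis by (intro L2_bounded_mult[OF psi, where C = C]) auto
qed

lemma fun_P:
  assumes "\<psi> \<in> L2"
  shows "fun_P f \<psi> \<in> L2" "AE \<xi> in lebesgue. fourier (fun_P f \<psi>) \<xi> = complex_of_real (f \<xi>) * fourier \<psi> \<xi>"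
  unfolding fun_P_def
  using inv_fourier[OF bounded_multiplier_L2[OF fourier_transform(1)[OF assms]]] by auto

lemma l2_inner_fun_P:
  assumes "\<phi> \<in> L2" "\<psi> \<in> L2"
  shows "l2_inner \<phi> (fun_P f \<psi>) = l2_inner (fourier \<phi>) (\<lambda>\<xi>. complex_of_real (f \<xi>) * fourier \<psi> \<xi>)"
proof -
  have "l2_inner \<phi> (fun_P f \<psi>) = l2_inner (fourier \<phi>) (fourier (fun_P f \<psi>))"
    by (rule fourier_inner[symmetric]) (intro assms fun_P)+
  also have "\<dots> = l2_inner (fourier \<phi>) (\<lambda>\<xi>. complex_of_real (f \<xi>) * fourier \<psi> \<xi>)"
    by (rule l2_inner_cong_AE)
       (use fun_P assms in \<open>auto intro!: bounded_multiplier_L2 fourier_transform\<close>)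
  finally show ?thesis .
qed

lemma fun_P_symmetric:
  assumes "\<phi> \<in> L2" "\<psi> \<in> L2"
  shows "l2_inner \<phi> (fun_P f \<psi>) = l2_inner (fun_P f \<phi>) \<psi>"
proof -
  have "l2_inner (fun_P f \<phi>) \<psi> = cnj (l2_inner \<psi> (fun_P f \<phi>))" by (rule l2_inner_cnj)
  then show ?thesis
    unfolding l2_inner_fun_P[OF assms] l2_inner_fun_P[OF assms(2,1)]
    using l2_inner_cnj[of "\<lambda>\<xi>. complex_of_real (f \<xi>) * fourier \<phi> \<xi>" "fourier \<psi>"]
    by (simp add: l2_inner_def mult.commute mult.left_commute)
qed

text \<open>On explicitly given momentum functions \<open>f(P)\<close> is an explicit integral, whatever representatives
  the definitions choose.\<close>

lemma fun_P_inverse_integral: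
  assumes u: "u \<in> L1_L2"
  shows "AE x in lebesgue. fun_P f (inverse_integral u) x = inverse_integral (\<lambda>\<xi>. complex_of_real (f \<xi>) * u \<xi>) x"
proof (rule fourier_injective)
  let ?fu = "\<lambda>\<xi>. complex_of_real (f \<xi>) * u \<xi>"
  obtain C where C: "\<And>x. \<bar>f x\<bar> \<le> C" using f_bdd by (auto simp: bounded_iff)
  have fu: "?fu \<in> L1_L2"
    using bounded_multiplier_L2[OF L1_L2_D(1)[OF u]] integrable_mult_bounded[OF L1_L2_D(2)[OF u], of "\<lambda>x. complex_of_real (f x)" C] C
    by (simp add: L1_L2_def)
  show "fun_P f (inverse_integral u) \<in> L2" by (intro fun_P inverse_integral_L2 u)
  show "inverse_integral ?fu \<in> L2" by (rule inverse_integral_L2[OF fu])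
  show "AE \<xi> in lebesgue. fourier (fun_P f (inverse_integral u)) \<xi> = fourier (inverse_integral ?fu) \<xi>"
    using fun_P(2)[OF inverse_integral_L2[OF u]] fourier_inverse_integral[OF fu] fourier_inverse_integral[OF u]
    by eventually_elim simp
qed

end


section \<open>The quadratic form of the commutator\<close>

text \<open>Both \<open>f(P)\<close> and \<open>g(Q)\<close> are symmetric, so the two terms of the commutator are conjugate to each
  other.\<close>

lemma commutator_form:
  assumes [measurable]: "f \<in> borel_measurable lebesgue" "g \<in> borel_measurable lebesgue"
    and "bounded (range f)" "bounded (range g)" and psi: "\<psi> \<in> L2"
  shows "l2_inner \<psi> (i_commutator f g \<psi>)
       = of_real (2 * Im (l2_inner (\<lambda>x. complex_of_real (g x) * \<psi> x) (fun_P f \<psi>)))"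
proof -
  let ?g = "\<lambda>\<phi> x. complex_of_real (g x) * \<phi> x"
  note gL = bounded_multiplier_L2[OF assms(2,4)] and fP = fun_P(1)[OF assms(1,3)]
  have "l2_inner \<psi> (i_commutator f g \<psi>) = l2_inner \<psi> (\<lambda>x. \<i> * (fun_P f (?g \<psi>) x - ?g (fun_P f \<psi>) x))"
    by (simp add: i_commutator_def commutator_def fun_Q_def)
  also have "\<dots> = \<i> * l2_inner \<psi> (\<lambda>x. fun_P f (?g \<psi>) x - ?g (fun_P f \<psi>) x)"
    by (simp add: l2_inner_def mult.left_commute[of _ \<i>])
  also have "\<dots> = \<i> * (l2_inner \<psi> (fun_P f (?g \<psi>)) - l2_inner \<psi> (?g (fun_P f \<psi>)))"
    by (intro arg_cong2[where f = "(*)"] refl l2_inner_diff_right psi gL fP)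
  also have "l2_inner \<psi> (fun_P f (?g \<psi>)) = cnj (l2_inner (?g \<psi>) (fun_P f \<psi>))"
    using fun_P_symmetric[OF assms(1,3) psi gL[OF psi]] l2_inner_cnj[of "fun_P f \<psi>"] by simp
  also have "l2_inner \<psi> (?g (fun_P f \<psi>)) = l2_inner (?g \<psi>) (fun_P f \<psi>)"
    by (simp add: l2_inner_def ac_simps)
  finally show ?thesis by (simp add: complex_eq_iff)
qed

lemma L1_L2_bounded_multiplier:
  assumes h: "h \<in> borel_measurable lebesgue" "bounded (range h)" and u: "u \<in> L1_L2"
  shows "(\<lambda>x. complex_of_real (h x) * u x) \<in> L1_L2"
proof -
  note [measurable] = h(1)
  obtain C where C: "\<And>x. \<bar>h x\<bar> \<le> C" using h(2) by (auto simp: bounded_iff)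
  show ?thesis
    using bounded_multiplier_L2[OF h L1_L2_D(1)[OF u]]
      integrable_mult_bounded[OF L1_L2_D(2)[OF u], of "\<lambda>x. complex_of_real (h x)" C] C
    by (simp add: L1_L2_def)
qed

text \<open>Positivity of the commutator on vectors given by their momentum function \<open>u\<close>, expressed by
  convergent integrals only.  The notion is not visibly symmetric in \<open>f\<close> and \<open>g\<close>; the operator
  provides it in both orders.\<close>

definition kato_positive :: "(real \<Rightarrow> real) \<Rightarrow> (real \<Rightarrow> real) \<Rightarrow> bool" where
  "kato_positive f g \<longleftrightarrow> (\<forall>u\<in>L1_L2.
     0 \<le> Im (l2_inner (\<lambda>x. complex_of_real (g x) * inverse_integral u x)
                       (inverse_integral (\<lambda>\<xi>. complex_of_real (f \<xi>) * u \<xi>))))"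

context
  fixes f g :: "real \<Rightarrow> real"
  assumes f: "f \<in> borel_measurable lebesgue" "bounded (range f)"
    and g: "g \<in> borel_measurable lebesgue" "bounded (range g)"
begin

lemma positive_form:
  assumes "positive_op (i_commutator f g)" "\<psi> \<in> L2"
  shows "0 \<le> Im (l2_inner (\<lambda>x. complex_of_real (g x) * \<psi> x) (fun_P f \<psi>))"
  using assms commutator_form[OF f(1) g(1) f(2) g(2) assms(2)]
  by (auto simp: positive_op_def complex_nonneg_Reals_iff)

lemma kato_positive_momentum:
  assumes "positive_op (i_commutator f g)"
  shows "kato_positive f g"
  unfolding kato_positive_def
proof
  fix u assume u: "u \<in> L1_L2"
  let ?\<psi> = "inverse_integral u"
  have psi: "?\<psi> \<in> L2" by (rule inverse_integral_L2[OF u])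
  have "l2_inner (\<lambda>x. complex_of_real (g x) * ?\<psi> x) (inverse_integral (\<lambda>\<xi>. complex_of_real (f \<xi>) * u \<xi>))
      = l2_inner (\<lambda>x. complex_of_real (g x) * ?\<psi> x) (fun_P f ?\<psi>)"
    by (rule l2_inner_cong_AE)
       (use fun_P_inverse_integral[OF f u] fun_P(1)[OF f psi] bounded_multiplier_L2[OF g psi]
         in \<open>auto elim: eventually_mono\<close>)
  then show "0 \<le> Im (l2_inner (\<lambda>x. complex_of_real (g x) * ?\<psi> x) (inverse_integral (\<lambda>\<xi>. complex_of_real (f \<xi>) * u \<xi>)))"
    using positive_form[OF assms psi] by simp
qed

text \<open>Here \<open>u\<close> describes the vector in position space.  Conjugating it turns the Fourier integrals that
  appear into inverse ones, which is the form required with \<open>f\<close> and \<open>g\<close> exchanged; the sign of the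
  commutator and the conjugation cancel.\<close>

lemma kato_positive_position:
  assumes "positive_op (i_commutator f g)"
  shows "kato_positive g f"
  unfolding kato_positive_def
proof
  fix u assume u: "u \<in> L1_L2"
  note [measurable] = L2_measurable[OF L1_L2_D(1)[OF u]]
  let ?v = "\<lambda>x. cnj (u x)" and ?f = "\<lambda>\<phi> x. complex_of_real (f x) * \<phi> x" and ?g = "\<lambda>\<phi> x. complex_of_real (g x) * \<phi> x"
  have v: "?v \<in> L1_L2" using u by (simp add: L1_L2_def L2_def)
  have vL: "?v \<in> L2" by (rule L1_L2_D(1)[OF v])
  have gv: "?g ?v \<in> L1_L2" by (rule L1_L2_bounded_multiplier[OF g v])
  have "l2_inner (?g ?v) (fun_P f ?v) = l2_inner (fourier (?g ?v)) (?f (fourier ?v))"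
    by (rule l2_inner_fun_P[OF f L1_L2_D(1)[OF gv] vL])
  also have "\<dots> = l2_inner (fourier_integral (?g ?v)) (?f (fourier_integral ?v))"
    by (rule l2_inner_cong_AE)
       (use fourier_eq_fourier_integral[OF gv] fourier_eq_fourier_integral[OF v] fourier_contraction(1)[OF gv]
         bounded_multiplier_L2[OF f fourier_contraction(1)[OF v]] in \<open>auto elim: eventually_mono\<close>)
  also have "\<dots> = l2_inner (?f (inverse_integral u)) (inverse_integral (?g u))"
  proof -
    have "fourier_integral ?v \<xi> = cnj (inverse_integral u \<xi>)" for \<xi>
      using arg_cong[OF cnj_fourier_integral[of ?v \<xi>], of cnj] by simp
    moreover have "cnj (fourier_integral (?g ?v) \<xi>) = inverse_integral (?g u) \<xi>" for \<xi>
      using cnj_fourier_integral[of "?g ?v" \<xi>] by simp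
    ultimately show ?thesis by (simp add: l2_inner_def ac_simps)
  qed
  finally show "0 \<le> Im (l2_inner (?f (inverse_integral u)) (inverse_integral (?g u)))"
    using positive_form[OF assms vL] by simp
qed

lemma fun_P_scale:
  assumes "\<psi> \<in> L2" shows "AE x in lebesgue. fun_P f (\<lambda>x. c * \<psi> x) x = c * fun_P f \<psi> x"
proof (rule fourier_injective)
  show "fun_P f (\<lambda>x. c * \<psi> x) \<in> L2" "(\<lambda>x. c * fun_P f \<psi> x) \<in> L2"
    by (intro fun_P[OF f] L2_cmult assms)+
  show "AE \<xi> in lebesgue. fourier (fun_P f (\<lambda>x. c * \<psi> x)) \<xi> = fourier (\<lambda>x. c * fun_P f \<psi> x) \<xi>"
    using fun_P(2)[OF f L2_cmult[OF assms, of c]] fun_P(2)[OF f assms] fourier_scale[OF assms, of c]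
      fourier_scale[OF fun_P(1)[OF f assms], of c]
    by eventually_elim simp
qed

lemma fun_P_const:
  assumes c: "AE x in lebesgue. f x = c" and psi: "\<psi> \<in> L2"
  shows "AE x in lebesgue. fun_P f \<psi> x = complex_of_real c * \<psi> x"
proof (rule fourier_injective)
  show "fun_P f \<psi> \<in> L2" "(\<lambda>x. complex_of_real c * \<psi> x) \<in> L2" by (intro fun_P[OF f] L2_cmult psi)+
  show "AE \<xi> in lebesgue. fourier (fun_P f \<psi>) \<xi> = fourier (\<lambda>x. complex_of_real c * \<psi> x) \<xi>"
    using fun_P(2)[OF f psi] fourier_scale[OF psi, of "complex_of_real c"] c by eventually_elim simp
qed

lemma fun_P_cong_AE:
  assumes "\<psi> \<in> L2" "AE x in lebesgue. \<phi> x = \<psi> x"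
  shows "AE x in lebesgue. fun_P f \<phi> x = fun_P f \<psi> x"
proof (rule fourier_injective)
  have phi: "\<phi> \<in> L2" by (rule L2_cong_AE[OF assms])
  show "fun_P f \<phi> \<in> L2" "fun_P f \<psi> \<in> L2" by (intro fun_P[OF f] phi assms)+
  show "AE \<xi> in lebesgue. fourier (fun_P f \<phi>) \<xi> = fourier (fun_P f \<psi>) \<xi>"
    using fun_P(2)[OF f phi] fun_P(2)[OF f assms(1)] fourier_cong_AE[OF assms] by eventually_elim simp
qed

text \<open>A nonzero commutator excludes constant \<open>f\<close> and \<open>g\<close>.  This is how the proof obtains points
  between which the functions strictly increase.\<close>

lemma commutator_const_zero:
  assumes "(AE x in lebesgue. f x = c) \<or> (AE x in lebesgue. g x = c)"
  shows "\<not> nonzero_op (i_commutator f g)"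
proof -
  have "AE x in lebesgue. i_commutator f g \<psi> x = 0" if psi: "\<psi> \<in> L2" for \<psi>
  proof -
    let ?g = "\<lambda>\<phi> x. complex_of_real (g x) * \<phi> x"
    have gL: "?g \<psi> \<in> L2" by (rule bounded_multiplier_L2[OF g psi])
    have "AE x in lebesgue. fun_P f (?g \<psi>) x = ?g (fun_P f \<psi>) x"
      using assms
    proof
      assume c: "AE x in lebesgue. f x = c"
      from fun_P_const[OF c gL] fun_P_const[OF c psi] show ?thesis by eventually_elim simp
    next
      assume c: "AE x in lebesgue. g x = c"
      then have "AE x in lebesgue. ?g \<psi> x = complex_of_real c * \<psi> x" by eventually_elim simp
      from fun_P_cong_AE[OF L2_cmult[OF psi] this] fun_P_scale[OF psi, of "complex_of_real c"] c
      show ?thesis by eventually_elim simp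
    qed
    then show ?thesis by eventually_elim (simp add: i_commutator_def commutator_def fun_Q_def)
  qed
  then show ?thesis by (auto simp: nonzero_op_def)
qed

end


section \<open>Absolutely continuous monotone functions\<close>

text \<open>Gauge integration makes the fundamental theorem direct.  At tags outside \<open>N\<close> the gauge comes from
  differentiability.  At tags in \<open>N\<close> it is an open set of small measure that covers \<open>N\<close>: there the
  integrand vanishes, and absolute continuity makes the sum of the increments of \<open>F\<close> small.\<close>

lemma abs_continuous_has_integral:
  assumes ac: "abs_continuous_on {a..b} F" and ab: "a \<le> b"
    and N: "negligible N" and deriv: "\<And>x. x \<notin> N \<Longrightarrow> (F has_real_derivative F' x) (at x)"
    and F'0: "\<And>x. x \<in> N \<Longrightarrow> F' x = 0"
  shows "(F' has_integral F b - F a) {a..b}"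
  unfolding has_integral_real
proof (intro allI impI)
  fix e :: real assume e: "e > 0"
  \<comment> \<open>The summand 1 covers the degenerate interval \<open>a = b\<close>.\<close>
  define e1 where "e1 = e / (2 * (b - a + 1))"
  have e1: "e1 > 0" "e1 * (b - a) < e / 2" using e ab by (auto simp: e1_def field_simps)
  have "\<exists>d>0. \<forall>y. \<bar>y - x\<bar> < d \<longrightarrow> \<bar>F y - F x - F' x * (y - x)\<bar> \<le> e1 * \<bar>y - x\<bar>" if "x \<notin> N" for x
    using deriv[OF that] e1(1) unfolding has_field_derivative_def has_derivative_at_alt by auto
  then obtain d where d: "\<And>x. x \<notin> N \<Longrightarrow> d x > 0"
    "\<And>x y. x \<notin> N \<Longrightarrow> \<bar>y - x\<bar> < d x \<Longrightarrow> \<bar>F y - F x - F' x * (y - x)\<bar> \<le> e1 * \<bar>y - x\<bar>"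
    by metis
  obtain \<delta> where \<delta>: "\<delta> > 0" and ac: "\<And>I :: (real \<times> real) set. finite I \<Longrightarrow> (\<forall>(u, v)\<in>I. u \<le> v \<and> {u..v} \<subseteq> {a..b}) \<Longrightarrow>
        pairwise (\<lambda>(u, v) (u', v'). {u<..<v} \<inter> {u'<..<v'} = {}) I \<Longrightarrow>
        (\<Sum>(u, v)\<in>I. v - u) < \<delta> \<Longrightarrow> (\<Sum>(u, v)\<in>I. \<bar>F v - F u\<bar>) < e / 2"
    using ac[unfolded abs_continuous_on_def, rule_format, of "e / 2"] e by auto
  have Ns: "N \<in> null_sets lebesgue" using N by (simp add: negligible_iff_null_sets)
  obtain T where T: "open T" "N \<subseteq> T" "(T - N) \<in> lmeasurable" "emeasure lebesgue (T - N) < ennreal \<delta>"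
    using sets_lebesgue_outer_open[OF _ \<delta>, of N] Ns by blast
  have "emeasure lebesgue T = emeasure lebesgue (T - N)"
    using emeasure_Diff_null_set[OF Ns, of T] T(1) by simp
  then have Tm: "emeasure lborel T < ennreal \<delta>" using T(1,4) by simp
  define \<gamma> where "\<gamma> x = (if x \<in> N then T else ball x (d x))" for x
  have g: "gauge \<gamma>" using T d by (auto simp: gauge_def \<gamma>_def)
  show "\<exists>\<gamma>. gauge \<gamma> \<and> (\<forall>p. p tagged_division_of {a..b} \<and> \<gamma> fine p \<longrightarrow>
          norm ((\<Sum>(x, k)\<in>p. measure lborel k *\<^sub>R F' x) - (F b - F a)) < e)"
  proof (intro exI[of _ \<gamma>] conjI g allI impI, elim conjE)
    fix p assume p: "p tagged_division_of {a..b}" and fine: "\<gamma> fine p"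
    note pD = tagged_division_ofD[OF p]
    have k: "\<exists>u v. k = {u..v} \<and> u \<le> v \<and> Inf k = u \<and> Sup k = v \<and> u \<le> x \<and> x \<le> v \<and> a \<le> u \<and> v \<le> b \<and> measure lborel k = v - u"
      if xk: "(x, k) \<in> p" for x k
    proof -
      obtain u v where uv: "k = {u..v}" using pD(4)[OF xk] by auto
      moreover have "x \<in> k" by (rule pD(2)[OF xk])
      moreover have "k \<subseteq> {a..b}" by (rule pD(3)[OF xk])
      ultimately show ?thesis by (intro exI[of _ u] exI[of _ v]) auto
    qed
    have tel: "F b - F a = (\<Sum>(x, k)\<in>p. F (Sup k) - F (Inf k))" "b - a = (\<Sum>(x, k)\<in>p. Sup k - Inf k)"
      using additive_tagged_division_1[OF ab p, of F] additive_tagged_division_1[OF ab p, of "\<lambda>x. x"] by auto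
    \<comment> \<open>Degenerate intervals are left out: they contribute nothing, and without them distinct tagged
      intervals have distinct endpoints.\<close>
    define pN where "pN = {z \<in> p. fst z \<in> N \<and> Inf (snd z) < Sup (snd z)}"
    define I where "I = (\<lambda>z. (Inf (snd z), Sup (snd z))) ` pN"
    have fpN: "finite pN" using pD(1) by (simp add: pN_def)
    have int: "interior k = {Inf k<..<Sup k}" if xk: "(x, k) \<in> p" for x k
    proof -
      obtain u v where "k = {u..v}" "Inf k = u" "Sup k = v" using k[OF xk] by blast
      then show ?thesis by simp
    qed
    have disj: "{Inf k<..<Sup k} \<inter> {Inf k'<..<Sup k'} = {}" if "(x, k) \<in> p" "(x', k') \<in> p" "(x, k) \<noteq> (x', k')" for x k x' k'
      using pD(5)[OF that] int[OF that(1)] int[OF that(2)] by simp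
    have inj: "inj_on (\<lambda>z. (Inf (snd z), Sup (snd z))) pN"
    proof (rule inj_onI)
      fix z z' assume z: "z \<in> pN" "z' \<in> pN" "(Inf (snd z), Sup (snd z)) = (Inf (snd z'), Sup (snd z'))"
      then obtain x k x' k' where zz: "z = (x, k)" "z' = (x', k')" by (meson surj_pair)
      show "z = z'"
      proof (rule ccontr)
        assume "z \<noteq> z'"
        then have "{Inf k<..<Sup k} = {}" using disj[of x k x' k'] z zz by (auto simp: pN_def)
        then show False using z zz by (auto simp: pN_def)
      qed
    qed
    have pw: "pairwise (\<lambda>(u, v) (u', v'). {u<..<v} \<inter> {u'<..<v'} = {}) I"
    proof (rule pairwiseI)
      fix i j assume "i \<in> I" "j \<in> I" "i \<noteq> j"
      have I: "\<exists>x k. (x, k) \<in> p \<and> i = (Inf k, Sup k)" if "i \<in> I" for i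
        using that unfolding I_def pN_def by force
      obtain x k x' k' where xk: "(x, k) \<in> p" "(x', k') \<in> p"
        and ij: "i = (Inf k, Sup k)" "j = (Inf k', Sup k')" using I[OF \<open>i \<in> I\<close>] I[OF \<open>j \<in> I\<close>] by metis
      then have "(x, k) \<noteq> (x', k')" using \<open>i \<noteq> j\<close> by auto
      with xk ij show "(case i of (u, v) \<Rightarrow> \<lambda>(u', v'). {u<..<v} \<inter> {u'<..<v'} = {}) j"
        using disj by simp
    qed
    have "(\<Sum>(u, v)\<in>I. ennreal (v - u)) = (\<Sum>i\<in>I. emeasure lborel ((\<lambda>(u, v). {u<..<v}) i))"
      by (intro sum.cong refl) (auto simp: I_def pN_def)
    also have "\<dots> = emeasure lborel (\<Union>i\<in>I. (\<lambda>(u, v). {u<..<v}) i)"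
    proof (rule sum_emeasure)
      show "disjoint_family_on (\<lambda>(u, v). {u<..<v}) I"
        using pw unfolding disjoint_family_on_def pairwise_def by fast
    qed (use fpN in \<open>auto simp: I_def\<close>)
    also have "\<dots> \<le> emeasure lborel T"
    proof (rule emeasure_mono)
      show "(\<Union>i\<in>I. (\<lambda>(u, v). {u<..<v}) i) \<subseteq> T"
      proof (clarsimp simp: I_def pN_def)
        fix x k y assume xk: "(x, k) \<in> p" "x \<in> N" "Inf k < y" "y < Sup k"
        have "k \<subseteq> \<gamma> x" using fine xk(1) by (auto simp: fine_def)
        then have "k \<subseteq> T" using xk(2) by (simp add: \<gamma>_def)
        then show "y \<in> T" using k[OF xk(1)] xk by fastforce
      qed
    qed (use T in auto)
    also have "\<dots> < ennreal \<delta>" by (rule Tm)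
    finally have "(\<Sum>(u, v)\<in>I. ennreal (v - u)) < ennreal \<delta>" .
    moreover have "(\<Sum>(u, v)\<in>I. ennreal (v - u)) = ennreal (\<Sum>(u, v)\<in>I. v - u)"
      by (subst sum_ennreal[symmetric]) (auto simp: I_def pN_def intro!: sum.cong)
    moreover have nn: "0 \<le> (\<Sum>(u, v)\<in>I. v - u)"
      by (intro sum_nonneg) (auto simp: I_def pN_def)
    ultimately have small: "(\<Sum>(u, v)\<in>I. v - u) < \<delta>"
      using ennreal_less_iff[OF nn] by simp
    have "(\<Sum>(u, v)\<in>I. \<bar>F v - F u\<bar>) < e / 2"
    proof (rule ac[OF _ _ pw small])
      show "finite I" using fpN by (simp add: I_def)
      show "\<forall>(u, v)\<in>I. u \<le> v \<and> {u..v} \<subseteq> {a..b}"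
        using k by (fastforce simp: I_def pN_def)
    qed
    then have bad: "(\<Sum>z\<in>pN. \<bar>F (Sup (snd z)) - F (Inf (snd z))\<bar>) < e / 2"
      by (simp add: I_def sum.reindex[OF inj] case_prod_beta)
    have each: "\<bar>measure lborel k * F' x - (F (Sup k) - F (Inf k))\<bar>
        \<le> e1 * (Sup k - Inf k) + (if x \<in> N \<and> Inf k < Sup k then \<bar>F (Sup k) - F (Inf k)\<bar> else 0)"
      if xk: "(x, k) \<in> p" for x k
    proof -
      obtain u v where uv: "k = {u..v}" "u \<le> v" "Inf k = u" "Sup k = v" "u \<le> x" "x \<le> v" "measure lborel k = v - u"
        using k[OF xk] by blast
      show ?thesis
      proof (cases "x \<in> N")
        case True
        have "0 \<le> e1 * (v - u)" using e1(1) uv(2) by simp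
        then show ?thesis using uv F'0[OF True] True by (cases "u = v") (auto simp: abs_minus_commute)
      next
        case False
        have "k \<subseteq> \<gamma> x" using fine xk by (auto simp: fine_def)
        then have "k \<subseteq> ball x (d x)" using False by (simp add: \<gamma>_def)
        moreover have "u \<in> k" "v \<in> k" using uv by auto
        ultimately have "u \<in> ball x (d x)" "v \<in> ball x (d x)" by blast+
        then have "\<bar>u - x\<bar> < d x" "\<bar>v - x\<bar> < d x" by (auto simp: dist_real_def)
        from d(2)[OF False this(1)] d(2)[OF False this(2)]
        have "\<bar>F u - F x - F' x * (u - x)\<bar> \<le> e1 * (x - u)" "\<bar>F v - F x - F' x * (v - x)\<bar> \<le> e1 * (v - x)"
          using uv by auto
        moreover have "(v - u) * F' x - (F v - F u) = (F u - F x - F' x * (u - x)) - (F v - F x - F' x * (v - x))"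
          by (simp add: algebra_simps)
        moreover have "e1 * (x - u) + e1 * (v - x) = e1 * (v - u)" by (simp add: algebra_simps)
        ultimately show ?thesis using uv False by simp
      qed
    qed
    have "\<bar>(\<Sum>(x, k)\<in>p. measure lborel k * F' x) - (F b - F a)\<bar> = \<bar>\<Sum>(x, k)\<in>p. measure lborel k * F' x - (F (Sup k) - F (Inf k))\<bar>"
      by (simp add: tel sum_subtractf case_prod_beta)
    also have "\<dots> \<le> (\<Sum>(x, k)\<in>p. e1 * (Sup k - Inf k) + (if x \<in> N \<and> Inf k < Sup k then \<bar>F (Sup k) - F (Inf k)\<bar> else 0))"
      by (rule order_trans[OF sum_abs]) (use each in \<open>auto intro!: sum_mono\<close>)
    also have "\<dots> = e1 * (b - a) + (\<Sum>z\<in>p. if fst z \<in> N \<and> Inf (snd z) < Sup (snd z) then \<bar>F (Sup (snd z)) - F (Inf (snd z))\<bar> else 0)"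
      by (simp add: tel(2) sum.distrib sum_distrib_left case_prod_beta)
    also have "(\<Sum>z\<in>p. if fst z \<in> N \<and> Inf (snd z) < Sup (snd z) then \<bar>F (Sup (snd z)) - F (Inf (snd z))\<bar> else 0)
        = (\<Sum>z\<in>pN. \<bar>F (Sup (snd z)) - F (Inf (snd z))\<bar>)"
      unfolding pN_def by (rule sum.inter_filter[symmetric]) (rule pD(1))
    finally show "norm ((\<Sum>(x, k)\<in>p. measure lborel k *\<^sub>R F' x) - (F b - F a)) < e"
      using bad e1(2) by simp
  qed
qed

text \<open>Increments of \<open>F\<close> are integrals of the nonnegative Borel function \<open>p\<close>.  All later arguments use a
  monotone function only through such a density.\<close>

definition monotone_density :: "(real \<Rightarrow> real) \<Rightarrow> (real \<Rightarrow> real) \<Rightarrow> bool" where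
  "monotone_density F p \<longleftrightarrow> p \<in> borel_measurable borel \<and> (\<forall>t. 0 \<le> p t) \<and> integrable lborel p \<and>
     (\<forall>x y. x \<le> y \<longrightarrow> F y - F x = (LINT t|lborel. indicator {x..y} t * p t))"

lemma ac_version_density:
  assumes ac: "ac_version f F F'" and mono: "mono F"
  obtains p where "monotone_density F p" "AE t in lborel. (F has_real_derivative p t) (at t)" "AE t in lebesgue. F' t = p t"
proof -
  have deriv: "AE t in lebesgue. (F has_real_derivative F' t) (at t)" and int: "integrable lebesgue F'"
    using ac by (auto simp: ac_version_def)
  obtain p0 where p0: "p0 \<in> borel_measurable lborel" "AE x in lborel. F' x = p0 x"
    using completion_ex_borel_measurable_real[OF borel_measurable_integrable[OF int]] by blast
  \<comment> \<open>Truncation at 0 changes nothing almost everywhere, since a monotone function has nonnegative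
    derivatives.\<close>
  define p where "p x = max 0 (p0 x)" for x
  have pm [measurable]: "p \<in> borel_measurable borel" using p0(1) by (auto simp: p_def[abs_def])
  have nonneg: "0 \<le> D" if "(F has_real_derivative D) (at t)" for D t
    using mono_on_imp_deriv_nonneg[of UNIV F D t] that mono by (auto simp: mono_on_def mono_def)
  have p0l: "AE x in lebesgue. F' x = p0 x" by (rule AE_completion[OF p0(2)])
  then have eq: "AE t in lebesgue. F' t = p t"
    using deriv by eventually_elim (use nonneg in \<open>auto simp: p_def\<close>)
  then have dp: "AE t in lebesgue. (F has_real_derivative p t) (at t)"
    using deriv by eventually_elim simp
  define N where "N = {t. \<not> (F has_real_derivative p t) (at t)}"
  have "N \<in> null_sets lebesgue"
    using dp by (simp add: completion.AE_iff_null_sets N_def)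
  then have N: "negligible N" by (simp add: negligible_iff_null_sets)
  have pl: "p \<in> borel_measurable lebesgue" using measurable_completion[of p lborel borel] pm by simp
  have "integrable lebesgue p" by (rule integrable_cong_AE_imp[OF int pl]) (use eq in \<open>auto elim: eventually_mono\<close>)
  then have pint: "integrable lborel p" by (simp add: integrable_completion)
  have "F y - F x = (LINT t|lborel. indicator {x..y} t * p t)" if "x \<le> y" for x y
  proof -
    have "((\<lambda>t. if t \<in> N then 0 else p t) has_integral F y - F x) {x..y}"
      by (rule abs_continuous_has_integral[OF _ that N]) (use ac in \<open>auto simp: ac_version_def N_def\<close>)
    then have "(p has_integral F y - F x) {x..y}"
      by (rule has_integral_spike[OF N, rotated]) auto
    moreover have "set_integrable lborel {x..y} p"
      unfolding set_integrable_def real_scaleR_def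
      by (rule integrable_real_mult_indicator[OF _ pint, unfolded mult.commute[of "p _"]]) simp
    ultimately show ?thesis
      using set_borel_integral_eq_integral(2)[of "{x..y}" p]
      by (simp add: set_lebesgue_integral_def integral_unique)
  qed
  moreover have "0 \<le> p t" for t by (simp add: p_def)
  ultimately have "monotone_density F p" using pint by (simp add: monotone_density_def)
  moreover have "AE t in lborel. (F has_real_derivative p t) (at t)" using dp by (simp add: AE_completion_iff)
  ultimately show ?thesis using eq by (rule that)
qed


section \<open>Divided differences as averages\<close>

definition divided_difference :: "(real \<Rightarrow> real) \<Rightarrow> real \<Rightarrow> real \<Rightarrow> real" where
  "divided_difference F x y = (F x - F y) / (x - y)"

lemma monotone_densityD:
  assumes "monotone_density F p"
  shows "p \<in> borel_measurable borel" "\<And>t. 0 \<le> p t" "integrable lborel p"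
    "\<And>x y. x \<le> y \<Longrightarrow> F y - F x = (LINT t|lborel. indicator {x..y} t * p t)"
  using assms by (auto simp: monotone_density_def)

lemma density_indicator_integrable:
  assumes "monotone_density F p" "A \<in> sets borel"
  shows "integrable lborel (\<lambda>t. indicator A t * p t)"
  using integrable_mult_indicator[OF _ monotone_densityD(3)[OF assms(1)], of A] assms(2) by simp

lemma monotone_density_mono:
  assumes "monotone_density F p" shows "mono F"
proof (rule monoI)
  fix x y :: real assume "x \<le> y"
  have "0 \<le> (LINT t|lborel. indicator {x..y} t * p t)"
    using monotone_densityD(2)[OF assms] by (intro integral_nonneg_AE) auto
  then show "F x \<le> F y" using monotone_densityD(4)[OF assms \<open>x \<le> y\<close>] by simp
qed

lemma monotone_density_measurable:
  assumes "monotone_density F p" shows "F \<in> borel_measurable borel"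
  using borel_measurable_mono[OF monotone_density_mono[OF assms]] .

lemma monotone_density_bound:
  assumes F: "monotone_density F p" shows "\<bar>F x - F y\<bar> \<le> (LINT t|lborel. p t)"
proof -
  have *: "\<bar>F x - F y\<bar> \<le> (LINT t|lborel. p t)" if "x \<le> y" for x y
  proof -
    have "F y - F x \<le> (LINT t|lborel. p t)"
      unfolding monotone_densityD(4)[OF F that]
      using monotone_densityD(2,3)[OF F] by (intro integral_mono density_indicator_integrable[OF F]) (auto simp: indicator_def)
    then show ?thesis using monoD[OF monotone_density_mono[OF F] that] by simp
  qed
  show ?thesis using *[of x y] *[of y x] by (cases "x \<le> y") auto
qed

lemma nn_increment:
  assumes F: "monotone_density F p" and "x \<le> y"
  shows "(\<integral>\<^sup>+t. indicator {x..y} t * ennreal (p t) \<partial>lborel) = ennreal (F y - F x)"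
proof -
  have "(\<integral>\<^sup>+t. indicator {x..y} t * ennreal (p t) \<partial>lborel) = (\<integral>\<^sup>+t. ennreal (indicator {x..y} t * p t) \<partial>lborel)"
    by (intro nn_integral_cong) (auto simp: indicator_def)
  also have "\<dots> = ennreal (LINT t|lborel. indicator {x..y} t * p t)"
    using density_indicator_integrable[OF F, of "{x..y}"] monotone_densityD(2)[OF F]
    by (intro nn_integral_eq_integral) auto
  finally show ?thesis using monotone_densityD(4)[OF assms] by simp
qed

lemma divided_difference_nonneg:
  assumes "mono F" shows "0 \<le> divided_difference F x y"
proof (cases "x \<le> y")
  case True
  then show ?thesis using monoD[OF assms True] unfolding divided_difference_def
    by (intro divide_nonpos_nonpos) auto
next
  case False
  then show ?thesis using monoD[OF assms, of y x] unfolding divided_difference_def by auto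
qed

lemma divided_difference_commute: "divided_difference F x y = divided_difference F y x"
  using minus_divide_divide[of "F y - F x" "y - x"] by (simp add: divided_difference_def)

text \<open>A divided difference is the average of the derivative over the segment between the two points.
  This removes the singularity at the diagonal from all later estimates.\<close>

lemma divided_difference_average:
  assumes F: "monotone_density F p" and s: "s \<noteq> 0"
  shows "ennreal (divided_difference F x (x + s)) = (\<integral>\<^sup>+\<theta>. indicator {0..1} \<theta> * ennreal (p (x + \<theta> * s)) \<partial>lborel)"
proof -
  note [measurable] = monotone_densityD(1)[OF F]
  define u v where "u = min x (x + s)" and "v = max x (x + s)"
  have uv: "u \<le> v" by (simp add: u_def v_def)
  have ind: "indicator {u..v} (x + s * \<theta>) = (indicator {0..1} \<theta> :: ennreal)" for \<theta>
  proof (cases "s > 0")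
    case True
    have "s * \<theta> \<le> s \<longleftrightarrow> \<theta> \<le> 1" "0 \<le> s * \<theta> \<longleftrightarrow> 0 \<le> \<theta>"
      using True mult_le_cancel_left_pos[of s \<theta> 1] by (auto simp: zero_le_mult_iff)
    then show ?thesis using True by (auto simp: u_def v_def indicator_def)
  next
    case False
    then have "s < 0" using s by simp
    then have "s \<le> s * \<theta> \<longleftrightarrow> \<theta> \<le> 1" "s * \<theta> \<le> 0 \<longleftrightarrow> 0 \<le> \<theta>"
      using mult_le_cancel_left_neg[of s 1 \<theta>] by (auto simp: mult_le_0_iff)
    then show ?thesis using \<open>s < 0\<close> by (auto simp: u_def v_def indicator_def)
  qed
  have "ennreal (F v - F u) = \<bar>s\<bar> * (\<integral>\<^sup>+\<theta>. indicator {u..v} (x + s * \<theta>) * ennreal (p (x + s * \<theta>)) \<partial>lborel)"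
    unfolding nn_increment[OF F uv, symmetric] by (rule nn_integral_real_affine[OF _ s]) measurable
  then have eq: "ennreal (F v - F u) = ennreal \<bar>s\<bar> * (\<integral>\<^sup>+\<theta>. indicator {0..1} \<theta> * ennreal (p (x + \<theta> * s)) \<partial>lborel)"
    unfolding ind by (simp only: mult.commute[of s])
  have "divided_difference F x (x + s) = (F v - F u) / \<bar>s\<bar>"
    using s by (auto simp: divided_difference_def u_def v_def min_def max_def abs_if field_simps)
  then have "ennreal (divided_difference F x (x + s)) = ennreal (F v - F u) / ennreal \<bar>s\<bar>"
    using s monoD[OF monotone_density_mono[OF F] uv] by (simp add: divide_ennreal)
  also have "\<dots> = (\<integral>\<^sup>+\<theta>. indicator {0..1} \<theta> * ennreal (p (x + \<theta> * s)) \<partial>lborel)"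
    unfolding eq mult.commute[of "ennreal \<bar>s\<bar>"] using s by (intro ennreal_mult_divide_eq) auto
  finally show ?thesis .
qed

lemma divided_difference_measurable:
  assumes "monotone_density F p"
  shows "(\<lambda>z. divided_difference F (fst z) (snd z)) \<in> borel_measurable (lborel \<Otimes>\<^sub>M lborel)"
proof -
  note [measurable] = monotone_density_measurable[OF assms]
  show ?thesis unfolding divided_difference_def by measurable
qed

text \<open>The pair of points at distance \<open>s\<close> whose convex combination with weight \<open>\<theta>\<close> is \<open>x\<close>.\<close>

definition spread :: "real \<times> real \<times> real \<Rightarrow> real \<times> real" where
  "spread = (\<lambda>(s, \<theta>, x). (x - \<theta> * s, x - \<theta> * s + s))"

definition spread_weight :: "(real \<Rightarrow> real) \<Rightarrow> real \<times> real \<times> real \<Rightarrow> real" where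
  "spread_weight p = (\<lambda>(s, \<theta>, x). indicator {0..1} \<theta> * p x)"

lemma spread_measurable [measurable]: "spread \<in> lborel \<Otimes>\<^sub>M (lborel \<Otimes>\<^sub>M lborel) \<rightarrow>\<^sub>M lborel \<Otimes>\<^sub>M lborel"
  unfolding spread_def by measurable

lemma spread_weight_measurable:
  assumes [measurable]: "p \<in> borel_measurable borel"
  shows "spread_weight p \<in> borel_measurable (lborel \<Otimes>\<^sub>M (lborel \<Otimes>\<^sub>M lborel))"
  unfolding spread_weight_def by measurable

text \<open>Substitute \<open>\<eta> = \<xi> + s\<close>, write the divided difference as an average, and shift \<open>\<xi>\<close> by \<open>\<theta> s\<close> so that the
  density is evaluated at an integration variable.\<close>

lemma nn_integral_divided_difference:
  assumes F: "monotone_density F p" and H [measurable]: "H \<in> borel_measurable (lborel \<Otimes>\<^sub>M lborel)"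
  shows "(\<integral>\<^sup>+z. H z * ennreal (divided_difference F (fst z) (snd z)) \<partial>(lborel \<Otimes>\<^sub>M lborel))
       = (\<integral>\<^sup>+s. \<integral>\<^sup>+\<theta>. \<integral>\<^sup>+x. H (spread (s, \<theta>, x)) * ennreal (spread_weight p (s, \<theta>, x)) \<partial>lborel \<partial>lborel \<partial>lborel)"
proof -
  note [measurable] = monotone_densityD(1)[OF F] monotone_density_measurable[OF F] divided_difference_measurable[OF F]
  have "(\<integral>\<^sup>+z. H z * ennreal (divided_difference F (fst z) (snd z)) \<partial>(lborel \<Otimes>\<^sub>M lborel))
      = (\<integral>\<^sup>+\<xi>. \<integral>\<^sup>+\<eta>. H (\<xi>, \<eta>) * ennreal (divided_difference F \<xi> \<eta>) \<partial>lborel \<partial>lborel)"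
  proof -
    have "(\<lambda>z. H z * ennreal (divided_difference F (fst z) (snd z))) \<in> borel_measurable (lborel \<Otimes>\<^sub>M lborel)"
      by measurable
    from lborel.nn_integral_fst[OF this] show ?thesis by simp
  qed
  also have "\<dots> = (\<integral>\<^sup>+\<xi>. \<integral>\<^sup>+s. H (\<xi>, \<xi> + s) * ennreal (divided_difference F \<xi> (\<xi> + s)) \<partial>lborel \<partial>lborel)"
  proof (rule nn_integral_cong)
    fix \<xi>
    show "(\<integral>\<^sup>+\<eta>. H (\<xi>, \<eta>) * ennreal (divided_difference F \<xi> \<eta>) \<partial>lborel)
        = (\<integral>\<^sup>+s. H (\<xi>, \<xi> + s) * ennreal (divided_difference F \<xi> (\<xi> + s)) \<partial>lborel)"
      using nn_integral_real_affine[of "\<lambda>\<eta>. H (\<xi>, \<eta>) * ennreal (divided_difference F \<xi> \<eta>)" 1 \<xi>]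
      unfolding divided_difference_def by simp
  qed
  also have "\<dots> = (\<integral>\<^sup>+\<xi>. \<integral>\<^sup>+s. \<integral>\<^sup>+\<theta>. H (\<xi>, \<xi> + s) * (indicator {0..1} \<theta> * ennreal (p (\<xi> + \<theta> * s))) \<partial>lborel \<partial>lborel \<partial>lborel)"
  proof (rule nn_integral_cong, rule nn_integral_cong_AE)
    fix \<xi> :: real
    show "AE s in lborel. H (\<xi>, \<xi> + s) * ennreal (divided_difference F \<xi> (\<xi> + s))
        = (\<integral>\<^sup>+\<theta>. H (\<xi>, \<xi> + s) * (indicator {0..1} \<theta> * ennreal (p (\<xi> + \<theta> * s))) \<partial>lborel)"
      using AE_lborel_singleton[of 0]
      by eventually_elim (simp add: divided_difference_average[OF F] nn_integral_cmult)
  qed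
  also have "\<dots> = (\<integral>\<^sup>+s. \<integral>\<^sup>+\<xi>. \<integral>\<^sup>+\<theta>. H (\<xi>, \<xi> + s) * (indicator {0..1} \<theta> * ennreal (p (\<xi> + \<theta> * s))) \<partial>lborel \<partial>lborel \<partial>lborel)"
    by (rule lborel_pair.Fubini') measurable
  also have "\<dots> = (\<integral>\<^sup>+s. \<integral>\<^sup>+\<theta>. \<integral>\<^sup>+\<xi>. H (\<xi>, \<xi> + s) * (indicator {0..1} \<theta> * ennreal (p (\<xi> + \<theta> * s))) \<partial>lborel \<partial>lborel \<partial>lborel)"
    by (intro nn_integral_cong lborel_pair.Fubini') measurable
  also have "\<dots> = (\<integral>\<^sup>+s. \<integral>\<^sup>+\<theta>. \<integral>\<^sup>+x. H (spread (s, \<theta>, x)) * ennreal (spread_weight p (s, \<theta>, x)) \<partial>lborel \<partial>lborel \<partial>lborel)"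
  proof (rule nn_integral_cong, rule nn_integral_cong)
    fix s \<theta> :: real
    have "(\<integral>\<^sup>+\<xi>. H (\<xi>, \<xi> + s) * (indicator {0..1} \<theta> * ennreal (p (\<xi> + \<theta> * s))) \<partial>lborel)
        = ennreal \<bar>1\<bar> * (\<integral>\<^sup>+x. H (- \<theta> * s + 1 * x, - \<theta> * s + 1 * x + s) * (indicator {0..1} \<theta> * ennreal (p (- \<theta> * s + 1 * x + \<theta> * s))) \<partial>lborel)"
      by (rule nn_integral_real_affine) measurable
    then show "(\<integral>\<^sup>+\<xi>. H (\<xi>, \<xi> + s) * (indicator {0..1} \<theta> * ennreal (p (\<xi> + \<theta> * s))) \<partial>lborel)
        = (\<integral>\<^sup>+x. H (spread (s, \<theta>, x)) * ennreal (spread_weight p (s, \<theta>, x)) \<partial>lborel)"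
      by (auto simp: spread_def spread_weight_def indicator_def algebra_simps intro!: nn_integral_cong)
  qed
  finally show ?thesis .
qed

text \<open>The averaging formula as an identity of measures on the plane: the divided difference times
  Lebesgue measure is the image of \<open>p x dx d\<theta> ds\<close>, with \<open>\<theta>\<close> in the unit interval.  Stated for
  measures, it transfers integrability and complex integrals at once.\<close>

lemma divided_difference_distr:
  assumes F: "monotone_density F p"
  shows "density (lborel \<Otimes>\<^sub>M lborel) (\<lambda>z. ennreal (divided_difference F (fst z) (snd z)))
       = distr (density (lborel \<Otimes>\<^sub>M (lborel \<Otimes>\<^sub>M lborel)) (\<lambda>w. ennreal (spread_weight p w))) (lborel \<Otimes>\<^sub>M lborel) spread"
proof (rule measure_eqI)
  note [measurable] = monotone_densityD(1)[OF F] divided_difference_measurable[OF F] spread_weight_measurable[OF monotone_densityD(1)[OF F]]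
  fix A :: "(real \<times> real) set"
  assume "A \<in> sets (density (lborel \<Otimes>\<^sub>M lborel) (\<lambda>z. ennreal (divided_difference F (fst z) (snd z))))"
  then have A [measurable]: "A \<in> sets (lborel \<Otimes>\<^sub>M lborel)" by simp
  have "emeasure (density (lborel \<Otimes>\<^sub>M lborel) (\<lambda>z. ennreal (divided_difference F (fst z) (snd z)))) A
      = (\<integral>\<^sup>+z. indicator A z * ennreal (divided_difference F (fst z) (snd z)) \<partial>(lborel \<Otimes>\<^sub>M lborel))"
    by (subst emeasure_density[OF _ A]) (measurable, simp add: mult.commute)
  also have "\<dots> = (\<integral>\<^sup>+s. \<integral>\<^sup>+\<theta>. \<integral>\<^sup>+x. indicator A (spread (s, \<theta>, x)) * ennreal (spread_weight p (s, \<theta>, x)) \<partial>lborel \<partial>lborel \<partial>lborel)"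
    by (rule nn_integral_divided_difference[OF F]) measurable
  also have "\<dots> = (\<integral>\<^sup>+s. \<integral>\<^sup>+w. indicator A (spread (s, w)) * ennreal (spread_weight p (s, w)) \<partial>(lborel \<Otimes>\<^sub>M lborel) \<partial>lborel)"
  proof (rule nn_integral_cong)
    fix s :: real
    have "(\<lambda>w. indicator A (spread (s, w)) * ennreal (spread_weight p (s, w))) \<in> borel_measurable (lborel \<Otimes>\<^sub>M lborel)"
      by measurable
    from lborel.nn_integral_fst[OF this]
    show "(\<integral>\<^sup>+\<theta>. \<integral>\<^sup>+x. indicator A (spread (s, \<theta>, x)) * ennreal (spread_weight p (s, \<theta>, x)) \<partial>lborel \<partial>lborel)
        = (\<integral>\<^sup>+w. indicator A (spread (s, w)) * ennreal (spread_weight p (s, w)) \<partial>(lborel \<Otimes>\<^sub>M lborel))" .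
  qed
  also have "\<dots> = (\<integral>\<^sup>+w. indicator A (spread w) * ennreal (spread_weight p w) \<partial>(lborel \<Otimes>\<^sub>M (lborel \<Otimes>\<^sub>M lborel)))"
    using sigma_finite_measure.nn_integral_fst[of "lborel \<Otimes>\<^sub>M lborel" "\<lambda>w. indicator A (spread w) * ennreal (spread_weight p w)" lborel]
      lborel_pair.sigma_finite_measure_axioms by simp
  also have "\<dots> = (\<integral>\<^sup>+w. indicator A (spread w) \<partial>density (lborel \<Otimes>\<^sub>M (lborel \<Otimes>\<^sub>M lborel)) (\<lambda>w. ennreal (spread_weight p w)))"
    by (subst nn_integral_density) (auto simp: mult.commute)
  also have "\<dots> = (\<integral>\<^sup>+z. indicator A z \<partial>distr (density (lborel \<Otimes>\<^sub>M (lborel \<Otimes>\<^sub>M lborel)) (\<lambda>w. ennreal (spread_weight p w))) (lborel \<Otimes>\<^sub>M lborel) spread)"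
    by (subst nn_integral_distr) auto
  also have "\<dots> = emeasure (distr (density (lborel \<Otimes>\<^sub>M (lborel \<Otimes>\<^sub>M lborel)) (\<lambda>w. ennreal (spread_weight p w))) (lborel \<Otimes>\<^sub>M lborel) spread) A"
    by (rule nn_integral_indicator) (simp only: sets_distr A)
  finally show "emeasure (density (lborel \<Otimes>\<^sub>M lborel) (\<lambda>z. ennreal (divided_difference F (fst z) (snd z)))) A
      = emeasure (distr (density (lborel \<Otimes>\<^sub>M (lborel \<Otimes>\<^sub>M lborel)) (\<lambda>w. ennreal (spread_weight p w))) (lborel \<Otimes>\<^sub>M lborel) spread) A" .
qed simp

text \<open>If both endpoints lie in \<open>{a..b}\<close> then so does the point in between, and their distance is at most
  \<open>b - a\<close>.  On small squares at a point of differentiability the bound is of second order, as the limit in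
  \<open>determinant_inequality\<close> requires.\<close>

lemma divided_difference_box:
  assumes F: "monotone_density F p" and ab: "a \<le> b"
  shows "(\<integral>\<^sup>+z. indicator ({a..b} \<times> {a..b}) z * ennreal (divided_difference F (fst z) (snd z)) \<partial>(lborel \<Otimes>\<^sub>M lborel))
       \<le> ennreal (2 * (b - a) * (F b - F a))"
proof -
  note [measurable] = monotone_densityD(1)[OF F]
  have [measurable]: "{a..b} \<times> {a..b} \<in> sets (lborel \<Otimes>\<^sub>M lborel)" by auto
  have "(\<integral>\<^sup>+z. indicator ({a..b} \<times> {a..b}) z * ennreal (divided_difference F (fst z) (snd z)) \<partial>(lborel \<Otimes>\<^sub>M lborel))
      = (\<integral>\<^sup>+s. \<integral>\<^sup>+\<theta>. \<integral>\<^sup>+x. indicator ({a..b} \<times> {a..b}) (spread (s, \<theta>, x)) * ennreal (spread_weight p (s, \<theta>, x)) \<partial>lborel \<partial>lborel \<partial>lborel)"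
    by (rule nn_integral_divided_difference[OF F]) measurable
  also have "\<dots> \<le> (\<integral>\<^sup>+s. \<integral>\<^sup>+\<theta>. \<integral>\<^sup>+x. indicator {-(b-a)..b-a} s * (indicator {0..1::real} \<theta> * (indicator {a..b} x * ennreal (p x))) \<partial>lborel \<partial>lborel \<partial>lborel)"
  proof (rule nn_integral_mono, rule nn_integral_mono, rule nn_integral_mono)
    fix s \<theta> x :: real
    show "indicator ({a..b} \<times> {a..b}) (spread (s, \<theta>, x)) * ennreal (spread_weight p (s, \<theta>, x))
       \<le> indicator {-(b-a)..b-a} s * (indicator {0..1} \<theta> * (indicator {a..b} x * ennreal (p x)))"
    proof (cases "spread (s, \<theta>, x) \<in> {a..b} \<times> {a..b} \<and> \<theta> \<in> {0..1}")
      case True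
      then have h: "a \<le> x - \<theta> * s" "x - \<theta> * s \<le> b" "a \<le> x - \<theta> * s + s" "x - \<theta> * s + s \<le> b" "0 \<le> \<theta>" "\<theta> \<le> 1"
        by (auto simp: spread_def)
      have xx: "x = (1 - \<theta>) * (x - \<theta> * s) + \<theta> * (x - \<theta> * s + s)" by (simp add: algebra_simps)
      have "a \<le> x" "x \<le> b"
        using h convex_bound_le[of "x - \<theta> * s" b "x - \<theta> * s + s" "1 - \<theta>" \<theta>]
          convex_bound_le[of "- (x - \<theta> * s)" "- a" "- (x - \<theta> * s + s)" "1 - \<theta>" \<theta>] xx
        by (auto simp: algebra_simps)
      then show ?thesis using h True by (auto simp: spread_weight_def indicator_def)
    next
      case False
      then show ?thesis by (auto simp: spread_weight_def indicator_def)
    qed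
  qed
  also have "\<dots> = ennreal (2 * (b - a)) * ennreal (F b - F a)"
    using ab by (simp add: nn_integral_cmult nn_integral_multc nn_increment[OF F ab])
  also have "\<dots> = ennreal (2 * (b - a) * (F b - F a))"
    using ab monoD[OF monotone_density_mono[OF F] ab] by (simp add: ennreal_mult)
  finally show ?thesis .
qed


section \<open>Test functions, damping and the kernel\<close>

definition density_transform :: "(real \<Rightarrow> real) \<Rightarrow> real \<Rightarrow> complex" where
  "density_transform q s = (LINT t|lborel. iexp (- (s * t)) * complex_of_real (q t))"

text \<open>Bounded Borel functions with bounded support.\<close>

definition test_function :: "(real \<Rightarrow> complex) \<Rightarrow> bool" where
  "test_function u \<longleftrightarrow> u \<in> borel_measurable borel \<and> (\<exists>R. \<forall>x. \<bar>x\<bar> > R \<longrightarrow> u x = 0) \<and> (\<exists>M. \<forall>x. cmod (u x) \<le> M)"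

text \<open>The quadratic form of the kernel of the commutator in the momentum representation, without the
  factor \<open>1/(2 pi)\<close>.\<close>

definition dd_form :: "(real \<Rightarrow> real) \<Rightarrow> (real \<Rightarrow> real) \<Rightarrow> (real \<Rightarrow> complex) \<Rightarrow> complex" where
  "dd_form F q u = (LINT z|(lborel \<Otimes>\<^sub>M lborel). cnj (u (snd z)) * u (fst z) *
     (complex_of_real (divided_difference F (fst z) (snd z)) * density_transform q (snd z - fst z)))"

lemma density_transform_measurable [measurable]:
  assumes [measurable]: "q \<in> borel_measurable borel"
  shows "density_transform q \<in> borel_measurable borel"
  unfolding density_transform_def by measurable

lemma density_transform_bound:
  assumes q: "integrable lborel q" "\<And>t. 0 \<le> q t" shows "cmod (density_transform q s) \<le> (LINT t|lborel. q t)"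
proof -
  have "cmod (density_transform q s) \<le> (LINT t|lborel. norm (iexp (- (s * t)) * complex_of_real (q t)))"
    unfolding density_transform_def by (rule integral_norm_bound)
  also have "\<dots> = (LINT t|lborel. q t)" using q(2) by (simp add: norm_mult)
  finally show ?thesis .
qed

lemma test_function_L1_L2:
  assumes "test_function u" shows "u \<in> L1_L2"
proof -
  obtain R M where "u \<in> borel_measurable borel" "\<And>x. \<bar>x\<bar> > R \<Longrightarrow> u x = 0" "\<And>x. cmod (u x) \<le> M"
    using assms by (auto simp: test_function_def)
  moreover have "u \<in> borel_measurable lebesgue"
    using measurable_completion[of u lborel borel] calculation(1) by simp
  ultimately show ?thesis using bounded_support_L1_L2 by blast
qed

lemma test_function_integrable:
  assumes "test_function u" shows "integrable lborel u"
  using L1_L2_D(2)[OF test_function_L1_L2[OF assms]] assms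
  by (simp add: integrable_completion test_function_def)

lemma test_function_mult:
  assumes u: "test_function u" and m: "m \<in> borel_measurable borel" "\<And>x. \<bar>m x\<bar> \<le> C"
  shows "test_function (\<lambda>x. complex_of_real (m x) * u x)"
proof -
  obtain R M where u: "u \<in> borel_measurable borel" "\<And>x. \<bar>x\<bar> > R \<Longrightarrow> u x = 0" "\<And>x. cmod (u x) \<le> M"
    using u by (auto simp: test_function_def)
  note [measurable] = u(1) m(1)
  have "(\<lambda>x. complex_of_real (m x) * u x) \<in> borel_measurable borel" by measurable
  moreover have "cmod (complex_of_real (m x) * u x) \<le> C * M" for x
    using m(2)[of x] u(3)[of x] by (simp add: norm_mult mult_mono)
  moreover have "\<forall>x. \<bar>x\<bar> > R \<longrightarrow> complex_of_real (m x) * u x = 0" using u(2) by simp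
  ultimately show ?thesis unfolding test_function_def by blast
qed

lemma inverse_integral_lborel:
  assumes "w \<in> borel_measurable borel"
  shows "inverse_integral w x = (LINT \<xi>|lborel. (iexp (x * \<xi>) / sqrt (2 * pi)) * w \<xi>)"
  unfolding inverse_integral_def fourier_integral_lborel[OF assms] by simp

lemma l2_inner_inverse_integral:
  assumes "a \<in> L1_L2" "b \<in> L1_L2"
  shows "l2_inner (inverse_integral a) (inverse_integral b) = l2_inner a b"
proof -
  have "l2_inner (inverse_integral a) (inverse_integral b)
      = l2_inner (fourier (inverse_integral a)) (fourier (inverse_integral b))"
    by (rule fourier_inner[symmetric]) (intro inverse_integral_L2 assms)+
  also have "\<dots> = l2_inner a b"
    by (rule l2_inner_cong_AE) (intro L1_L2_D fourier_inverse_integral assms)+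
  finally show ?thesis .
qed

lemma integral_pair_product:
  fixes A B :: "real \<Rightarrow> complex"
  assumes A: "integrable lborel A" and B: "integrable lborel B"
  shows "integrable (lborel \<Otimes>\<^sub>M lborel) (\<lambda>z. A (fst z) * B (snd z))"
    "(LINT z|(lborel \<Otimes>\<^sub>M lborel). A (fst z) * B (snd z)) = (LINT x|lborel. A x) * (LINT x|lborel. B x)"
proof -
  have "integrable (lborel \<Otimes>\<^sub>M lborel) (\<lambda>(s, t). A s * (1 * B t))"
    by (rule integrable_bounded_kernel[OF A B, of _ 1]) auto
  then show i: "integrable (lborel \<Otimes>\<^sub>M lborel) (\<lambda>z. A (fst z) * B (snd z))" by (simp add: case_prod_unfold)
  show "(LINT z|(lborel \<Otimes>\<^sub>M lborel). A (fst z) * B (snd z)) = (LINT x|lborel. A x) * (LINT x|lborel. B x)"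
    using lborel_pair.integral_fst'[OF i] by simp
qed

lemma divided_difference_form_integrable:
  assumes F: "monotone_density F p" and u: "test_function u"
  shows "integrable (lborel \<Otimes>\<^sub>M lborel)
    (\<lambda>z. cnj (u (snd z)) * u (fst z) * complex_of_real (divided_difference F (fst z) (snd z)))"
proof (rule integrableI_bounded)
  obtain R M where u: "u \<in> borel_measurable borel" "\<And>x. \<bar>x\<bar> > R \<Longrightarrow> u x = 0" "\<And>x. cmod (u x) \<le> M"
    using u by (auto simp: test_function_def)
  define r where "r = \<bar>R\<bar>"
  have M0: "0 \<le> M" using u(3)[of 0] norm_ge_zero order_trans by blast
  note [measurable] = u(1) divided_difference_measurable[OF F]
  show "(\<lambda>z. cnj (u (snd z)) * u (fst z) * complex_of_real (divided_difference F (fst z) (snd z))) \<in> borel_measurable (lborel \<Otimes>\<^sub>M lborel)"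
    by measurable
  have bd: "ennreal (norm (cnj (u (snd z)) * u (fst z) * complex_of_real (divided_difference F (fst z) (snd z))))
      \<le> ennreal (M * M) * (indicator ({-r..r} \<times> {-r..r}) z * ennreal (divided_difference F (fst z) (snd z)))" for z
  proof (cases "z \<in> {-r..r} \<times> {-r..r}")
    case True
    have dd: "0 \<le> divided_difference F (fst z) (snd z)"
      by (rule divided_difference_nonneg[OF monotone_density_mono[OF F]])
    have "norm (cnj (u (snd z)) * u (fst z) * complex_of_real (divided_difference F (fst z) (snd z)))
        \<le> (M * M) * divided_difference F (fst z) (snd z)"
      using dd M0 u(3)[of "fst z"] u(3)[of "snd z"] by (auto simp: norm_mult intro!: mult_mono mult_nonneg_nonneg)
    then show ?thesis using True dd M0 by (simp add: ennreal_mult[symmetric] ennreal_leI)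
  next
    case False
    then have "u (fst z) = 0 \<or> u (snd z) = 0"
      using u(2)[of "fst z"] u(2)[of "snd z"] by (cases z) (auto simp: r_def abs_if split: if_splits)
    then show ?thesis by auto
  qed
  have "(\<integral>\<^sup>+z. ennreal (norm (cnj (u (snd z)) * u (fst z) * complex_of_real (divided_difference F (fst z) (snd z)))) \<partial>(lborel \<Otimes>\<^sub>M lborel))
      \<le> (\<integral>\<^sup>+z. ennreal (M * M) * (indicator ({-r..r} \<times> {-r..r}) z * ennreal (divided_difference F (fst z) (snd z))) \<partial>(lborel \<Otimes>\<^sub>M lborel))"
    by (intro nn_integral_mono bd)
  also have "\<dots> = ennreal (M * M) * (\<integral>\<^sup>+z. indicator ({-r..r} \<times> {-r..r}) z * ennreal (divided_difference F (fst z) (snd z)) \<partial>(lborel \<Otimes>\<^sub>M lborel))"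
    by (rule nn_integral_cmult) measurable
  also have "\<dots> \<le> ennreal (M * M) * ennreal (2 * (r - - r) * (F r - F (- r)))"
    by (intro mult_left_mono divided_difference_box[OF F]) (auto simp: r_def)
  also have "\<dots> < \<infinity>" by (simp add: ennreal_mult_less_top)
  finally show "(\<integral>\<^sup>+z. ennreal (norm (cnj (u (snd z)) * u (fst z) * complex_of_real (divided_difference F (fst z) (snd z)))) \<partial>(lborel \<Otimes>\<^sub>M lborel)) < \<infinity>" .
qed

lemma damping_integrable:
  fixes e t :: real
  assumes "e > 0"
  shows "integrable lborel (\<lambda>x. indicator {t<..} x * exp (- (e * (x - t))))"
proof -
  have "prob_space (density lborel (exponential_density e))"
    by (rule prob_space_exponential_density[OF assms])
  then have "(\<integral>\<^sup>+x. ennreal (exponential_density e x) \<partial>lborel) = 1"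
    using prob_space.emeasure_space_1[of "density lborel (exponential_density e)"] by (simp add: emeasure_density)
  then have i: "integrable lborel (exponential_density e)"
    using assms by (intro integrableI_bounded) (auto simp: exponential_density_nonneg)
  have "integrable lborel (\<lambda>x. exponential_density e (- t + 1 * x))"
    by (rule lborel_integrable_real_affine[OF i]) simp
  then have "integrable lborel (\<lambda>x. (1 / e) * exponential_density e (- t + 1 * x))" by simp
  then show ?thesis
    by (rule Bochner_Integration.integrable_bound) (use assms in \<open>auto simp: exponential_density_def indicator_def algebra_simps\<close>)
qed

lemma fourier_damping:
  assumes e: "e > 0"
  shows "(LINT x|lborel. iexp (x * \<omega>) * complex_of_real (indicator {t<..} x * exp (- (e * (x - t)))))
       = iexp (t * \<omega>) / (complex_of_real e - \<i> * complex_of_real \<omega>)"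
proof -
  define c where "c = complex_of_real e - \<i> * complex_of_real \<omega>"
  have c0: "c \<noteq> 0" using e by (auto simp: c_def complex_eq_iff)
  define f where "f x = iexp (x * \<omega>) * complex_of_real (exp (- (e * (x - t))))" for x
  define P where "P x = - f x / c" for x
  have int: "integrable lborel (\<lambda>x. iexp (x * \<omega>) * complex_of_real (indicator {t<..} x * exp (- (e * (x - t)))))"
  proof (rule integrable_mult_bounded[where C = 1])
    show "integrable lborel (\<lambda>x. complex_of_real (indicator {t<..} x * exp (- (e * (x - t)))))"
      by (rule integrable_of_real[OF damping_integrable[OF e]])
  qed auto
  have ind: "iexp (x * \<omega>) * complex_of_real (indicator {t<..} x * exp (- (e * (x - t)))) = indicator {t<..} x *\<^sub>R f x" for x
    by (simp add: f_def indicator_def)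
  have f': "f x = exp (- (c * (of_real x - of_real t))) * iexp (t * \<omega>)" for x
    by (simp add: f_def c_def exp_of_real[symmetric] mult_exp_exp algebra_simps)
  have "(LBINT x=ereal t..\<infinity>. f x) = 0 - P t"
  proof (rule interval_integral_FTC_integrable)
    show "(P has_vector_derivative f x) (at x)" for x
    proof -
      have "((\<lambda>z. - (exp (- (c * (z - of_real t))) * iexp (t * \<omega>)) / c) has_field_derivative
          exp (- (c * (of_real x - of_real t))) * iexp (t * \<omega>)) (at (of_real x))"
        using c0 by (auto intro!: derivative_eq_intros)
      from has_vector_derivative_real_field[OF this] show ?thesis
        by (simp add: P_def[abs_def] f')
    qed
    show "isCont f x" for x unfolding f_def by (intro continuous_intros)
    show "set_integrable lborel (einterval (ereal t) \<infinity>) f"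
      using int unfolding ind set_integrable_def einterval_def by (simp add: greaterThan_def)
    have "isCont P t" unfolding P_def f_def by (intro continuous_intros c0)
    then show "((P \<circ> real_of_ereal) \<longlongrightarrow> P t) (at_right (ereal t))"
      unfolding ereal_tendsto_simps isCont_def by (rule filterlim_mono) (auto simp: at_within_le_at)
    have "((\<lambda>x. exp (- (e * (x - t)))) \<longlongrightarrow> 0) at_top"
    proof (rule filterlim_compose[OF exp_at_bot])
      have "filterlim (\<lambda>x. e * (- t + x)) at_top at_top"
        by (intro filterlim_tendsto_pos_mult_at_top[OF tendsto_const e]
            filterlim_tendsto_add_at_top[OF tendsto_const] filterlim_ident)
      then show "filterlim (\<lambda>x. - (e * (x - t))) at_bot at_top"
        by (simp add: filterlim_uminus_at_top)
    qed
    then have "((\<lambda>x. exp (- (e * (x - t))) / cmod c) \<longlongrightarrow> 0 / cmod c) at_top"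
      using c0 by (intro tendsto_intros) auto
    moreover have "norm (P x) = exp (- (e * (x - t))) / cmod c" for x
      by (simp add: P_def f_def norm_divide norm_mult)
    ultimately have "(P \<longlongrightarrow> 0) at_top"
      by (intro tendsto_norm_zero_cancel[of P]) simp
    then show "((P \<circ> real_of_ereal) \<longlongrightarrow> 0) (at_left \<infinity>)"
      by (simp add: ereal_tendsto_simps)
  qed simp
  then have "(LINT x|lborel. indicator {t<..} x *\<^sub>R f x) = - P t"
    by (simp add: interval_integral_to_infinity_eq set_lebesgue_integral_def)
  then show ?thesis unfolding ind by (simp add: P_def f_def c_def)
qed

text \<open>The constant is the value of \<open>G\<close> at minus infinity.\<close>

lemma monotone_density_cumulative:
  assumes G: "monotone_density G q"
  obtains c where "\<And>x. G x = c + (LINT t|lborel. indicator {..x} t * q t)"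
proof -
  note Gi = density_indicator_integrable[OF G]
  have split: "(LINT t|lborel. indicator {..y} t * q t) - (LINT t|lborel. indicator {..x} t * q t) = G y - G x" if "x \<le> y" for x y
  proof -
    have "(LINT t|lborel. indicator {..y} t * q t) - (LINT t|lborel. indicator {..x} t * q t)
        = (LINT t|lborel. indicator {..y} t * q t - indicator {..x} t * q t)"
      by (rule Bochner_Integration.integral_diff[symmetric]) (intro Gi; simp)+
    also have "\<dots> = (LINT t|lborel. indicator {x..y} t * q t)"
    proof (rule integral_cong_AE)
      note [measurable] = monotone_densityD(1)[OF G]
      show "(\<lambda>t. indicator {..y} t * q t - indicator {..x} t * q t) \<in> borel_measurable lborel"
        "(\<lambda>t. indicator {x..y} t * q t) \<in> borel_measurable lborel" by measurable
      show "AE t in lborel. indicator {..y} t * q t - indicator {..x} t * q t = indicator {x..y} t * q t"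
        using AE_lborel_singleton[of x] by eventually_elim (use that in \<open>auto simp: indicator_def\<close>)
    qed
    also have "\<dots> = G y - G x" using monotone_densityD(4)[OF G that] by simp
    finally show ?thesis .
  qed
  have "G x = (G 0 - (LINT t|lborel. indicator {..0} t * q t)) + (LINT t|lborel. indicator {..x} t * q t)" for x
    using split[of 0 x] split[of x 0] by (cases "0 \<le> x") auto
  then show ?thesis by (rule that)
qed


section \<open>From the commutator to its kernel\<close>

lemma integral_swap_bounded_kernel_pair:
  fixes A :: "real \<Rightarrow> complex" and B :: "real \<times> real \<Rightarrow> complex"
  assumes "integrable lborel A" "integrable (lborel \<Otimes>\<^sub>M lborel) B"
    and "case_prod k \<in> borel_measurable (lborel \<Otimes>\<^sub>M (lborel \<Otimes>\<^sub>M lborel))"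
    and "\<And>s z. cmod (k s z) \<le> C"
  shows "(LINT s|lborel. A s * (LINT z|(lborel \<Otimes>\<^sub>M lborel). k s z * B z))
       = (LINT z|(lborel \<Otimes>\<^sub>M lborel). B z * (LINT s|lborel. k s z * A s))"
  using integral_swap_bounded_kernel[of A B k C] assms unfolding lborel_prod by blast

text \<open>Write \<open>U\<close> and \<open>V\<close> for the position functions of \<open>u\<close> and \<open>F u\<close>, and \<open>h\<close> for twice the imaginary part
  of \<open>cnj U * V\<close>, times \<open>\<i>\<close>.  The left side is the integral of \<open>G h\<close>, up to a constant factor.  Since
  the integral of \<open>h\<close> vanishes, integration by parts leaves the integral of \<open>q t\<close> times the tail
  integral of \<open>h\<close> over \<open>{t<..}\<close>.  As \<open>h\<close> is a double Fourier integral, damping the tail by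
  \<open>exp (- e (x - t))\<close> produces the factor \<open>1 / (e - \<i> (\<xi> - \<eta>))\<close>.  It multiplies \<open>F \<xi> - F \<eta>\<close>, so the
  limit \<open>e \<longrightarrow> 0\<close> exists by domination and is a divided difference.\<close>

lemma kato_integral_eq_dd_form:
  assumes F: "monotone_density F p" and Fb: "bounded (range F)" and G: "monotone_density G q" and Gb: "bounded (range G)"
    and u: "test_function u"
  shows "complex_of_real (4 * pi * Im (l2_inner (\<lambda>x. complex_of_real (G x) * inverse_integral u x)
            (inverse_integral (\<lambda>\<xi>. complex_of_real (F \<xi>) * u \<xi>)))) = dd_form F q u"
proof -
  let ?P = "lborel \<Otimes>\<^sub>M (lborel :: real measure) :: (real \<times> real) measure"
  let ?c = "complex_of_real (sqrt (2 * pi))"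
  let ?Fu = "\<lambda>\<xi>. complex_of_real (F \<xi>) * u \<xi>"
  define U where "U = inverse_integral u"
  define V where "V = inverse_integral ?Fu"
  define h where "h x = cnj (U x) * V x - U x * cnj (V x)" for x
  define Z where "Z = l2_inner (\<lambda>x. complex_of_real (G x) * U x) V"
  define J where "J z = cnj (u (snd z)) * u (fst z) * complex_of_real (F (fst z) - F (snd z))" for z
  define D where "D z = cnj (u (snd z)) * u (fst z) * complex_of_real (divided_difference F (fst z) (snd z))" for z
  have um [measurable]: "u \<in> borel_measurable borel" using u by (simp add: test_function_def)
  note [measurable] = monotone_density_measurable[OF F] monotone_density_measurable[OF G]
    monotone_densityD(1)[OF G] divided_difference_measurable[OF F]
  obtain C where C: "\<And>x. \<bar>F x\<bar> \<le> C" using Fb by (auto simp: bounded_iff)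
  obtain C' where C': "\<And>x. \<bar>G x\<bar> \<le> C'" using Gb by (auto simp: bounded_iff)
  have Fu: "test_function ?Fu" by (rule test_function_mult[OF u _ C]) measurable
  have uL: "u \<in> L1_L2" and FuL: "?Fu \<in> L1_L2" using test_function_L1_L2 u Fu by auto
  have UL: "U \<in> L2" and VL: "V \<in> L2" unfolding U_def V_def by (intro inverse_integral_L2 uL FuL)+
  have Um [measurable]: "U \<in> borel_measurable borel" and Vm [measurable]: "V \<in> borel_measurable borel"
    unfolding U_def V_def inverse_integral_def[abs_def] by measurable
  have UV: "integrable lborel (\<lambda>x. cnj (U x) * V x)"
    using L2_inner_integrable[OF UL VL] by (simp add: integrable_completion)
  have VU: "integrable lborel (\<lambda>x. U x * cnj (V x))"
    using L2_inner_integrable[OF VL UL] by (simp add: integrable_completion mult.commute)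
  have hint: "integrable lborel h" unfolding h_def by (intro Bochner_Integration.integrable_diff UV VU)
  have Gmult: "integrable lborel (\<lambda>x. complex_of_real (G x) * w x)" if "integrable lborel w" for w
    using integrable_mult_bounded[OF that, of "\<lambda>x. complex_of_real (G x)" C'] C' by simp

  have Gh: "(LINT x|lborel. complex_of_real (G x) * h x) = 2 * \<i> * complex_of_real (Im Z)"
  proof -
    have Z: "Z = (LINT x|lborel. complex_of_real (G x) * (cnj (U x) * V x))"
      unfolding Z_def by (subst l2_inner_lborel) (auto simp: mult.assoc)
    have "cnj Z = (LINT x|lborel. cnj (complex_of_real (G x) * (cnj (U x) * V x)))"
      unfolding Z by (rule Bochner_Integration.integral_cnj[symmetric])
    then have cZ: "cnj Z = (LINT x|lborel. complex_of_real (G x) * (U x * cnj (V x)))" by simp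
    have "(LINT x|lborel. complex_of_real (G x) * h x) = Z - cnj Z"
      unfolding cZ unfolding Z h_def right_diff_distrib
      by (rule Bochner_Integration.integral_diff) (intro Gmult UV VU)+
    then show ?thesis by (simp add: complex_eq_iff)
  qed

  have h0: "(LINT x|lborel. h x) = 0"
  proof -
    have "(LINT x|lborel. h x) = (LINT x|lborel. cnj (U x) * V x) - (LINT x|lborel. U x * cnj (V x))"
      unfolding h_def by (rule Bochner_Integration.integral_diff[OF UV VU])
    also have "\<dots> = l2_inner U V - l2_inner V U" by (simp add: l2_inner_lborel mult.commute)
    also have "\<dots> = l2_inner u ?Fu - l2_inner ?Fu u"
      unfolding U_def V_def by (simp add: l2_inner_inverse_integral uL FuL)
    also have "\<dots> = 0" by (simp add: l2_inner_def ac_simps)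
    finally show ?thesis .
  qed

  have Jint: "integrable ?P J"
    and hJ: "h x = (LINT z|?P. iexp (x * (fst z - snd z)) / complex_of_real (2 * pi) * J z)" for x
  proof -
    have Jint: "integrable ?P J"
    proof -
      have "integrable ?P (\<lambda>z. ?Fu (fst z) * cnj (u (snd z)) - u (fst z) * cnj (?Fu (snd z)))"
      proof (intro Bochner_Integration.integrable_diff integral_pair_product(1))
        show "integrable lborel u" "integrable lborel ?Fu" by (intro test_function_integrable u Fu)+
        then show "integrable lborel (\<lambda>\<xi>. cnj (u \<xi>))" "integrable lborel (\<lambda>\<xi>. cnj (?Fu \<xi>))"
          by (simp_all only: integrable_cnj)
      qed
      then show ?thesis by (simp add: J_def[abs_def] algebra_simps)
    qed
    then show "integrable ?P J" .
    let ?a = "\<lambda>\<xi>. (iexp (x * \<xi>) / ?c) * u \<xi>" and ?b = "\<lambda>\<xi>. (iexp (x * \<xi>) / ?c) * ?Fu \<xi>"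
    have ab: "integrable lborel ?a" "integrable lborel ?b"
      by (rule integrable_mult_bounded[OF test_function_integrable[OF u] _ fourier_kernel_bound], measurable)
         (rule integrable_mult_bounded[OF test_function_integrable[OF Fu] _ fourier_kernel_bound], measurable)
    have U: "U x = (LINT \<xi>|lborel. ?a \<xi>)" and V: "V x = (LINT \<xi>|lborel. ?b \<xi>)"
      unfolding U_def V_def by (rule inverse_integral_lborel, measurable)+
    have cU: "cnj (U x) = (LINT \<xi>|lborel. cnj (?a \<xi>))" and cV: "cnj (V x) = (LINT \<xi>|lborel. cnj (?b \<xi>))"
      unfolding U V by (rule Bochner_Integration.integral_cnj[symmetric])+
    have cab: "integrable lborel (\<lambda>\<xi>. cnj (?a \<xi>))" "integrable lborel (\<lambda>\<xi>. cnj (?b \<xi>))"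
      using ab by (simp_all only: integrable_cnj)
    have "h x = (LINT z|?P. ?b (fst z) * cnj (?a (snd z))) - (LINT z|?P. ?a (fst z) * cnj (?b (snd z)))"
    proof -
      have "V x * cnj (U x) = (LINT z|?P. ?b (fst z) * cnj (?a (snd z)))"
        unfolding V cU by (rule integral_pair_product(2)[symmetric, OF ab(2) cab(1)])
      moreover have "U x * cnj (V x) = (LINT z|?P. ?a (fst z) * cnj (?b (snd z)))"
        unfolding U cV by (rule integral_pair_product(2)[symmetric, OF ab(1) cab(2)])
      ultimately show ?thesis by (simp only: h_def mult.commute[of "cnj (U x)"])
    qed
    also have "\<dots> = (LINT z|?P. ?b (fst z) * cnj (?a (snd z)) - ?a (fst z) * cnj (?b (snd z)))"
      by (rule Bochner_Integration.integral_diff[symmetric]) (rule integral_pair_product, (rule ab cab)+)+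
    also have "\<dots> = (LINT z|?P. iexp (x * (fst z - snd z)) / complex_of_real (2 * pi) * J z)"
    proof (rule Bochner_Integration.integral_cong[OF refl])
      fix z :: "real \<times> real"
      have cc: "?c * ?c = complex_of_real (2 * pi)" by (simp flip: of_real_mult)
      have e: "iexp (x * (fst z - snd z)) = iexp (x * fst z) * cnj (iexp (x * snd z))"
        by (simp add: exp_cnj mult_exp_exp algebra_simps)
      show "?b (fst z) * cnj (?a (snd z)) - ?a (fst z) * cnj (?b (snd z))
          = iexp (x * (fst z - snd z)) / complex_of_real (2 * pi) * J z"
        unfolding e cc[symmetric] J_def by (simp add: field_simps)
    qed
    finally show "h x = (LINT z|?P. iexp (x * (fst z - snd z)) / complex_of_real (2 * pi) * J z)" .
  qed

  have JD: "J z = D z * complex_of_real (fst z - snd z)" for z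
    by (cases "fst z = snd z") (simp_all add: J_def D_def divided_difference_def)
  have Dint: "integrable ?P D"
    using divided_difference_form_integrable[OF F u] by (simp add: D_def[abs_def])

  have damped: "(LINT x|lborel. complex_of_real (indicator {t<..} x * exp (- (e * (x - t)))) * h x)
      = (LINT z|?P. J z * (iexp (t * (fst z - snd z)) / (complex_of_real (2 * pi) * (complex_of_real e - \<i> * complex_of_real (fst z - snd z)))))"
    if e: "e > 0" for e t
  proof -
    let ?E = "\<lambda>x. complex_of_real (indicator {t<..} x * exp (- (e * (x - t))))"
    have E: "integrable lborel ?E" by (rule integrable_of_real[OF damping_integrable[OF e]])
    have pi1: "1 \<le> 2 * pi" using pi_gt3 by simp
    have "(LINT x|lborel. ?E x * h x) = (LINT x|lborel. ?E x * (LINT z|?P. iexp (x * (fst z - snd z)) / complex_of_real (2 * pi) * J z))"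
      by (simp only: hJ)
    also have "\<dots> = (LINT z|?P. J z * (LINT x|lborel. iexp (x * (fst z - snd z)) / complex_of_real (2 * pi) * ?E x))"
      by (rule integral_swap_bounded_kernel_pair[OF E Jint, where C = 1]) (measurable, use pi1 in \<open>simp add: norm_divide\<close>)
    also have "\<dots> = (LINT z|?P. J z * (iexp (t * (fst z - snd z)) / (complex_of_real (2 * pi) * (complex_of_real e - \<i> * complex_of_real (fst z - snd z)))))"
    proof (rule Bochner_Integration.integral_cong[OF refl])
      fix z :: "real \<times> real"
      have "(LINT x|lborel. iexp (x * (fst z - snd z)) / complex_of_real (2 * pi) * ?E x)
          = (LINT x|lborel. iexp (x * (fst z - snd z)) * ?E x / complex_of_real (2 * pi))"
        by (simp only: times_divide_eq_left)
      also have "\<dots> = (LINT x|lborel. iexp (x * (fst z - snd z)) * ?E x) / complex_of_real (2 * pi)"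
        by (rule integral_divide_zero)
      also have "\<dots> = iexp (t * (fst z - snd z)) / (complex_of_real (2 * pi) * (complex_of_real e - \<i> * complex_of_real (fst z - snd z)))"
        unfolding fourier_damping[OF e] by (simp add: field_simps)
      finally show "J z * (LINT x|lborel. iexp (x * (fst z - snd z)) / complex_of_real (2 * pi) * ?E x)
         = J z * (iexp (t * (fst z - snd z)) / (complex_of_real (2 * pi) * (complex_of_real e - \<i> * complex_of_real (fst z - snd z))))"
        by simp
    qed
    finally show ?thesis .
  qed

  have tail: "(LINT x|lborel. complex_of_real (indicator {t<..} x) * h x)
      = \<i> / complex_of_real (2 * pi) * (LINT z|?P. iexp (t * (fst z - snd z)) * D z)" for t
  proof (rule LIMSEQ_unique)
    let ?e = "\<lambda>n. inverse (real (Suc n))"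
    show "(\<lambda>n. LINT x|lborel. complex_of_real (indicator {t<..} x * exp (- (?e n * (x - t)))) * h x)
       \<longlonglongrightarrow> (LINT x|lborel. complex_of_real (indicator {t<..} x) * h x)"
    proof (rule integral_dominated_convergence)
      show "integrable lborel (\<lambda>x. cmod (h x))" using hint by simp
      note [measurable] = borel_measurable_integrable[OF hint]
      show "(\<lambda>x. complex_of_real (indicator {t<..} x) * h x) \<in> borel_measurable lborel" by measurable
      show "(\<lambda>x. complex_of_real (indicator {t<..} x * exp (- (?e n * (x - t)))) * h x) \<in> borel_measurable lborel" for n by measurable
      show "AE x in lborel. (\<lambda>n. complex_of_real (indicator {t<..} x * exp (- (?e n * (x - t)))) * h x) \<longlonglongrightarrow> complex_of_real (indicator {t<..} x) * h x"
      proof (rule AE_I2)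
        fix x
        have "(\<lambda>n. complex_of_real (indicator {t<..} x * exp (- (?e n * (x - t)))) * h x)
            \<longlonglongrightarrow> complex_of_real (indicator {t<..} x * exp (- (0 * (x - t)))) * h x"
          by (intro tendsto_intros LIMSEQ_inverse_real_of_nat)
        then show "(\<lambda>n. complex_of_real (indicator {t<..} x * exp (- (?e n * (x - t)))) * h x) \<longlonglongrightarrow> complex_of_real (indicator {t<..} x) * h x"
          by simp
      qed
      show "AE x in lborel. norm (complex_of_real (indicator {t<..} x * exp (- (?e n * (x - t)))) * h x) \<le> cmod (h x)" for n
        by (rule AE_I2) (auto simp: norm_mult indicator_def intro!: mult_left_le_one_le)
    qed
    have "(\<lambda>n. LINT z|?P. J z * (iexp (t * (fst z - snd z)) / (complex_of_real (2 * pi) * (complex_of_real (?e n) - \<i> * complex_of_real (fst z - snd z)))))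
       \<longlonglongrightarrow> (LINT z|?P. \<i> / complex_of_real (2 * pi) * (iexp (t * (fst z - snd z)) * D z))"
    proof (rule integral_dominated_convergence)
      show "integrable ?P (\<lambda>z. cmod (D z))" using Dint by simp
      note [measurable] = borel_measurable_integrable[OF Jint] borel_measurable_integrable[OF Dint]
      show "(\<lambda>z. \<i> / complex_of_real (2 * pi) * (iexp (t * (fst z - snd z)) * D z)) \<in> borel_measurable ?P" by measurable
      show "(\<lambda>z. J z * (iexp (t * (fst z - snd z)) / (complex_of_real (2 * pi) * (complex_of_real (?e n) - \<i> * complex_of_real (fst z - snd z))))) \<in> borel_measurable ?P" for n
        by measurable
      show "AE z in ?P. (\<lambda>n. J z * (iexp (t * (fst z - snd z)) / (complex_of_real (2 * pi) * (complex_of_real (?e n) - \<i> * complex_of_real (fst z - snd z)))))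
         \<longlonglongrightarrow> \<i> / complex_of_real (2 * pi) * (iexp (t * (fst z - snd z)) * D z)"
      proof (rule AE_I2)
        fix z :: "real \<times> real"
        show "(\<lambda>n. J z * (iexp (t * (fst z - snd z)) / (complex_of_real (2 * pi) * (complex_of_real (?e n) - \<i> * complex_of_real (fst z - snd z)))))
         \<longlonglongrightarrow> \<i> / complex_of_real (2 * pi) * (iexp (t * (fst z - snd z)) * D z)"
        proof (cases "fst z = snd z")
          case True
          then show ?thesis by (simp add: J_def D_def divided_difference_def)
        next
          case False
          define \<omega> where "\<omega> = fst z - snd z"
          have w: "\<omega> \<noteq> 0" using False by (simp add: \<omega>_def)
          have "(\<lambda>n. J z * (iexp (t * \<omega>) / (complex_of_real (2 * pi) * (complex_of_real (?e n) - \<i> * complex_of_real \<omega>))))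
            \<longlonglongrightarrow> J z * (iexp (t * \<omega>) / (complex_of_real (2 * pi) * (complex_of_real 0 - \<i> * complex_of_real \<omega>)))"
            by (intro tendsto_intros LIMSEQ_inverse_real_of_nat) (use w in simp)
          moreover have "J z * (iexp (t * \<omega>) / (complex_of_real (2 * pi) * (complex_of_real 0 - \<i> * complex_of_real \<omega>)))
              = \<i> / complex_of_real (2 * pi) * (iexp (t * \<omega>) * D z)"
            using w unfolding JD \<omega>_def[symmetric] by (simp add: field_simps)
          ultimately show ?thesis by (simp only: \<omega>_def)
        qed
      qed
      show "AE z in ?P. norm (J z * (iexp (t * (fst z - snd z)) / (complex_of_real (2 * pi) * (complex_of_real (?e n) - \<i> * complex_of_real (fst z - snd z))))) \<le> cmod (D z)" for n
      proof (rule AE_I2)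
        fix z :: "real \<times> real"
        define \<omega> where "\<omega> = fst z - snd z"
        define d where "d = cmod (complex_of_real (?e n) - \<i> * complex_of_real \<omega>)"
        have d: "\<bar>\<omega>\<bar> \<le> d" "d > 0"
        proof -
          show "\<bar>\<omega>\<bar> \<le> d" using abs_Im_le_cmod[of "complex_of_real (?e n) - \<i> * complex_of_real \<omega>"] by (simp add: d_def)
          show "d > 0" unfolding d_def by (simp add: complex_eq_iff)
        qed
        have J: "cmod (J z) = cmod (D z) * \<bar>\<omega>\<bar>"
          unfolding JD \<omega>_def norm_mult by (simp only: norm_of_real)
        have "norm (J z * (iexp (t * \<omega>) / (complex_of_real (2 * pi) * (complex_of_real (?e n) - \<i> * complex_of_real \<omega>))))
            = cmod (D z) * (\<bar>\<omega>\<bar> / (2 * pi * d))"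
          using J by (simp add: norm_mult norm_divide d_def)
        also have "\<dots> \<le> cmod (D z) * 1"
        proof (rule mult_left_mono)
          have "\<bar>\<omega>\<bar> \<le> 1 * d" using d by simp
          also have "\<dots> \<le> 2 * pi * d" using pi_gt3 d by (intro mult_right_mono) auto
          finally show "\<bar>\<omega>\<bar> / (2 * pi * d) \<le> 1" using d by simp
        qed simp
        finally show "norm (J z * (iexp (t * (fst z - snd z)) / (complex_of_real (2 * pi) * (complex_of_real (?e n) - \<i> * complex_of_real (fst z - snd z))))) \<le> cmod (D z)"
          by (simp add: \<omega>_def)
      qed
    qed
    then show "(\<lambda>n. LINT x|lborel. complex_of_real (indicator {t<..} x * exp (- (?e n * (x - t)))) * h x)
       \<longlonglongrightarrow> \<i> / complex_of_real (2 * pi) * (LINT z|?P. iexp (t * (fst z - snd z)) * D z)"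
      unfolding integral_mult_right_zero by (subst damped) auto
  qed

  obtain c where c: "\<And>x. G x = c + (LINT t|lborel. indicator {..x} t * q t)"
    using monotone_density_cumulative[OF G] by blast
  have qint: "integrable lborel (\<lambda>t. complex_of_real (q t))"
    by (rule integrable_of_real[OF monotone_densityD(3)[OF G]])
  have "(LINT x|lborel. complex_of_real (G x) * h x)
      = (LINT x|lborel. complex_of_real c * h x + h x * (LINT t|lborel. complex_of_real (indicator {..x} t) * complex_of_real (q t)))"
  proof (rule Bochner_Integration.integral_cong[OF refl])
    fix x
    have "complex_of_real (LINT t|lborel. indicator {..x} t * q t) = (LINT t|lborel. complex_of_real (indicator {..x} t) * complex_of_real (q t))"
      unfolding of_real_mult[symmetric] by (rule integral_complex_of_real[symmetric])
    then show "complex_of_real (G x) * h x = complex_of_real c * h x + h x * (LINT t|lborel. complex_of_real (indicator {..x} t) * complex_of_real (q t))"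
      by (subst c) (simp add: algebra_simps)
  qed
  also have "\<dots> = (LINT x|lborel. complex_of_real c * h x) + (LINT x|lborel. h x * (LINT t|lborel. complex_of_real (indicator {..x} t) * complex_of_real (q t)))"
  proof (rule Bochner_Integration.integral_add)
    show "integrable lborel (\<lambda>x. complex_of_real c * h x)" using hint by simp
    have "integrable (lborel \<Otimes>\<^sub>M lborel) (\<lambda>(x, t). h x * (complex_of_real (indicator {..x} t) * complex_of_real (q t)))"
      by (rule integrable_bounded_kernel[OF hint qint, where C = 1]) (measurable, auto simp: indicator_def)
    from lborel_pair.integrable_fst'[OF this] show "integrable lborel (\<lambda>x. h x * (LINT t|lborel. complex_of_real (indicator {..x} t) * complex_of_real (q t)))"
      by simp
  qed
  also have "(LINT x|lborel. complex_of_real c * h x) = 0" using h0 by simp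
  also have "(LINT x|lborel. h x * (LINT t|lborel. complex_of_real (indicator {..x} t) * complex_of_real (q t)))
      = (LINT t|lborel. complex_of_real (q t) * (LINT x|lborel. complex_of_real (indicator {..x} t) * h x))"
    by (rule integral_swap_bounded_kernel[OF hint qint, where C = 1]) (measurable, auto simp: indicator_def)
  also have "\<dots> = (LINT t|lborel. complex_of_real (q t) * (LINT x|lborel. complex_of_real (indicator {t<..} x) * h x))"
  proof (rule Bochner_Integration.integral_cong[OF refl], rule arg_cong2[where f = "(*)", OF refl])
    fix t
    show "(LINT x|lborel. complex_of_real (indicator {..x} t) * h x) = (LINT x|lborel. complex_of_real (indicator {t<..} x) * h x)"
    proof (rule integral_cong_AE)
      note [measurable] = borel_measurable_integrable[OF hint]
      have "(\<lambda>x. complex_of_real (indicator {..x} t) * h x) = (\<lambda>x. complex_of_real (indicator {t..} x) * h x)"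
        by (auto simp: indicator_def)
      then show "(\<lambda>x. complex_of_real (indicator {..x} t) * h x) \<in> borel_measurable lborel"
        by simp measurable
      show "(\<lambda>x. complex_of_real (indicator {t<..} x) * h x) \<in> borel_measurable lborel" by measurable
      show "AE x in lborel. complex_of_real (indicator {..x} t) * h x = complex_of_real (indicator {t<..} x) * h x"
        using AE_lborel_singleton[of t] by eventually_elim (auto simp: indicator_def)
    qed
  qed
  also have "\<dots> = (LINT t|lborel. \<i> / complex_of_real (2 * pi) * (complex_of_real (q t) * (LINT z|?P. iexp (t * (fst z - snd z)) * D z)))"
    unfolding tail by (simp add: ac_simps)
  also have "\<dots> = \<i> / complex_of_real (2 * pi) * (LINT t|lborel. complex_of_real (q t) * (LINT z|?P. iexp (t * (fst z - snd z)) * D z))"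
    by (rule integral_mult_right_zero)
  also have "(LINT t|lborel. complex_of_real (q t) * (LINT z|?P. iexp (t * (fst z - snd z)) * D z))
      = (LINT z|?P. D z * (LINT t|lborel. iexp (t * (fst z - snd z)) * complex_of_real (q t)))"
  proof (rule integral_swap_bounded_kernel_pair[OF qint Dint, where C = 1])
    have "(\<lambda>w :: real \<times> real \<times> real. complex_of_real (fst w * (fst (snd w) - snd (snd w)))) \<in> borel_measurable (lborel \<Otimes>\<^sub>M (lborel \<Otimes>\<^sub>M lborel))"
      by measurable
    then have "(\<lambda>w :: real \<times> real \<times> real. iexp (fst w * (fst (snd w) - snd (snd w)))) \<in> borel_measurable (lborel \<Otimes>\<^sub>M (lborel \<Otimes>\<^sub>M lborel))"
      by measurable
    then show "(\<lambda>(t, z). iexp (t * (fst z - snd z))) \<in> borel_measurable (lborel \<Otimes>\<^sub>M (lborel \<Otimes>\<^sub>M lborel))"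
      by (simp add: case_prod_unfold)
  qed (simp only: norm_exp_i_times order_refl)
  also have "\<dots> = dd_form F q u"
    unfolding dd_form_def D_def density_transform_def
    by (intro Bochner_Integration.integral_cong refl) (simp add: algebra_simps)
  finally have "2 * \<i> * complex_of_real (Im Z) = \<i> / complex_of_real (2 * pi) * dd_form F q u"
    unfolding Gh by simp
  then have "complex_of_real (4 * pi * Im Z) = dd_form F q u" by (simp add: field_simps)
  then show ?thesis by (simp add: Z_def U_def V_def)
qed


section \<open>The determinant inequality\<close>

text \<open>Positive semidefiniteness of the kernel of the commutator, where \<open>q\<close> is the derivative of the
  other function.\<close>

definition dd_positive :: "(real \<Rightarrow> real) \<Rightarrow> (real \<Rightarrow> real) \<Rightarrow> bool" where
  "dd_positive F q \<longleftrightarrow> (\<forall>u. test_function u \<longrightarrow> 0 \<le> Re (dd_form F q u))"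

lemma dd_positive_if_kato_positive:
  assumes "kato_positive F G" "monotone_density F p" "bounded (range F)" "monotone_density G q" "bounded (range G)"
  shows "dd_positive F q"
  unfolding dd_positive_def
proof (intro allI impI)
  fix u assume u: "test_function u"
  let ?I = "Im (l2_inner (\<lambda>x. complex_of_real (G x) * inverse_integral u x) (inverse_integral (\<lambda>\<xi>. complex_of_real (F \<xi>) * u \<xi>)))"
  have "0 \<le> ?I" using assms(1) test_function_L1_L2[OF u] by (auto simp: kato_positive_def)
  then have "0 \<le> 4 * pi * ?I" by simp
  moreover have "Re (dd_form F q u) = 4 * pi * ?I"
    by (subst kato_integral_eq_dd_form[OF assms(2-5) u, symmetric]) simp
  ultimately show "0 \<le> Re (dd_form F q u)" by simp
qed

lemma cnj_transform: "cnj (density_transform q s) = density_transform q (- s)"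
  unfolding density_transform_def by (subst Bochner_Integration.integral_cnj[symmetric]) (simp add: exp_cnj)

lemma density_transform_continuous:
  assumes q: "integrable lborel q"
  shows "isCont (density_transform q) s"
  unfolding continuous_at_sequentially comp_def
proof (intro allI impI)
  fix X :: "nat \<Rightarrow> real" assume X: "X \<longlonglongrightarrow> s"
  note [measurable] = borel_measurable_integrable[OF q]
  show "(\<lambda>n. density_transform q (X n)) \<longlonglongrightarrow> density_transform q s"
    unfolding density_transform_def
  proof (rule integral_dominated_convergence)
    show "integrable lborel (\<lambda>t. \<bar>q t\<bar>)" using q by simp
    show "AE t in lborel. (\<lambda>n. iexp (- (X n * t)) * complex_of_real (q t)) \<longlonglongrightarrow> iexp (- (s * t)) * complex_of_real (q t)"
      using X by (auto intro!: tendsto_intros)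
    show "AE t in lborel. norm (iexp (- (X n * t)) * complex_of_real (q t)) \<le> \<bar>q t\<bar>" for n
      by (simp add: norm_mult)
  qed measurable
qed

context
  fixes F q p :: "real \<Rightarrow> real"
  assumes F: "monotone_density F p" and q: "integrable lborel q" "\<And>t. 0 \<le> q t"
    and pos: "dd_positive F q"
begin

definition dd_kernel :: "real \<times> real \<Rightarrow> complex" where
  "dd_kernel z = complex_of_real (divided_difference F (fst z) (snd z)) * density_transform q (snd z - fst z)"

definition dd_block :: "real set \<Rightarrow> real set \<Rightarrow> complex" where
  "dd_block I J = (LINT z|(lborel \<Otimes>\<^sub>M lborel). indicator (I \<times> J) z * dd_kernel z)"

lemma dd_kernel_measurable [measurable]: "dd_kernel \<in> borel_measurable (lborel \<Otimes>\<^sub>M lborel)"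
proof -
  have [measurable]: "q \<in> borel_measurable borel" using borel_measurable_integrable[OF q(1)] by simp
  note [measurable] = divided_difference_measurable[OF F]
  show ?thesis unfolding dd_kernel_def by measurable
qed

lemma dd_kernel_bound: "cmod (dd_kernel z) \<le> (LINT t|lborel. q t) * divided_difference F (fst z) (snd z)"
  using mult_right_mono[OF density_transform_bound[OF q, of "snd z - fst z"] divided_difference_nonneg[OF monotone_density_mono[OF F], of "fst z" "snd z"]]
    divided_difference_nonneg[OF monotone_density_mono[OF F], of "fst z" "snd z"]
  by (simp add: dd_kernel_def norm_mult mult.commute)

lemma dd_block_integrable:
  assumes I [measurable]: "I \<in> sets borel" and J [measurable]: "J \<in> sets borel" and R: "I \<union> J \<subseteq> {-R..R}"
  shows "integrable (lborel \<Otimes>\<^sub>M lborel) (\<lambda>z. indicator (I \<times> J) z * dd_kernel z)"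
proof (rule Bochner_Integration.integrable_bound)
  let ?u = "\<lambda>x. indicator {-R..R} x :: complex"
  have u: "test_function ?u"
    unfolding test_function_def by (intro conjI exI[of _ R] exI[of _ 1]) (auto simp: indicator_def)
  from divided_difference_form_integrable[OF F u]
  show "integrable (lborel \<Otimes>\<^sub>M lborel) (\<lambda>z. (LINT t|lborel. q t) *
      cmod (cnj (?u (snd z)) * ?u (fst z) * complex_of_real (divided_difference F (fst z) (snd z))))"
    by (intro integrable_mult_right integrable_norm)
  have [measurable]: "I \<times> J \<in> sets (lborel \<Otimes>\<^sub>M lborel)" by auto
  show "(\<lambda>z. indicator (I \<times> J) z * dd_kernel z) \<in> borel_measurable (lborel \<Otimes>\<^sub>M lborel)" by measurable
  show "AE z in lborel \<Otimes>\<^sub>M lborel. norm (indicator (I \<times> J) z * dd_kernel z) \<le> norm ((LINT t|lborel. q t) *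
      cmod (cnj (?u (snd z)) * ?u (fst z) * complex_of_real (divided_difference F (fst z) (snd z))))"
  proof (rule AE_I2)
    fix z :: "real \<times> real"
    show "norm (indicator (I \<times> J) z * dd_kernel z) \<le> norm ((LINT t|lborel. q t) *
      cmod (cnj (?u (snd z)) * ?u (fst z) * complex_of_real (divided_difference F (fst z) (snd z))))"
    proof (cases "z \<in> I \<times> J")
      case True
      then have "fst z \<in> {-R..R}" "snd z \<in> {-R..R}" using R by auto
      moreover have "0 \<le> (LINT t|lborel. q t)" using q(2) by (intro integral_nonneg_AE) auto
      moreover note dd_kernel_bound[of z] divided_difference_nonneg[OF monotone_density_mono[OF F], of "fst z" "snd z"]
      ultimately show ?thesis using True by (simp add: norm_mult)
    qed simp
  qed
qed

lemma dd_block_diagonal: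
  assumes "a \<le> b"
  shows "cmod (dd_block {a..b} {a..b}) \<le> 2 * (LINT t|lborel. q t) * (b - a) * (F b - F a)"
proof -
  let ?g = "LINT t|lborel. q t"
  have g0: "0 \<le> ?g" using q(2) by (intro integral_nonneg_AE) auto
  have [measurable]: "{a..b} \<times> {a..b} \<in> sets (lborel \<Otimes>\<^sub>M lborel)" by auto
  note [measurable] = divided_difference_measurable[OF F]
  have "ennreal (cmod (dd_block {a..b} {a..b})) \<le> (\<integral>\<^sup>+z. ennreal (norm (indicator ({a..b} \<times> {a..b}) z * dd_kernel z)) \<partial>(lborel \<Otimes>\<^sub>M lborel))"
    unfolding dd_block_def by (rule norm_integral_le_nn_integral)
  also have "\<dots> \<le> (\<integral>\<^sup>+z. ennreal ?g * (indicator ({a..b} \<times> {a..b}) z * ennreal (divided_difference F (fst z) (snd z))) \<partial>(lborel \<Otimes>\<^sub>M lborel))"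
  proof (rule nn_integral_mono)
    fix z :: "real \<times> real"
    have "ennreal (cmod (dd_kernel z)) \<le> ennreal ?g * ennreal (divided_difference F (fst z) (snd z))"
      using dd_kernel_bound[of z] g0 divided_difference_nonneg[OF monotone_density_mono[OF F], of "fst z" "snd z"]
      by (simp add: ennreal_mult[symmetric] ennreal_leI)
    then show "ennreal (norm (indicator ({a..b} \<times> {a..b}) z * dd_kernel z)) \<le> ennreal ?g * (indicator ({a..b} \<times> {a..b}) z * ennreal (divided_difference F (fst z) (snd z)))"
      by (auto simp: indicator_def norm_mult)
  qed
  also have "\<dots> = ennreal ?g * (\<integral>\<^sup>+z. indicator ({a..b} \<times> {a..b}) z * ennreal (divided_difference F (fst z) (snd z)) \<partial>(lborel \<Otimes>\<^sub>M lborel))"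
    by (rule nn_integral_cmult) measurable
  also have "\<dots> \<le> ennreal ?g * ennreal (2 * (b - a) * (F b - F a))"
    by (intro mult_left_mono divided_difference_box[OF F assms]) simp
  also have "\<dots> = ennreal (2 * ?g * (b - a) * (F b - F a))"
    using g0 assms monoD[OF monotone_density_mono[OF F] assms]
    by (simp add: ennreal_mult[symmetric] ac_simps)
  finally show ?thesis
    using g0 assms monoD[OF monotone_density_mono[OF F] assms] by (subst (asm) ennreal_le_iff) auto
qed

lemma dd_block_swap:
  assumes [measurable]: "I \<in> sets borel" "J \<in> sets borel"
  shows "dd_block J I = cnj (dd_block I J)"
proof -
  have [measurable]: "J \<times> I \<in> sets (lborel \<Otimes>\<^sub>M lborel)" by auto
  have k: "cnj (dd_kernel (x, y)) = dd_kernel (y, x)" for x y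
    by (simp add: dd_kernel_def cnj_transform divided_difference_commute[of F x y])
  have "cnj (dd_block I J) = (LINT z|(lborel \<Otimes>\<^sub>M lborel). cnj (indicator (I \<times> J) z * dd_kernel z))"
    unfolding dd_block_def by (rule Bochner_Integration.integral_cnj[symmetric])
  also have "\<dots> = (LINT z|(lborel \<Otimes>\<^sub>M lborel). (case z of (x, y) \<Rightarrow> indicator (J \<times> I) (y, x) * dd_kernel (y, x)))"
    by (intro Bochner_Integration.integral_cong refl) (auto simp: k indicator_def)
  also have "\<dots> = dd_block J I"
    unfolding dd_block_def by (rule lborel_pair.integral_product_swap) measurable
  finally show ?thesis by simp
qed

text \<open>The form at \<open>u = c 1_I + d 1_J\<close>; the two mixed blocks are conjugate to each other.\<close>

lemma dd_form_two_blocks: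
  assumes I [measurable]: "I \<in> sets borel" and J [measurable]: "J \<in> sets borel" and R: "I \<union> J \<subseteq> {-R..R}"
  shows "0 \<le> (cmod c)\<^sup>2 * Re (dd_block I I) + (cmod d)\<^sup>2 * Re (dd_block J J) + 2 * Re (cnj d * c * dd_block I J)"
proof -
  define u where "u x = c * indicator I x + d * indicator J x" for x :: real
  have [measurable]: "u \<in> borel_measurable borel" unfolding u_def by measurable
  have "cmod (u x) \<le> cmod c + cmod d" for x
    unfolding u_def by (rule order_trans[OF norm_triangle_ineq]) (auto simp: indicator_def)
  moreover have "u x = 0" if "\<bar>x\<bar> > \<bar>R\<bar>" for x
  proof -
    have "x \<notin> {-R..R}" using that by auto
    then have "x \<notin> I" "x \<notin> J" using R by auto
    then show ?thesis by (simp add: u_def)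
  qed
  ultimately have u: "test_function u" unfolding test_function_def by (intro conjI exI allI impI) auto
  let ?b = "\<lambda>I J z. indicator (I \<times> J) z * dd_kernel z"
  have i: "integrable (lborel \<Otimes>\<^sub>M lborel) (?b I I)" "integrable (lborel \<Otimes>\<^sub>M lborel) (?b I J)"
    "integrable (lborel \<Otimes>\<^sub>M lborel) (?b J I)" "integrable (lborel \<Otimes>\<^sub>M lborel) (?b J J)"
    by (rule dd_block_integrable[where R = R], use R in auto)+
  have "dd_form F q u = (LINT z|(lborel \<Otimes>\<^sub>M lborel). (cnj c * c) * ?b I I z + (cnj d * c) * ?b I J z + (cnj c * d) * ?b J I z + (cnj d * d) * ?b J J z)"
    unfolding dd_form_def dd_kernel_def[symmetric]
    by (intro Bochner_Integration.integral_cong refl) (auto simp: u_def indicator_def algebra_simps)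
  also have "\<dots> = (cnj c * c) * dd_block I I + (cnj d * c) * dd_block I J + (cnj c * d) * dd_block J I + (cnj d * d) * dd_block J J"
    unfolding dd_block_def by (simp add: i)
  also have "dd_block J I = cnj (dd_block I J)" by (rule dd_block_swap) measurable
  finally have "Re (dd_form F q u) = Re ((cnj c * c) * dd_block I I) + Re ((cnj d * d) * dd_block J J)
      + (Re (cnj d * c * dd_block I J) + Re (cnj (cnj d * c * dd_block I J)))"
    by (simp add: algebra_simps)
  moreover have "Re ((cnj e * e) * X) = (cmod e)\<^sup>2 * Re X" for e X
  proof -
    have "cnj e * e = complex_of_real ((cmod e)\<^sup>2)" by (metis complex_norm_square mult.commute of_real_power)
    then show ?thesis by (simp only:) simp
  qed
  moreover have "Re (cnj Y) = Re Y" for Y by simp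
  ultimately have eq: "Re (dd_form F q u) = (cmod c)\<^sup>2 * Re (dd_block I I) + (cmod d)\<^sup>2 * Re (dd_block J J) + 2 * Re (cnj d * c * dd_block I J)"
    by (simp only: mult_2)
  have "0 \<le> Re (dd_form F q u)" using pos u by (simp add: dd_positive_def)
  then show ?thesis by (simp only: eq)
qed

text \<open>Test functions with two values give a nonnegative quadratic form in two variables.  Choosing the
  phase that makes the mixed term negative gives the determinant inequality.\<close>

lemma dd_block_Cauchy_Schwarz:
  assumes IJ: "I \<in> sets borel" "J \<in> sets borel" "I \<union> J \<subseteq> {-R..R}"
    and \<alpha>: "cmod (dd_block I I) \<le> \<alpha>" and \<beta>: "cmod (dd_block J J) \<le> \<beta>"
  shows "(cmod (dd_block I J))\<^sup>2 \<le> \<alpha> * \<beta>"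
proof -
  define A where "A = dd_block I J"
  have \<alpha>0: "0 \<le> \<alpha>" "0 \<le> \<beta>" using \<alpha> \<beta> norm_ge_zero order_trans by blast+
  \<comment> \<open>The phase of the second value is opposite to that of \<open>A\<close>.\<close>
  have *: "2 * \<tau> * \<sigma> * cmod A \<le> \<tau>\<^sup>2 * \<alpha> + \<sigma>\<^sup>2 * \<beta>" if "A \<noteq> 0" for \<tau> \<sigma> :: real
  proof -
    let ?d = "- complex_of_real \<sigma> * (A / complex_of_real (cmod A))"
    have "cnj A * A = (complex_of_real (cmod A))\<^sup>2" by (metis complex_norm_square mult.commute of_real_power)
    then have "cnj ?d * complex_of_real \<tau> * A = - complex_of_real (\<tau> * \<sigma> * cmod A)"
      using that by (simp add: field_simps power2_eq_square)
    then have e: "Re (cnj ?d * complex_of_real \<tau> * A) = - (\<tau> * \<sigma> * cmod A)" by simp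
    have n: "(cmod (complex_of_real \<tau>))\<^sup>2 = \<tau>\<^sup>2" "(cmod ?d)\<^sup>2 = \<sigma>\<^sup>2"
      using that by (simp_all add: norm_mult norm_divide power_mult_distrib)
    have "0 \<le> \<tau>\<^sup>2 * Re (dd_block I I) + \<sigma>\<^sup>2 * Re (dd_block J J) + 2 * Re (cnj ?d * complex_of_real \<tau> * dd_block I J)"
      using dd_form_two_blocks[OF IJ, of "complex_of_real \<tau>" ?d] unfolding n .
    moreover have "\<tau>\<^sup>2 * Re (dd_block I I) \<le> \<tau>\<^sup>2 * \<alpha>" "\<sigma>\<^sup>2 * Re (dd_block J J) \<le> \<sigma>\<^sup>2 * \<beta>"
      using \<alpha> \<beta> complex_Re_le_cmod[of "dd_block I I"] complex_Re_le_cmod[of "dd_block J J"]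
      by (auto intro!: mult_left_mono)
    moreover note e[unfolded A_def]
    ultimately show ?thesis unfolding A_def by linarith
  qed
  show ?thesis
  proof (cases "A = 0")
    case True then show ?thesis using \<alpha>0 by (simp add: A_def)
  next
    case False
    then have A: "0 < cmod A" by simp
    have "0 < \<alpha>"
    proof (rule ccontr)
      assume "\<not> 0 < \<alpha>"
      then have "\<alpha> = 0" using \<alpha>0 by simp
      \<comment> \<open>If \<open>\<alpha> = 0\<close>, a large first value \<open>\<beta> + 1\<close> gives a contradiction.\<close>
      then have "2 * (\<beta> + 1) * cmod A * cmod A \<le> cmod A * cmod A * \<beta>"
        using *[OF False, of "\<beta> + 1" "cmod A"] by (simp add: power2_eq_square)
      then have "(cmod A * cmod A) * (2 * (\<beta> + 1)) \<le> (cmod A * cmod A) * \<beta>" by (simp add: ac_simps)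
      then have "2 * (\<beta> + 1) \<le> \<beta>" using A by (simp only: mult_le_cancel_left_pos mult_pos_pos)
      then show False using \<alpha>0 by simp
    qed
    moreover have "\<alpha> * (cmod A)\<^sup>2 \<le> \<alpha> * (\<alpha> * \<beta>)"
      using *[OF False, of "cmod A" \<alpha>] by (simp add: power2_eq_square algebra_simps)
    ultimately show ?thesis by (simp add: A_def)
  qed
qed

text \<open>The Cauchy--Schwarz inequality for the kernel at two points.  The kernel is only an almost
  everywhere object on the diagonal, so the test functions live on intervals of length \<open>h\<close> that shrink
  to \<open>\<xi>\<close> and \<open>\<eta>\<close>.  The mixed block, divided by \<open>h\<^sup>2\<close>, tends to the kernel by continuity; the diagonal
  blocks are only bounded, through difference quotients of \<open>F\<close>, which costs the factor 4.\<close>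

lemma determinant_inequality:
  assumes \<xi>: "(F has_real_derivative d1) (at \<xi>)" and \<eta>: "(F has_real_derivative d2) (at \<eta>)" and ne: "\<xi> \<noteq> \<eta>"
  shows "(cmod (density_transform q (\<eta> - \<xi>)) * divided_difference F \<xi> \<eta>)\<^sup>2 \<le> 4 * (LINT t|lborel. q t)\<^sup>2 * d1 * d2"
proof -
  let ?g = "LINT t|lborel. q t"
  define h where "h n = inverse (real (Suc n))" for n
  have h: "h n > 0" for n by (simp add: h_def)
  have h0: "h \<longlonglongrightarrow> 0" unfolding h_def by (rule LIMSEQ_inverse_real_of_nat)
  define I where "I n = {\<xi>..\<xi> + h n}" for n
  define J where "J n = {\<eta>..\<eta> + h n}" for n
  define k where "k = dd_kernel (\<xi>, \<eta>)"
  have quot: "(\<lambda>n. (F (x + h n) - F x) / h n) \<longlonglongrightarrow> d" if "(F has_real_derivative d) (at x)" for x d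
  proof -
    have "((\<lambda>t. (F (x + t) - F x) / t) \<longlongrightarrow> d) (at 0)" using that by (rule DERIV_D)
    then show ?thesis
      by (rule filterlim_compose) (use h0 h in \<open>auto simp: filterlim_at less_imp_neq[symmetric]\<close>)
  qed
  have bound: "(cmod (dd_block (I n) (J n)) / (h n)\<^sup>2)\<^sup>2
      \<le> 4 * ?g\<^sup>2 * ((F (\<xi> + h n) - F \<xi>) / h n) * ((F (\<eta> + h n) - F \<eta>) / h n)" for n
  proof -
    have "(cmod (dd_block (I n) (J n)))\<^sup>2 \<le> (2 * ?g * h n * (F (\<xi> + h n) - F \<xi>)) * (2 * ?g * h n * (F (\<eta> + h n) - F \<eta>))"
      using dd_block_diagonal[of \<xi> "\<xi> + h n"] dd_block_diagonal[of \<eta> "\<eta> + h n"] h[of n]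
      by (intro dd_block_Cauchy_Schwarz[where R = "\<bar>\<xi>\<bar> + \<bar>\<eta>\<bar> + h n"]) (auto simp: I_def J_def)
    then have "(cmod (dd_block (I n) (J n)))\<^sup>2 / (h n)^4
       \<le> (2 * ?g * h n * (F (\<xi> + h n) - F \<xi>)) * (2 * ?g * h n * (F (\<eta> + h n) - F \<eta>)) / (h n)^4"
      using h[of n] by (intro divide_right_mono) auto
    also have "\<dots> = 4 * ?g\<^sup>2 * ((F (\<xi> + h n) - F \<xi>) / h n) * ((F (\<eta> + h n) - F \<eta>) / h n)"
      using h[of n] by (simp add: field_simps power2_eq_square eval_nat_numeral)
    finally show ?thesis using h[of n] by (simp add: power_divide flip: power_mult)
  qed
  have cont: "isCont dd_kernel (\<xi>, \<eta>)"
  proof -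
    have "isCont F \<xi>" "isCont F \<eta>" using DERIV_isCont[OF \<xi>] DERIV_isCont[OF \<eta>] by auto
    moreover have c: "isCont (\<lambda>z :: real \<times> real. fst z) (\<xi>, \<eta>)" "isCont (\<lambda>z :: real \<times> real. snd z) (\<xi>, \<eta>)"
      by (intro continuous_intros)+
    ultimately have "isCont (\<lambda>z. F (fst z)) (\<xi>, \<eta>)" "isCont (\<lambda>z. F (snd z)) (\<xi>, \<eta>)"
      using isCont_o2[OF c(1), of F] isCont_o2[OF c(2), of F] by simp_all
    moreover have "isCont (\<lambda>z. density_transform q (snd z - fst z)) (\<xi>, \<eta>)"
      by (rule isCont_o2[OF continuous_diff[OF c(2,1)] density_transform_continuous[OF q(1)]])
    ultimately show ?thesis
      unfolding dd_kernel_def[abs_def] divided_difference_def using c ne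
      by (intro continuous_mult continuous_of_real continuous_divide continuous_diff) auto
  qed
  have lim: "(\<lambda>n. dd_block (I n) (J n) / complex_of_real ((h n)\<^sup>2)) \<longlonglongrightarrow> k"
  proof (rule LIMSEQ_I)
    fix r :: real assume r: "r > 0"
    have "(dd_kernel \<longlongrightarrow> dd_kernel (\<xi>, \<eta>)) (nhds (\<xi>, \<eta>))"
      using cont by (simp only: isCont_def tendsto_at_iff_tendsto_nhds)
    from tendstoD[OF this, of "r / 2"] r
    have "\<forall>\<^sub>F z in nhds (\<xi>, \<eta>). dist (dd_kernel z) (dd_kernel (\<xi>, \<eta>)) < r / 2" by simp
    then obtain \<delta> where \<delta>: "\<delta> > 0" "\<And>z. dist z (\<xi>, \<eta>) < \<delta> \<Longrightarrow> dist (dd_kernel z) k < r / 2"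
      unfolding k_def eventually_nhds_metric by auto
    obtain N where N: "\<And>n. n \<ge> N \<Longrightarrow> h n < \<delta> / 2"
      using LIMSEQ_D[OF h0, of "\<delta> / 2"] \<delta>(1) h by (auto simp: less_imp_le)
    have "norm (dd_block (I n) (J n) / complex_of_real ((h n)\<^sup>2) - k) < r" if n: "n \<ge> N" for n
    proof -
      have [measurable]: "I n \<in> sets borel" "J n \<in> sets borel" by (auto simp: I_def J_def)
      have [measurable]: "I n \<times> J n \<in> sets (lborel \<Otimes>\<^sub>M lborel)" by auto
      have bi: "integrable (lborel \<Otimes>\<^sub>M lborel) (\<lambda>z. indicator (I n \<times> J n) z * dd_kernel z)"
        by (rule dd_block_integrable[where R = "\<bar>\<xi>\<bar> + \<bar>\<eta>\<bar> + h n"]) (use h[of n] in \<open>auto simp: I_def J_def\<close>)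
      have em: "emeasure (lborel \<Otimes>\<^sub>M lborel) (I n \<times> J n) = ennreal ((h n)\<^sup>2)"
        using h[of n] by (simp add: lborel.emeasure_pair_measure_Times I_def J_def ennreal_mult power2_eq_square)
      have ii: "integrable (lborel \<Otimes>\<^sub>M lborel) (\<lambda>z. indicator (I n \<times> J n) z :: real)"
        by (rule integrable_real_indicator) (auto simp: em)
      have mI: "(LINT z|(lborel \<Otimes>\<^sub>M lborel). indicator (I n \<times> J n) z :: real) = (h n)\<^sup>2"
        using em by (simp add: measure_def)
      have ki: "integrable (lborel \<Otimes>\<^sub>M lborel) (\<lambda>z. indicator (I n \<times> J n) z * k)"
        using integrable_of_real[OF ii, where 'a = complex] by (simp add: of_real_indicator)
      have "(LINT z|(lborel \<Otimes>\<^sub>M lborel). complex_of_real (indicator (I n \<times> J n) z)) = complex_of_real ((h n)\<^sup>2)"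
        unfolding mI[symmetric] by (rule integral_complex_of_real)
      then have "(LINT z|(lborel \<Otimes>\<^sub>M lborel). complex_of_real (indicator (I n \<times> J n) z) * k) = complex_of_real ((h n)\<^sup>2) * k"
        by (simp only: integral_mult_left_zero)
      then have kk: "(LINT z|(lborel \<Otimes>\<^sub>M lborel). indicator (I n \<times> J n) z * k) = complex_of_real ((h n)\<^sup>2) * k"
        by (simp only: of_real_indicator)
      have "dd_block (I n) (J n) - complex_of_real ((h n)\<^sup>2) * k
          = (LINT z|(lborel \<Otimes>\<^sub>M lborel). indicator (I n \<times> J n) z * dd_kernel z - indicator (I n \<times> J n) z * k)"
        unfolding dd_block_def Bochner_Integration.integral_diff[OF bi ki] kk ..
      also have "norm \<dots> \<le> (LINT z|(lborel \<Otimes>\<^sub>M lborel). indicator (I n \<times> J n) z * (r / 2))"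
      proof (rule order_trans[OF integral_norm_bound integral_mono])
        show "integrable (lborel \<Otimes>\<^sub>M lborel) (\<lambda>z. norm (indicator (I n \<times> J n) z * dd_kernel z - indicator (I n \<times> J n) z * k))"
          by (intro integrable_norm Bochner_Integration.integrable_diff bi ki)
        show "integrable (lborel \<Otimes>\<^sub>M lborel) (\<lambda>z. indicator (I n \<times> J n) z * (r / 2))" using ii by simp
        fix z :: "real \<times> real"
        show "norm (indicator (I n \<times> J n) z * dd_kernel z - indicator (I n \<times> J n) z * k) \<le> indicator (I n \<times> J n) z * (r / 2)"
        proof (cases "z \<in> I n \<times> J n")
          case True
          then have "\<bar>fst z - \<xi>\<bar> \<le> h n" "\<bar>snd z - \<eta>\<bar> \<le> h n" by (auto simp: I_def J_def)
          then have "\<bar>fst z - \<xi>\<bar> + \<bar>snd z - \<eta>\<bar> < \<delta>" using N[OF n] by simp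
          moreover have "dist z (\<xi>, \<eta>) \<le> \<bar>fst z - \<xi>\<bar> + \<bar>snd z - \<eta>\<bar>"
            using sqrt_sum_squares_le_sum_abs[of "fst z - \<xi>" "snd z - \<eta>"] by (cases z) (simp add: dist_Pair_Pair dist_real_def)
          ultimately have "dist (dd_kernel z) k < r / 2" by (intro \<delta>(2)) simp
          then show ?thesis using True by (simp add: dist_norm)
        qed simp
      qed
      also have "\<dots> = (h n)\<^sup>2 * (r / 2)" using mI by simp
      finally have "norm (dd_block (I n) (J n) - complex_of_real ((h n)\<^sup>2) * k) \<le> (h n)\<^sup>2 * (r / 2)" .
      moreover have "dd_block (I n) (J n) / complex_of_real ((h n)\<^sup>2) - k = (dd_block (I n) (J n) - complex_of_real ((h n)\<^sup>2) * k) / complex_of_real ((h n)\<^sup>2)"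
        using h[of n] by (simp add: field_simps)
      ultimately have "norm (dd_block (I n) (J n) / complex_of_real ((h n)\<^sup>2) - k) \<le> r / 2"
        using h[of n] by (simp add: norm_divide norm_power divide_le_eq mult.commute)
      then show ?thesis using r by simp
    qed
    then show "\<exists>no. \<forall>n\<ge>no. norm (dd_block (I n) (J n) / complex_of_real ((h n)\<^sup>2) - k) < r" by blast
  qed
  have "(\<lambda>n. (cmod (dd_block (I n) (J n) / complex_of_real ((h n)\<^sup>2)))\<^sup>2) \<longlonglongrightarrow> (cmod k)\<^sup>2"
    by (intro tendsto_intros lim)
  moreover have "(\<lambda>n. 4 * ?g\<^sup>2 * ((F (\<xi> + h n) - F \<xi>) / h n) * ((F (\<eta> + h n) - F \<eta>) / h n)) \<longlonglongrightarrow> 4 * ?g\<^sup>2 * d1 * d2"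
    by (intro tendsto_intros quot \<xi> \<eta>)
  ultimately have "(cmod k)\<^sup>2 \<le> 4 * ?g\<^sup>2 * d1 * d2"
    by (rule LIMSEQ_le) (use bound h in \<open>auto simp: norm_divide norm_power\<close>)
  then show ?thesis
    using divided_difference_nonneg[OF monotone_density_mono[OF F], of \<xi> \<eta>]
    by (simp add: k_def dd_kernel_def norm_mult mult.commute)
qed

end


section \<open>Exponential decay and Fourier inversion\<close>

lemma AE_lborel_obtain:
  assumes "AE t in lborel. P t" "a < (b::real)"
  obtains t where "a < t" "t < b" "P t"
proof -
  have "\<exists>t. a < t \<and> t < b \<and> P t"
  proof (rule ccontr)
    assume "\<nexists>t. a < t \<and> t < b \<and> P t"
    then have "AE t in lborel. t \<notin> {a<..<b}" using assms(1) by (auto elim: eventually_mono)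
    then have "{a<..<b} \<in> null_sets lborel" by (subst AE_iff_null_sets) auto
    then show False using assms(2) by (auto simp: null_sets_def)
  qed
  then show ?thesis using that by blast
qed

lemma AE_lborel_shift:
  fixes P :: "real \<Rightarrow> bool"
  assumes "AE t in lborel. P t" shows "AE s in lborel. P (x + s)"
proof -
  obtain N where N: "{t \<in> space lborel. \<not> P t} \<subseteq> N" "emeasure lborel N = 0" "N \<in> sets lborel"
    by (rule AE_E[OF assms])
  have [measurable]: "N \<in> sets borel" using N(3) by simp
  have "AE t in lborel. t \<notin> N" using N(2,3) by (intro AE_not_in null_setsI)
  then have "AE s in lborel. x + 1 * s \<notin> N" by (intro AE_borel_affine) auto
  then show ?thesis using N(1) by (auto elim!: eventually_mono)
qed

lemma integrable_even:
  fixes E :: "real \<Rightarrow> real"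
  assumes E: "integrable lborel (\<lambda>s. indicator {0<..} s * E s)" and even: "\<And>s. E (- s) = E s"
    and [measurable]: "E \<in> borel_measurable borel"
  shows "integrable lborel E"
proof -
  have "integrable lborel (\<lambda>s. indicator {0<..} (0 + - 1 * s) * E (0 + - 1 * s))"
    by (rule lborel_integrable_real_affine[OF E]) simp
  then have "integrable lborel (\<lambda>s. indicator {0<..} s * E s + indicator {0<..} (- s) * E s)"
    using E by (intro Bochner_Integration.integrable_add) (simp_all add: even)
  then show ?thesis
  proof (rule integrable_cong_AE_imp)
    show "AE s in lborel. indicator {0<..} s * E s + indicator {0<..} (- s) * E s = E s"
      using AE_lborel_singleton[of "0::real"] by eventually_elim (auto simp: indicator_def)
  qed measurable
qed

text \<open>Fix \<open>\<xi>\<close> below \<open>x0\<close>.  For \<open>s\<close> beyond \<open>y0 - \<xi>\<close> the divided difference between \<open>\<xi>\<close> and \<open>\<xi> + s\<close> is at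
  least \<open>(F y0 - F x0) / s\<close>, so \<open>determinant_inequality\<close> bounds \<open>|\<gamma> s|\<^sup>2 / s\<^sup>2\<close> by a multiple of
  \<open>p (\<xi> + s)\<close>.  The loss of the factor \<open>s\<close> and of the square is paid for by the gap between \<open>b'\<close> and \<open>b\<close>.\<close>

lemma density_transform_decay:
  assumes F: "monotone_density F p" and deriv: "AE t in lborel. (F has_real_derivative p t) (at t)"
    and q: "integrable lborel q" "\<And>t. 0 \<le> q t" and pos: "dd_positive F q"
    and incr: "x0 < y0" "F x0 < F y0"
    and w: "integrable lborel (\<lambda>t. p t * exp (2 * b * t))" and b': "0 \<le> b'" "b' < b"
  shows "integrable lborel (\<lambda>s. exp (b' * \<bar>s\<bar>) * cmod (density_transform q s))"
proof (rule integrable_even)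
  note [measurable] = monotone_densityD(1)[OF F]
  have qm [measurable]: "q \<in> borel_measurable borel" using borel_measurable_integrable[OF q(1)] by simp
  show "(\<lambda>s. exp (b' * \<bar>s\<bar>) * cmod (density_transform q s)) \<in> borel_measurable borel" by measurable
  show "exp (b' * \<bar>- s\<bar>) * cmod (density_transform q (- s)) = exp (b' * \<bar>s\<bar>) * cmod (density_transform q s)" for s
    using cnj_transform[of q s] by (metis abs_minus_cancel complex_mod_cnj)
  let ?g = "LINT t|lborel. q t"
  have g0: "0 \<le> ?g" using q(2) by (intro integral_nonneg_AE) auto
  obtain \<xi> where \<xi>: "\<xi> < x0" "(F has_real_derivative p \<xi>) (at \<xi>)"
    using AE_lborel_obtain[OF deriv, of "x0 - 1" x0] by auto
  define \<delta> where "\<delta> = F y0 - F x0"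
  define s0 where "s0 = y0 - \<xi>"
  define C where "C = 4 * ?g\<^sup>2 * p \<xi>"
  define c where "c = 2 * (b - b')"
  have \<delta>: "\<delta> > 0" and s0: "s0 > 0" and c: "c > 0" using incr \<xi> b' by (auto simp: \<delta>_def s0_def c_def)
  have C0: "0 \<le> C" using monotone_densityD(2)[OF F] by (simp add: C_def)
  let ?B = "\<lambda>s. ?g * exp (b' * s0) * indicator {0..s0} s + C / 2 * exp (- (2 * b * \<xi>)) / \<delta>\<^sup>2 * (p (\<xi> + 1 * s) * exp (2 * b * (\<xi> + 1 * s)))
      + 4 / c\<^sup>2 * (indicator {0<..} s * exp (- (c / 2 * (s - 0))))"
  show "integrable lborel (\<lambda>s. indicator {0<..} s * (exp (b' * \<bar>s\<bar>) * cmod (density_transform q s)))"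
  proof (rule Bochner_Integration.integrable_bound)
    show "integrable lborel ?B"
    proof (intro Bochner_Integration.integrable_add integrable_mult_right)
      show "integrable lborel (\<lambda>s. indicator {0..s0} s :: real)"
        by (rule integrable_real_indicator) (auto simp: emeasure_lborel_Icc_eq)
      show "integrable lborel (\<lambda>s. p (\<xi> + 1 * s) * exp (2 * b * (\<xi> + 1 * s)))"
        by (rule lborel_integrable_real_affine[OF w]) simp
      show "integrable lborel (\<lambda>s. indicator {0<..} s * exp (- (c / 2 * (s - 0))))"
        by (rule damping_integrable) (use c in simp)
    qed
    show "(\<lambda>s. indicator {0<..} s * (exp (b' * \<bar>s\<bar>) * cmod (density_transform q s))) \<in> borel_measurable lborel" by measurable
    show "AE s in lborel. norm (indicator {0<..} s * (exp (b' * \<bar>s\<bar>) * cmod (density_transform q s))) \<le> norm (?B s)"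
      using AE_lborel_shift[OF deriv, of \<xi>]
    proof eventually_elim
      fix s assume d: "(F has_real_derivative p (\<xi> + s)) (at (\<xi> + s))"
      have p0: "0 \<le> p (\<xi> + 1 * s)" by (rule monotone_densityD(2)[OF F])
      have nn: "0 \<le> ?g * exp (b' * s0) * indicator {0..s0} s" "0 \<le> C / 2 * exp (- (2 * b * \<xi>)) / \<delta>\<^sup>2 * (p (\<xi> + 1 * s) * exp (2 * b * (\<xi> + 1 * s)))"
        "0 \<le> 4 / c\<^sup>2 * (indicator {0<..} s * exp (- (c / 2 * (s - 0))))"
        using g0 C0 p0 by auto
      let ?\<gamma> = "cmod (density_transform q s)"
      consider "s \<le> 0" | "0 < s" "s \<le> s0" | "s0 < s" by linarith
      then have "indicator {0<..} s * (exp (b' * \<bar>s\<bar>) * ?\<gamma>) \<le> ?B s"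
      proof cases
        case 1
        then have "indicator {0<..} s * (exp (b' * \<bar>s\<bar>) * ?\<gamma>) = 0" by (simp add: indicator_def)
        then show ?thesis using nn by linarith
      next
        case 2
        have "exp (b' * s) * ?\<gamma> \<le> exp (b' * s0) * ?g"
          using 2 b' density_transform_bound[OF q] by (intro mult_mono) (auto intro: mult_left_mono)
        then have "indicator {0<..} s * (exp (b' * \<bar>s\<bar>) * ?\<gamma>) \<le> ?g * exp (b' * s0) * indicator {0..s0} s"
          using 2 by (simp add: mult.commute)
        then show ?thesis using nn by linarith
      next
        case 3
        then have s: "s > 0" using s0 by simp
        have "F y0 \<le> F (\<xi> + s)" "F \<xi> \<le> F x0"
          using monoD[OF monotone_density_mono[OF F], of y0 "\<xi> + s"] monoD[OF monotone_density_mono[OF F], of \<xi> x0] 3 \<xi>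
          by (auto simp: s0_def)
        then have "\<delta> \<le> F (\<xi> + s) - F \<xi>" by (simp add: \<delta>_def)
        then have dd: "\<delta> / s \<le> divided_difference F \<xi> (\<xi> + s)"
          using s by (simp add: divided_difference_def field_simps)
        have "(?\<gamma> * (\<delta> / s))\<^sup>2 \<le> (?\<gamma> * divided_difference F \<xi> (\<xi> + s))\<^sup>2"
          using dd \<delta> s by (intro power_mono mult_left_mono mult_nonneg_nonneg) auto
        also have "\<dots> \<le> C * p (\<xi> + s)"
          using determinant_inequality[OF F q pos \<xi>(2) d] s by (simp add: C_def)
        finally have main: "(?\<gamma> * (\<delta> / s))\<^sup>2 \<le> C * p (\<xi> + s)" .
        \<comment> \<open>Split the integrand into a part controlled by \<open>p\<close> and an exponentially small part.\<close>
        define A where "A = ?\<gamma> * exp (b * s) / s"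
        define B where "B = s * exp (- (b - b') * s)"
        have "0 \<le> (A - B)\<^sup>2" by simp
        then have "A * B \<le> A\<^sup>2 / 2 + B\<^sup>2 / 2" by (simp add: power2_eq_square algebra_simps)
        moreover have "A * B = exp (b' * s) * ?\<gamma>"
          using s by (simp add: A_def B_def mult_exp_exp algebra_simps)
        moreover have "A\<^sup>2 / 2 \<le> C / 2 * exp (- (2 * b * \<xi>)) / \<delta>\<^sup>2 * (p (\<xi> + 1 * s) * exp (2 * b * (\<xi> + 1 * s)))"
        proof -
          have "A\<^sup>2 = (?\<gamma> * (\<delta> / s))\<^sup>2 * exp (2 * b * s) / \<delta>\<^sup>2"
            using \<delta> by (simp add: A_def power_mult_distrib power_divide exp_double[symmetric] mult.assoc)
          also have "\<dots> \<le> C * p (\<xi> + s) * exp (2 * b * s) / \<delta>\<^sup>2"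
            by (intro divide_right_mono mult_right_mono main) auto
          also have "exp (2 * b * s) = exp (- (2 * b * \<xi>)) * exp (2 * b * (\<xi> + 1 * s))"
            by (simp add: mult_exp_exp algebra_simps)
          finally show ?thesis by (simp add: ac_simps)
        qed
        moreover have "B\<^sup>2 / 2 \<le> 4 / c\<^sup>2 * (indicator {0<..} s * exp (- (c / 2 * (s - 0))))"
        proof -
          have "1 + c * s / 2 + (c * s / 2)\<^sup>2 / 2 \<le> exp (c * s / 2)"
            by (rule exp_lower_Taylor_quadratic) (use c s in simp)
          moreover have "0 \<le> c * s / 2" using c s by simp
          ultimately have "(c * s / 2)\<^sup>2 / 2 \<le> exp (c * s / 2)" by linarith
          then have "s\<^sup>2 \<le> 8 / c\<^sup>2 * exp (c * s / 2)" using c by (simp add: field_simps power2_eq_square)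
          then have "s\<^sup>2 * exp (- (c * s)) \<le> 8 / c\<^sup>2 * exp (c * s / 2) * exp (- (c * s))" by (intro mult_right_mono) auto
          also have "\<dots> = 8 / c\<^sup>2 * exp (- (c / 2 * s))" by (simp add: mult_exp_exp mult.assoc)
          also have "s\<^sup>2 * exp (- (c * s)) = B\<^sup>2"
            by (simp add: B_def c_def power_mult_distrib exp_double[symmetric] algebra_simps)
          finally show ?thesis using s by simp
        qed
        ultimately have "exp (b' * s) * ?\<gamma> \<le> ?B s" using nn by linarith
        then show ?thesis using s by simp
      qed
      then show "norm (indicator {0<..} s * (exp (b' * \<bar>s\<bar>) * ?\<gamma>)) \<le> norm (?B s)"
        by (simp add: abs_mult)
    qed
  qed
qed

text \<open>Levy's inversion formula for the probability measure with density \<open>q\<close>, normalized; absolute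
  integrability turns its improper integral into an ordinary one.\<close>

lemma density_transform_inversion:
  assumes G: "monotone_density G q" and g: "0 < (LINT t|lborel. q t)" and xy: "x \<le> y"
    and int: "integrable lborel (\<lambda>s. (iexp (s * y) - iexp (s * x)) / (\<i> * s) * density_transform q s)"
  shows "complex_of_real (G y - G x) = 1 / (2 * pi) * (LINT s|lborel. (iexp (s * y) - iexp (s * x)) / (\<i> * s) * density_transform q s)"
proof -
  define g where "g = (LINT t|lborel. q t)"
  note [measurable] = monotone_densityD(1)[OF G]
  have q0: "\<And>t. 0 \<le> q t" and qi: "integrable lborel q" using monotone_densityD(2,3)[OF G] by auto
  have g0: "g > 0" using g by (simp add: g_def)
  define M where "M = density lborel (\<lambda>t. ennreal (q t / g))"
  have "(\<integral>\<^sup>+t. ennreal (q t / g) \<partial>lborel) = ennreal (LINT t|lborel. q t / g)"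
    using qi q0 g0 by (intro nn_integral_eq_integral) auto
  also have "\<dots> = 1" using g0 by (simp add: g_def)
  finally have "emeasure M (space M) = 1" by (simp add: M_def emeasure_density)
  then interpret prob_space M by (rule prob_spaceI)
  interpret real_distribution M by unfold_locales (simp_all add: M_def)
  have char: "char M t = density_transform q (- t) / g" for t
  proof -
    have "char M t = (LINT s|lborel. (q s / g) *\<^sub>R iexp (t * s))"
      unfolding char_def M_def using q0 g0 by (subst integral_density) auto
    also have "\<dots> = (LINT s|lborel. iexp (t * s) * complex_of_real (q s) / g)"
      by (intro Bochner_Integration.integral_cong refl) (simp add: scaleR_conv_of_real)
    finally show ?thesis by (simp add: density_transform_def)
  qed
  have meas: "measure M A = (LINT t|lborel. indicator A t * q t) / g" if [measurable]: "A \<in> sets borel" for A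
  proof -
    have "emeasure M A = (\<integral>\<^sup>+t. ennreal (indicator A t * q t / g) \<partial>lborel)"
      unfolding M_def by (subst emeasure_density) (auto intro!: nn_integral_cong simp: indicator_def)
    also have "\<dots> = ennreal (LINT t|lborel. indicator A t * q t / g)"
      using density_indicator_integrable[OF G that] q0 g0 by (intro nn_integral_eq_integral) auto
    finally show ?thesis using q0 g0 by (simp add: measure_def integral_nonneg_AE)
  qed
  have pt: "measure M {t} = 0" for t
  proof -
    have "(LINT s|lborel. indicator {t} s * q s) = G t - G t" using monotone_densityD(4)[OF G, of t t] by simp
    then show ?thesis by (simp add: meas)
  qed
  have ioc: "measure M {x<..y} = (G y - G x) / g"
  proof -
    have "(LINT s|lborel. indicator {x<..y} s * q s) = (LINT s|lborel. indicator {x..y} s * q s)"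
    proof (rule integral_cong_AE)
      show "AE s in lborel. indicator {x<..y} s * q s = indicator {x..y} s * q s"
        using AE_lborel_singleton[of x] by eventually_elim (auto simp: indicator_def)
    qed measurable
    then show ?thesis using monotone_densityD(4)[OF G xy] by (simp add: meas)
  qed
  let ?f = "\<lambda>t. (iexp (-(t * x)) - iexp (-(t * y))) / (\<i> * t) * char M t"
  let ?h = "\<lambda>s. (iexp (s * y) - iexp (s * x)) / (\<i> * s) * density_transform q s"
  have fh: "?f t = ?h (0 + - 1 * t) / g" for t
    unfolding char by (simp add: field_simps) (simp only: minus_divide_left minus_diff_eq)
  have fint: "integrable lborel ?f"
    unfolding fh by (intro integrable_divide_zero lborel_integrable_real_affine[OF int]) simp
  have "(LINT t|lborel. ?f t) = (LINT t|lborel. ?h (0 + - 1 * t)) / g" unfolding fh by (rule integral_divide_zero)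
  also have "(LINT t|lborel. ?h (0 + - 1 * t)) = (LINT t|lborel. ?h t)"
    using lborel_integral_real_affine[of "-1" ?h 0] by simp
  finally have fI: "(LINT t|lborel. ?f t) = (LINT t|lborel. ?h t) / g" .
  have levy: "(\<lambda>T::nat. 1 / (2 * pi) * (CLBINT t=-real T..real T. ?f t)) \<longlonglongrightarrow> measure M {x<..y}"
    using Levy_Inversion[OF xy pt pt] by simp
  have "(\<lambda>T::nat. CLBINT t=-real T..real T. ?f t) \<longlonglongrightarrow> (LINT t|lborel. ?f t)"
  proof -
    note [measurable] = borel_measurable_integrable[OF fint]
    have "(\<lambda>T::nat. LINT t|lborel. indicator {-real T<..<real T} t *\<^sub>R ?f t) \<longlonglongrightarrow> (LINT t|lborel. ?f t)"
    proof (rule integral_dominated_convergence)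
      show "integrable lborel (\<lambda>t. cmod (?f t))" using fint by (rule integrable_norm)
      show "AE t in lborel. (\<lambda>T::nat. indicator {-real T<..<real T} t *\<^sub>R ?f t) \<longlonglongrightarrow> ?f t"
      proof (rule AE_I2)
        fix t :: real
        obtain k :: nat where "\<bar>t\<bar> < real k" using reals_Archimedean2 by blast
        then have "\<forall>\<^sub>F T in sequentially. indicator {-real T<..<real T} t *\<^sub>R ?f t = ?f t"
          by (auto simp: eventually_sequentially indicator_def abs_less_iff intro!: exI[of _ k])
        then show "(\<lambda>T::nat. indicator {-real T<..<real T} t *\<^sub>R ?f t) \<longlonglongrightarrow> ?f t" by (rule tendsto_eventually)
      qed
      show "AE t in lborel. norm (indicator {-real T<..<real T} t *\<^sub>R ?f t) \<le> cmod (?f t)" for T :: nat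
        by (rule AE_I2) (simp add: indicator_def)
    qed measurable
    then show ?thesis
      by (simp add: interval_lebesgue_integral_def set_lebesgue_integral_def einterval_eq)
  qed
  then have "(\<lambda>T::nat. 1 / (2 * pi) * (CLBINT t=-real T..real T. ?f t)) \<longlonglongrightarrow> 1 / (2 * pi) * (LINT t|lborel. ?f t)"
    by (intro tendsto_intros)
  from LIMSEQ_unique[OF levy this]
  have "complex_of_real ((G y - G x) / g) = 1 / (2 * pi) * ((LINT t|lborel. ?h t) / g)"
    unfolding ioc fI .
  then have eq: "complex_of_real (G y - G x) / complex_of_real g = 1 / (2 * pi) * ((LINT t|lborel. ?h t) / complex_of_real g)"
    by (simp only: of_real_divide)
  have "A = c * R" if "A / d = c * (R / d)" "d \<noteq> 0" for A c R d :: complex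
    using that by simp
  note cancel = this
  show ?thesis by (rule cancel[OF eq]) (use g0 in simp)
qed


section \<open>Continuation to the strip\<close>

text \<open>The integral of \<open>exp (\<i> s w)\<close> over \<open>w\<close> from 0 to \<open>z\<close>, which is entire in \<open>z\<close> also at \<open>s = 0\<close>.\<close>

definition exp_kernel :: "real \<Rightarrow> complex \<Rightarrow> complex" where
  "exp_kernel s z = (if s = 0 then z else (exp (\<i> * s * z) - 1) / (\<i> * s))"

lemma exp_kernel_measurable [measurable]: "(\<lambda>s. exp_kernel s z) \<in> borel_measurable borel"
  unfolding exp_kernel_def by measurable

lemma abs_Im_mult: "\<bar>Re (\<i> * complex_of_real s * z)\<bar> = \<bar>s\<bar> * \<bar>Im z\<bar>"
  by (simp add: abs_mult)

lemma exp_kernel_bound: "cmod (exp_kernel s z) \<le> cmod z * exp (\<bar>Im z\<bar> * \<bar>s\<bar>)"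
proof (cases "s = 0")
  case True then show ?thesis by (simp add: exp_kernel_def)
next
  case False
  have "cmod (exp (\<i> * s * z) - 1) \<le> exp \<bar>Re (\<i> * s * z)\<bar> * cmod (\<i> * s * z)"
    using Taylor_exp[of "\<i> * s * z" 0] by simp
  also have "\<dots> = (cmod z * exp (\<bar>Im z\<bar> * \<bar>s\<bar>)) * \<bar>s\<bar>"
    unfolding abs_Im_mult by (simp add: norm_mult mult.commute)
  finally show ?thesis using False by (simp add: exp_kernel_def norm_divide norm_mult divide_le_eq)
qed

text \<open>The second-order Taylor estimate, with the exponential growth in \<open>s\<close> kept explicit so that the
  decay of the transform can absorb it.\<close>

lemma exp_kernel_increment:
  "cmod (exp_kernel s (z + h) - exp_kernel s z - h * exp (\<i> * s * z)) \<le> (cmod h)\<^sup>2 * (\<bar>s\<bar> * exp ((\<bar>Im z\<bar> + cmod h) * \<bar>s\<bar>))"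
proof (cases "s = 0")
  case True then show ?thesis by (simp add: exp_kernel_def)
next
  case False
  define e where "e = exp (\<i> * s * h) - 1 - \<i> * s * h"
  have "cmod e \<le> exp \<bar>Re (\<i> * s * h)\<bar> * (cmod (\<i> * s * h))\<^sup>2"
    using Taylor_exp[of "\<i> * s * h" 1] by (simp add: e_def diff_diff_eq numeral_2_eq_2)
  also have "\<dots> \<le> exp (cmod h * \<bar>s\<bar>) * (\<bar>s\<bar> * cmod h)\<^sup>2"
  proof -
    have "\<bar>s\<bar> * \<bar>Im h\<bar> \<le> cmod h * \<bar>s\<bar>"
      using mult_right_mono[OF abs_Im_le_cmod[of h], of "\<bar>s\<bar>"] by (simp add: mult.commute)
    then have "exp (\<bar>s\<bar> * \<bar>Im h\<bar>) * (\<bar>s\<bar> * cmod h)\<^sup>2 \<le> exp (cmod h * \<bar>s\<bar>) * (\<bar>s\<bar> * cmod h)\<^sup>2"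
      by (intro mult_right_mono) auto
    then show ?thesis unfolding abs_Im_mult by (simp add: norm_mult)
  qed
  finally have e: "cmod e \<le> exp (cmod h * \<bar>s\<bar>) * (\<bar>s\<bar> * cmod h)\<^sup>2" .
  have "exp_kernel s (z + h) - exp_kernel s z - h * exp (\<i> * s * z) = exp (\<i> * s * z) * e / (\<i> * s)"
    using False by (simp add: exp_kernel_def e_def exp_add distrib_left field_simps)
  then have "cmod (exp_kernel s (z + h) - exp_kernel s z - h * exp (\<i> * s * z)) = exp (Re (\<i> * s * z)) * cmod e / \<bar>s\<bar>"
    by (simp add: norm_mult norm_divide)
  also have "\<dots> \<le> exp (\<bar>Im z\<bar> * \<bar>s\<bar>) * (exp (cmod h * \<bar>s\<bar>) * (\<bar>s\<bar> * cmod h)\<^sup>2) / \<bar>s\<bar>"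
  proof (intro divide_right_mono mult_mono e)
    have "Re (\<i> * s * z) \<le> \<bar>s\<bar> * \<bar>Im z\<bar>" using abs_Im_mult[of s z] abs_ge_self by metis
    then show "exp (Re (\<i> * s * z)) \<le> exp (\<bar>Im z\<bar> * \<bar>s\<bar>)" by (simp only: exp_le_cancel_iff mult.commute)
  qed auto
  also have "\<dots> = (cmod h)\<^sup>2 * (\<bar>s\<bar> * exp ((\<bar>Im z\<bar> + cmod h) * \<bar>s\<bar>))"
    using False by (simp add: power2_eq_square distrib_right exp_add)
  finally show ?thesis .
qed

lemma cnj_exp_kernel: "cnj (exp_kernel s z) = exp_kernel (- s) (cnj z)"
  by (simp add: exp_kernel_def exp_cnj)

context
  fixes q :: "real \<Rightarrow> real" and \<beta> :: real
  assumes q: "integrable lborel q"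
    and decay: "\<And>b. 0 \<le> b \<Longrightarrow> b < \<beta> \<Longrightarrow> integrable lborel (\<lambda>s. exp (b * \<bar>s\<bar>) * cmod (density_transform q s))"
begin

text \<open>Fourier inversion evaluated at complex points; the value at 0 is normalized to 0.\<close>

definition strip_extension :: "complex \<Rightarrow> complex" where
  "strip_extension z = 1 / (2 * pi) * (LINT s|lborel. exp_kernel s z * density_transform q s)"

lemma density_transform_meas [measurable]: "density_transform q \<in> borel_measurable borel"
  using borel_measurable_integrable[OF q] by simp

lemma decay_dominates:
  assumes b: "0 \<le> b" "b < \<beta>" and [measurable]: "k \<in> borel_measurable borel"
    and k: "\<And>s. cmod (k s) \<le> C * exp (b * \<bar>s\<bar>)"
  shows "integrable lborel (\<lambda>s. k s * density_transform q s)"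
proof (rule Bochner_Integration.integrable_bound)
  show "integrable lborel (\<lambda>s. C * (exp (b * \<bar>s\<bar>) * cmod (density_transform q s)))"
    by (intro integrable_mult_right decay b)
  show "(\<lambda>s. k s * density_transform q s) \<in> borel_measurable lborel" by measurable
  show "AE s in lborel. norm (k s * density_transform q s) \<le> norm (C * (exp (b * \<bar>s\<bar>) * cmod (density_transform q s)))"
  proof (rule AE_I2)
    fix s
    have "norm (k s * density_transform q s) \<le> (C * exp (b * \<bar>s\<bar>)) * cmod (density_transform q s)"
      unfolding norm_mult by (rule mult_right_mono[OF k]) simp
    then show "norm (k s * density_transform q s) \<le> norm (C * (exp (b * \<bar>s\<bar>) * cmod (density_transform q s)))"
      by (simp only: mult.assoc real_norm_def order_trans[OF _ abs_ge_self])
  qed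
qed

lemma strip_extension_integrable:
  assumes "\<bar>Im z\<bar> < \<beta>"
  shows "integrable lborel (\<lambda>s. exp_kernel s z * density_transform q s)"
  by (rule decay_dominates[of "\<bar>Im z\<bar>" _ "cmod z"]) (use assms exp_kernel_bound in auto)

text \<open>The remainder in \<open>exp_kernel_increment\<close> is of order \<open>(cmod h)\<^sup>2\<close> uniformly in \<open>s\<close> after the decay
  is used, because a little room is left between \<open>\<bar>Im z\<bar>\<close> and \<open>\<beta>\<close>.\<close>

lemma strip_extension_derivative:
  assumes z: "\<bar>Im z\<bar> < \<beta>"
  shows "(strip_extension has_field_derivative (1 / (2 * pi) * (LINT s|lborel. exp (\<i> * s * z) * density_transform q s))) (at z)"
proof -
  \<comment> \<open>One third of the distance to the boundary for the increment, one third to absorb the factor \<open>\<bar>s\<bar>\<close>.\<close>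
  define r where "r = (\<beta> - \<bar>Im z\<bar>) / 3"
  have r: "r > 0" "\<bar>Im z\<bar> + 2 * r < \<beta>" using z by (auto simp: r_def field_simps)
  define c where "c = \<bar>Im z\<bar> + 2 * r"
  define D where "D = (LINT s|lborel. exp (\<i> * s * z) * density_transform q s)"
  define K where "K = 1 / r * (LINT s|lborel. exp (c * \<bar>s\<bar>) * cmod (density_transform q s))"
  have c: "0 \<le> c" "c < \<beta>" using r by (auto simp: c_def)
  have Di: "integrable lborel (\<lambda>s. exp (\<i> * s * z) * density_transform q s)"
  proof (rule decay_dominates[of "\<bar>Im z\<bar>" _ 1])
    fix s
    have "Re (\<i> * s * z) \<le> \<bar>s\<bar> * \<bar>Im z\<bar>" using abs_Im_mult[of s z] abs_ge_self by metis
    then show "cmod (exp (\<i> * s * z)) \<le> 1 * exp (\<bar>Im z\<bar> * \<bar>s\<bar>)"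
      by (simp only: norm_exp_eq_Re exp_le_cancel_iff mult.commute mult_1)
  qed (use z in auto)
  have est: "cmod (strip_extension (z + h) - strip_extension z - h * (1 / (2 * pi) * D)) \<le> (cmod h)\<^sup>2 * K" if h: "cmod h < r" for h
  proof -
    have "\<bar>Im (z + h)\<bar> < \<beta>" using abs_Im_le_cmod[of h] h r by simp
    note zi = strip_extension_integrable[OF this] strip_extension_integrable[OF z] Di
    let ?R = "\<lambda>s. (exp_kernel s (z + h) - exp_kernel s z - h * exp (\<i> * s * z)) * density_transform q s"
    have "strip_extension (z + h) - strip_extension z - h * (1 / (2 * pi) * D)
        = 1 / (2 * pi) * ((LINT s|lborel. exp_kernel s (z + h) * density_transform q s) - (LINT s|lborel. exp_kernel s z * density_transform q s)
             - (LINT s|lborel. h * (exp (\<i> * s * z) * density_transform q s)))"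
      unfolding strip_extension_def D_def integral_mult_right_zero by (simp add: algebra_simps)
    also have "\<dots> = 1 / (2 * pi) * (LINT s|lborel. ?R s)"
      using zi by (simp add: left_diff_distrib mult.assoc)
    finally have "cmod (strip_extension (z + h) - strip_extension z - h * (1 / (2 * pi) * D)) = 1 / (2 * pi) * cmod (LINT s|lborel. ?R s)"
      by (simp add: norm_mult norm_divide)
    also have "\<dots> \<le> 1 * cmod (LINT s|lborel. ?R s)"
      using pi_gt3 by (intro mult_right_mono) auto
    also have "\<dots> \<le> (LINT s|lborel. (cmod h)\<^sup>2 * (1 / r * (exp (c * \<bar>s\<bar>) * cmod (density_transform q s))))"
      unfolding mult_1
    proof (rule order_trans[OF integral_norm_bound integral_mono])
      show "integrable lborel (\<lambda>s. norm (?R s))"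
      proof (rule integrable_norm)
        have "integrable lborel (\<lambda>s. exp_kernel s (z + h) * density_transform q s - exp_kernel s z * density_transform q s - h * (exp (\<i> * s * z) * density_transform q s))"
          using zi by simp
        then show "integrable lborel ?R" by (simp add: left_diff_distrib mult.assoc)
      qed
      show "integrable lborel (\<lambda>s. (cmod h)\<^sup>2 * (1 / r * (exp (c * \<bar>s\<bar>) * cmod (density_transform q s))))"
        by (intro integrable_mult_right decay c)
      fix s
      have rs: "\<bar>s\<bar> \<le> 1 / r * exp (r * \<bar>s\<bar>)"
      proof -
        have "r * \<bar>s\<bar> \<le> exp (r * \<bar>s\<bar>)" using exp_ge_add_one_self[of "r * \<bar>s\<bar>"] by linarith
        then show ?thesis using r by (simp add: field_simps)
      qed
      have "cmod (exp_kernel s (z + h) - exp_kernel s z - h * exp (\<i> * s * z)) \<le> (cmod h)\<^sup>2 * (\<bar>s\<bar> * exp ((\<bar>Im z\<bar> + cmod h) * \<bar>s\<bar>))"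
        by (rule exp_kernel_increment)
      also have "\<dots> \<le> (cmod h)\<^sup>2 * ((1 / r * exp (r * \<bar>s\<bar>)) * exp ((\<bar>Im z\<bar> + r) * \<bar>s\<bar>))"
        using rs h by (intro mult_left_mono mult_mono) (auto intro: mult_right_mono)
      also have "\<dots> = (cmod h)\<^sup>2 * (1 / r * exp (c * \<bar>s\<bar>))"
        by (simp add: c_def mult_exp_exp algebra_simps)
      finally have "cmod (exp_kernel s (z + h) - exp_kernel s z - h * exp (\<i> * s * z)) * cmod (density_transform q s)
          \<le> (cmod h)\<^sup>2 * (1 / r * exp (c * \<bar>s\<bar>)) * cmod (density_transform q s)"
        by (rule mult_right_mono) simp
      then show "norm (?R s) \<le> (cmod h)\<^sup>2 * (1 / r * (exp (c * \<bar>s\<bar>) * cmod (density_transform q s)))"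
        by (simp only: norm_mult mult.assoc)
    qed
    also have "\<dots> = (cmod h)\<^sup>2 * K" by (simp add: K_def)
    finally show ?thesis .
  qed
  show ?thesis
    unfolding has_field_derivative_iff D_def[symmetric]
  proof (rule LIM_zero_cancel, rule tendsto_norm_zero_cancel, rule tendsto_sandwich)
    show "\<forall>\<^sub>F w in at z. 0 \<le> norm ((strip_extension w - strip_extension z) / (w - z) - 1 / (2 * pi) * D)" by simp
    show "\<forall>\<^sub>F w in at z. norm ((strip_extension w - strip_extension z) / (w - z) - 1 / (2 * pi) * D) \<le> cmod (w - z) * K"
      unfolding eventually_at
    proof (intro exI[of _ r] conjI r ballI impI)
      fix w assume w: "w \<noteq> z \<and> dist w z < r"
      have "cmod (strip_extension (z + (w - z)) - strip_extension z - (w - z) * (1 / (2 * pi) * D)) \<le> (cmod (w - z))\<^sup>2 * K"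
        by (rule est) (use w in \<open>simp add: dist_norm\<close>)
      then have "cmod (strip_extension w - strip_extension z - (w - z) * (1 / (2 * pi) * D)) / cmod (w - z) \<le> (cmod (w - z))\<^sup>2 * K / cmod (w - z)"
        by (intro divide_right_mono) auto
      moreover have "(strip_extension w - strip_extension z) / (w - z) - 1 / (2 * pi) * D = (strip_extension w - strip_extension z - (w - z) * (1 / (2 * pi) * D)) / (w - z)"
        using w by (simp add: diff_divide_distrib)
      ultimately show "norm ((strip_extension w - strip_extension z) / (w - z) - 1 / (2 * pi) * D) \<le> cmod (w - z) * K"
        using w by (simp add: norm_divide power2_eq_square)
    qed
    have "((\<lambda>w. cmod (w - z) * K) \<longlongrightarrow> cmod (z - z) * K) (at z)" by (intro tendsto_intros)
    then show "((\<lambda>w. cmod (w - z) * K) \<longlongrightarrow> 0) (at z)" by simp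
  qed simp
qed

lemma strip_extension_holomorphic: "strip_extension holomorphic_on {z. \<bar>Im z\<bar> < \<beta>}"
  unfolding holomorphic_on_def field_differentiable_def
  using strip_extension_derivative has_field_derivative_at_within by blast

lemma cnj_strip_extension: "cnj (strip_extension z) = strip_extension (cnj z)"
proof -
  have "cnj (LINT s|lborel. exp_kernel s z * density_transform q s) = (LINT s|lborel. cnj (exp_kernel s z * density_transform q s))"
    by (rule Bochner_Integration.integral_cnj[symmetric])
  also have "\<dots> = (LINT s|lborel. exp_kernel (0 + - 1 * s) (cnj z) * density_transform q (0 + - 1 * s))"
    by (simp add: cnj_exp_kernel cnj_transform)
  also have "\<dots> = (LINT s|lborel. exp_kernel s (cnj z) * density_transform q s)"
    using lborel_integral_real_affine[of "-1" "\<lambda>s. exp_kernel s (cnj z) * density_transform q s" 0] by simp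
  finally show ?thesis by (simp add: strip_extension_def)
qed

lemma strip_extension_real:
  assumes G: "monotone_density G q" and g: "0 < (LINT t|lborel. q t)" and \<beta>: "0 < \<beta>"
  shows "strip_extension (complex_of_real x) = complex_of_real (G x - G 0)"
proof -
  have *: "complex_of_real (G y - G x) = strip_extension (complex_of_real y) - strip_extension (complex_of_real x)" if xy: "x \<le> y" for x y
  proof -
    let ?h = "\<lambda>s. (iexp (s * y) - iexp (s * x)) / (\<i> * s) * density_transform q s"
    let ?d = "\<lambda>s. exp_kernel s (complex_of_real y) * density_transform q s - exp_kernel s (complex_of_real x) * density_transform q s"
    have int: "integrable lborel (\<lambda>s. exp_kernel s (complex_of_real y) * density_transform q s)"
       "integrable lborel (\<lambda>s. exp_kernel s (complex_of_real x) * density_transform q s)"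
      by (rule strip_extension_integrable; use \<beta> in simp)+
    have eq: "AE s in lborel. ?d s = ?h s"
      using AE_lborel_singleton[of "0::real"]
      by eventually_elim (simp add: exp_kernel_def mult.assoc diff_divide_distrib left_diff_distrib)
    have dint: "integrable lborel ?d" using int by simp
    have hm: "?h \<in> borel_measurable lborel" by measurable
    have hint: "integrable lborel ?h"
      by (rule integrable_cong_AE_imp[OF dint hm]) (use eq in \<open>auto elim: eventually_mono\<close>)
    have "(LINT s|lborel. ?h s) = (LINT s|lborel. ?d s)"
      by (rule integral_cong_AE) (use eq hm in \<open>auto elim: eventually_mono\<close>)
    also have "\<dots> = (LINT s|lborel. exp_kernel s (complex_of_real y) * density_transform q s) - (LINT s|lborel. exp_kernel s (complex_of_real x) * density_transform q s)"
      by (rule Bochner_Integration.integral_diff[OF int])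
    finally show ?thesis
      unfolding density_transform_inversion[OF G g xy hint] strip_extension_def by (simp add: right_diff_distrib)
  qed
  have "exp_kernel s 0 = 0" for s by (simp add: exp_kernel_def)
  then have "strip_extension 0 = 0" by (simp add: strip_extension_def)
  then show ?thesis using *[of 0 x] *[of x 0] by (cases "0 \<le> x") (auto simp: algebra_simps)
qed

text \<open>\<open>2 \<i> Im (strip_extension z)\<close> is the difference of the values at \<open>z\<close> and at its conjugate.\<close>

lemma Im_strip_extension:
  assumes b: "0 < b" "b < \<beta>"
  shows "complex_of_real (4 * pi * Im (strip_extension (Complex x b)))
       = (LINT s|lborel. iexp (s * x) * complex_of_real ((exp (b * s) - exp (- (b * s))) / s) * density_transform q s)"
proof -
  let ?z = "Complex x b"
  have i: "integrable lborel (\<lambda>s. exp_kernel s ?z * density_transform q s)" "integrable lborel (\<lambda>s. exp_kernel s (cnj ?z) * density_transform q s)"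
    by (rule strip_extension_integrable; use b in simp)+
  have "2 * \<i> * complex_of_real (Im (strip_extension ?z)) = strip_extension ?z - strip_extension (cnj ?z)"
    unfolding cnj_strip_extension[symmetric] by (simp add: complex_eq_iff)
  also have "\<dots> = 1 / (2 * pi) * ((LINT s|lborel. exp_kernel s ?z * density_transform q s) - (LINT s|lborel. exp_kernel s (cnj ?z) * density_transform q s))"
    by (simp only: strip_extension_def right_diff_distrib)
  also have "(LINT s|lborel. exp_kernel s ?z * density_transform q s) - (LINT s|lborel. exp_kernel s (cnj ?z) * density_transform q s)
      = (LINT s|lborel. exp_kernel s ?z * density_transform q s - exp_kernel s (cnj ?z) * density_transform q s)"
    by (rule Bochner_Integration.integral_diff[OF i, symmetric])
  also have "\<dots> = (LINT s|lborel. \<i> * (iexp (s * x) * complex_of_real ((exp (b * s) - exp (- (b * s))) / s) * density_transform q s))"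
  proof (rule integral_cong_AE)
    show "AE s in lborel. exp_kernel s ?z * density_transform q s - exp_kernel s (cnj ?z) * density_transform q s
        = \<i> * (iexp (s * x) * complex_of_real ((exp (b * s) - exp (- (b * s))) / s) * density_transform q s)"
      using AE_lborel_singleton[of "0::real"]
    proof eventually_elim
      fix s :: real assume s: "s \<noteq> 0"
      have z: "\<i> * s * ?z = \<i> * (s * x) + complex_of_real (- (b * s))" "\<i> * s * cnj ?z = \<i> * (s * x) + complex_of_real (b * s)"
        by (simp_all add: complex_eq_iff)
      have "exp_kernel s ?z - exp_kernel s (cnj ?z) = iexp (s * x) * complex_of_real (exp (- (b * s)) - exp (b * s)) / (\<i> * s)"
        using s unfolding exp_kernel_def z exp_add exp_of_real by (simp add: diff_divide_distrib right_diff_distrib)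
      also have "\<dots> = \<i> * (iexp (s * x) * complex_of_real ((exp (b * s) - exp (- (b * s))) / s))"
        using s by (simp add: field_simps)
      finally show "exp_kernel s ?z * density_transform q s - exp_kernel s (cnj ?z) * density_transform q s
        = \<i> * (iexp (s * x) * complex_of_real ((exp (b * s) - exp (- (b * s))) / s) * density_transform q s)"
        by (simp only: left_diff_distrib[symmetric] mult.assoc)
    qed
  qed measurable
  also have "\<dots> = \<i> * (LINT s|lborel. iexp (s * x) * complex_of_real ((exp (b * s) - exp (- (b * s))) / s) * density_transform q s)"
    by (rule integral_mult_right_zero)
  finally have "2 * \<i> * complex_of_real (Im (strip_extension ?z))
     = 1 / (2 * pi) * (\<i> * (LINT s|lborel. iexp (s * x) * complex_of_real ((exp (b * s) - exp (- (b * s))) / s) * density_transform q s))" .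
  moreover have "complex_of_real (4 * pi * r) = A" if "2 * \<i> * complex_of_real r = 1 / (2 * pi) * (\<i> * A)" for r A
    using that by (simp add: field_simps)
  ultimately show ?thesis by blast
qed

end


section \<open>The sign of the imaginary part and the Kato classes\<close>

lemma integral_triple_kernel:
  fixes A :: "real \<Rightarrow> complex" and B :: "real \<times> real \<Rightarrow> complex"
  assumes "integrable lborel A" "integrable (lborel \<Otimes>\<^sub>M lborel) B"
    and "case_prod k \<in> borel_measurable (lborel \<Otimes>\<^sub>M (lborel \<Otimes>\<^sub>M lborel))"
    and "\<And>s w. cmod (k s w) \<le> C"
  shows "integrable (lborel \<Otimes>\<^sub>M (lborel \<Otimes>\<^sub>M lborel)) (\<lambda>(s, w). A s * (k s w * B w))"
    "(LINT v|(lborel \<Otimes>\<^sub>M (lborel \<Otimes>\<^sub>M lborel)). (case v of (s, w) \<Rightarrow> A s * (k s w * B w)))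
       = (LINT s|lborel. A s * (LINT w|(lborel \<Otimes>\<^sub>M lborel). k s w * B w))"
proof -
  have 1: "integrable (lborel \<Otimes>\<^sub>M lborel) (\<lambda>(s, w). A s * (k s w * B w))"
    using integrable_bounded_kernel[of A B k C] assms unfolding lborel_prod by blast
  then show "integrable (lborel \<Otimes>\<^sub>M (lborel \<Otimes>\<^sub>M lborel)) (\<lambda>(s, w). A s * (k s w * B w))"
    unfolding lborel_prod .
  show "(LINT v|(lborel \<Otimes>\<^sub>M (lborel \<Otimes>\<^sub>M lborel)). (case v of (s, w) \<Rightarrow> A s * (k s w * B w)))
       = (LINT s|lborel. A s * (LINT w|(lborel \<Otimes>\<^sub>M lborel). k s w * B w))"
    using lborel_pair.integral_fst'[OF 1] unfolding lborel_prod by simp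
qed

lemma integral_exp_symmetric:
  fixes b s :: real
  assumes "b \<noteq> 0" "s \<noteq> 0"
  shows "has_bochner_integral lborel (\<lambda>\<theta>. indicator {0..1} \<theta> * exp (b * s * (1 - 2 * \<theta>))) ((exp (b * s) - exp (- (b * s))) / (2 * b * s))"
proof -
  let ?P = "\<lambda>\<theta>. - exp (b * s * (1 - 2 * \<theta>)) / (2 * b * s)"
  have "has_bochner_integral lborel (\<lambda>\<theta>. exp (b * s * (1 - 2 * \<theta>)) * indicator {0..1} \<theta>) (?P 1 - ?P 0)"
  proof (rule has_bochner_integral_FTC_Icc_real)
    show "DERIV ?P \<theta> :> exp (b * s * (1 - 2 * \<theta>))" for \<theta>
      using assms by (auto intro!: derivative_eq_intros)
    show "isCont (\<lambda>\<theta>. exp (b * s * (1 - 2 * \<theta>))) \<theta>" for \<theta> by (intro continuous_intros)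
  qed simp
  moreover have "?P 1 - ?P 0 = (exp (b * s) - exp (- (b * s))) / (2 * b * s)"
    by (simp add: diff_divide_distrib)
  ultimately show ?thesis by (simp only: mult.commute)
qed

text \<open>The test functions are truncations of \<open>e \<xi> = exp (- \<i> z \<xi>)\<close> with \<open>z = x + \<i> b\<close>.  In the coordinates of
  \<open>spread\<close> the product \<open>cnj (e \<eta>) * e \<xi>\<close> is
  \<open>exp (2 b y) * exp (b s (1 - 2 \<theta>)) * exp (\<i> s x)\<close>, so the form splits into the moment of \<open>p\<close>, which
  is positive, and an integral over \<open>s\<close> that is a positive multiple of the imaginary part.  The same
  splitting shows absolute convergence, which justifies removing the truncation.\<close>

lemma Im_strip_extension_nonneg:
  assumes F: "monotone_density F p" and q: "integrable lborel q" "\<And>t. 0 \<le> q t" and pos: "dd_positive F q"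
    and decay: "\<And>b. 0 \<le> b \<Longrightarrow> b < \<beta> \<Longrightarrow> integrable lborel (\<lambda>s. exp (b * \<bar>s\<bar>) * cmod (density_transform q s))"
    and b: "0 < b" "b < \<beta>" and w: "integrable lborel (\<lambda>t. p t * exp (2 * b * t))"
    and wpos: "0 < (LINT t|lborel. p t * exp (2 * b * t))"
  shows "0 \<le> Im (strip_extension q (Complex x b))"
proof -
  let ?M2 = "lborel \<Otimes>\<^sub>M (lborel :: real measure) :: (real \<times> real) measure"
  let ?M3 = "lborel \<Otimes>\<^sub>M ?M2 :: (real \<times> real \<times> real) measure"
  let ?\<phi> = "LINT t|lborel. p t * exp (2 * b * t)"
  let ?dd = "\<lambda>z. divided_difference F (fst z) (snd z)"
  note [measurable] = monotone_densityD(1)[OF F] divided_difference_measurable[OF F]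
    spread_weight_measurable[OF monotone_densityD(1)[OF F]]
  have qm [measurable]: "q \<in> borel_measurable borel" using borel_measurable_integrable[OF q(1)] by simp
  have dd0: "0 \<le> ?dd z" for z by (rule divided_difference_nonneg[OF monotone_density_mono[OF F]])
  have W0: "0 \<le> spread_weight p v" for v
    using monotone_densityD(2)[OF F] by (cases v) (simp add: spread_weight_def)
  define e where "e \<xi> = complex_of_real (exp (b * \<xi>)) * iexp (- (x * \<xi>))" for \<xi>
  have [measurable]: "e \<in> borel_measurable borel" unfolding e_def by measurable
  define H where "H z = cnj (e (snd z)) * e (fst z) * density_transform q (snd z - fst z)" for z
  have Hm [measurable]: "H \<in> borel_measurable ?M2" unfolding H_def by measurable
  \<comment> \<open>\<open>A\<close> carries the decay, \<open>B\<close> the moment of \<open>p\<close>, and \<open>k\<close> the coupling: its exponent is nonpositive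
    because \<open>\<bar>1 - 2 \<theta>\<bar> \<le> 1\<close> on the unit interval.\<close>
  define A where "A s = complex_of_real (exp (b * \<bar>s\<bar>)) * density_transform q s" for s
  define k where "k s w = complex_of_real (indicator {0..1} (fst w) * exp (b * s * (1 - 2 * fst w) - b * \<bar>s\<bar>)) * iexp (s * x)" for s :: real and w :: "real \<times> real"
  define B where "B w = complex_of_real (indicator {0..1} (fst w)) * complex_of_real (p (snd w) * exp (2 * b * snd w))" for w :: "real \<times> real"
  have Aint: "integrable lborel A"
  proof (rule integrable_norm_cancel)
    show "integrable lborel (\<lambda>s. norm (A s))" using decay[of b] b by (simp add: A_def norm_mult)
    show "A \<in> borel_measurable lborel" unfolding A_def by measurable
  qed
  have ind: "integrable lborel (\<lambda>\<theta>. complex_of_real (indicator {0..1::real} \<theta>))"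
    by (intro integrable_of_real integrable_real_indicator) auto
  have wc: "integrable lborel (\<lambda>t. complex_of_real (p t * exp (2 * b * t)))" by (rule integrable_of_real[OF w])
  have wI: "(LINT t|lborel. complex_of_real (p t * exp (2 * b * t))) = complex_of_real ?\<phi>"
    by (rule integral_complex_of_real)
  have Bint: "integrable ?M2 B" unfolding B_def by (rule integral_pair_product(1)[OF ind wc])
  have km: "case_prod k \<in> borel_measurable ?M3" unfolding k_def case_prod_unfold by measurable
  have kb: "cmod (k s w) \<le> 1" for s w
  proof (cases "fst w \<in> {0..1}")
    case True
    then have "\<bar>1 - 2 * fst w\<bar> \<le> 1" by auto
    then have "\<bar>b * s * (1 - 2 * fst w)\<bar> \<le> b * \<bar>s\<bar>"
      using b by (simp add: abs_mult mult_left_le)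
    then have "b * s * (1 - 2 * fst w) - b * \<bar>s\<bar> \<le> 0" by linarith
    then show ?thesis using True unfolding k_def norm_mult norm_of_real norm_exp_i_times by simp
  next
    case False then show ?thesis by (simp add: k_def)
  qed
  have eq3: "spread_weight p v *\<^sub>R H (spread v) = (case v of (s, w) \<Rightarrow> A s * (k s w * B w))" for v
  proof -
    obtain s \<theta> y where v: "v = (s, \<theta>, y)" by (cases v)
    define \<xi> where "\<xi> = y - \<theta> * s"
    have "cnj (e (\<xi> + s)) * e \<xi> = complex_of_real (exp (b * (\<xi> + s)) * exp (b * \<xi>)) * (iexp (x * (\<xi> + s)) * iexp (- (x * \<xi>)))"
      by (simp add: e_def exp_cnj)
    also have "exp (b * (\<xi> + s)) * exp (b * \<xi>) = exp (b * \<bar>s\<bar>) * exp (b * s * (1 - 2 * \<theta>) - b * \<bar>s\<bar>) * exp (2 * b * y)"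
      by (simp add: \<xi>_def mult_exp_exp algebra_simps)
    also have "iexp (x * (\<xi> + s)) * iexp (- (x * \<xi>)) = iexp (s * x)"
      by (simp add: mult_exp_exp algebra_simps)
    finally have "H (spread v) = complex_of_real (exp (b * \<bar>s\<bar>) * exp (b * s * (1 - 2 * \<theta>) - b * \<bar>s\<bar>) * exp (2 * b * y)) * iexp (s * x) * density_transform q s"
      by (simp add: H_def v spread_def \<xi>_def)
    then show ?thesis
      by (simp add: v spread_weight_def A_def k_def B_def scaleR_conv_of_real indicator_def)
  qed
  note triple = integral_triple_kernel[OF Aint Bint km kb]
  have distr: "density ?M2 (\<lambda>z. ennreal (?dd z)) = distr (density ?M3 (\<lambda>v. ennreal (spread_weight p v))) ?M2 spread"
    by (rule divided_difference_distr[OF F])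
  have spm: "spread \<in> density ?M3 (\<lambda>v. ennreal (spread_weight p v)) \<rightarrow>\<^sub>M ?M2" by measurable
  have Hspm: "(\<lambda>v. H (spread v)) \<in> borel_measurable ?M3" by measurable
  have "integrable ?M3 (\<lambda>v. spread_weight p v *\<^sub>R H (spread v))" unfolding eq3 by (rule triple(1))
  then have "integrable (density ?M3 (\<lambda>v. ennreal (spread_weight p v))) (\<lambda>v. H (spread v))"
    by (subst integrable_density[OF Hspm]) (auto simp: W0)
  then have "integrable (density ?M2 (\<lambda>z. ennreal (?dd z))) H"
    unfolding distr by (subst integrable_distr_eq[OF spm Hm])
  then have Hint: "integrable ?M2 (\<lambda>z. ?dd z *\<^sub>R H z)"
    by (subst (asm) integrable_density) (auto simp: dd0)
  have "(LINT z|?M2. ?dd z *\<^sub>R H z) = (LINT z|density ?M2 (\<lambda>z. ennreal (?dd z)). H z)"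
    by (subst integral_density) (auto simp: dd0)
  also have "\<dots> = (LINT v|density ?M3 (\<lambda>v. ennreal (spread_weight p v)). H (spread v))"
    unfolding distr by (rule integral_distr[OF spm Hm])
  also have "\<dots> = (LINT v|?M3. spread_weight p v *\<^sub>R H (spread v))"
    by (subst integral_density[OF Hspm]) (auto simp: W0)
  also have "\<dots> = (LINT s|lborel. A s * (LINT w|?M2. k s w * B w))"
    unfolding eq3 by (rule triple(2))
  also have "\<dots> = (LINT s|lborel. complex_of_real (?\<phi> / (2 * b)) * (iexp (s * x) * complex_of_real ((exp (b * s) - exp (- (b * s))) / s) * density_transform q s))"
  proof (rule integral_cong_AE)
    show "(\<lambda>s. A s * (LINT w|?M2. k s w * B w)) \<in> borel_measurable lborel"
    proof -
      have [measurable]: "A \<in> borel_measurable lborel" "B \<in> borel_measurable ?M2"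
        using Aint Bint by auto
      note [measurable] = km
      have "(\<lambda>s. LINT w|?M2. k s w * B w) \<in> borel_measurable lborel"
        by (rule sigma_finite_measure.borel_measurable_lebesgue_integral[OF lborel_pair.sigma_finite_measure_axioms]) measurable
      then show ?thesis by measurable
    qed
    show "AE s in lborel. A s * (LINT w|?M2. k s w * B w)
        = complex_of_real (?\<phi> / (2 * b)) * (iexp (s * x) * complex_of_real ((exp (b * s) - exp (- (b * s))) / s) * density_transform q s)"
      using AE_lborel_singleton[of "0::real"]
    proof eventually_elim
      fix s :: real assume s: "s \<noteq> 0"
      let ?I = "(exp (b * s) - exp (- (b * s))) / (2 * b * s)"
      let ?j = "\<lambda>\<theta>. complex_of_real (indicator {0..1} \<theta> * exp (b * s * (1 - 2 * \<theta>)))"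
      have hb: "has_bochner_integral lborel (\<lambda>\<theta>. indicator {0..1} \<theta> * exp (b * s * (1 - 2 * \<theta>))) ?I"
        by (rule integral_exp_symmetric) (use b s in auto)
      have j: "integrable lborel ?j" "(LINT \<theta>|lborel. ?j \<theta>) = complex_of_real ?I"
        using integrable_of_real[OF integrable.intros[OF hb]] has_bochner_integral_integral_eq[OF hb]
          integral_complex_of_real[of lborel "\<lambda>\<theta>. indicator {0..1} \<theta> * exp (b * s * (1 - 2 * \<theta>))"] by auto
      have split: "exp (b * s * (1 - 2 * \<theta>) - b * \<bar>s\<bar>) = exp (- (b * \<bar>s\<bar>)) * exp (b * s * (1 - 2 * \<theta>))" for \<theta>
        by (simp add: mult_exp_exp)
      have "(LINT w|?M2. k s w * B w) = (LINT w|?M2. (complex_of_real (exp (- (b * \<bar>s\<bar>))) * iexp (s * x)) * (?j (fst w) * complex_of_real (p (snd w) * exp (2 * b * snd w))))"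
        by (intro Bochner_Integration.integral_cong refl)
           (simp add: k_def B_def split indicator_def)
      also have "\<dots> = (complex_of_real (exp (- (b * \<bar>s\<bar>))) * iexp (s * x)) * (complex_of_real ?I * complex_of_real ?\<phi>)"
        unfolding integral_mult_right_zero integral_pair_product(2)[OF j(1) wc] j(2) wI ..
      finally have "A s * (LINT w|?M2. k s w * B w)
         = complex_of_real (exp (b * \<bar>s\<bar>) * exp (- (b * \<bar>s\<bar>)) * ?I * ?\<phi>) * iexp (s * x) * density_transform q s"
        by (simp add: A_def)
      also have "exp (b * \<bar>s\<bar>) * exp (- (b * \<bar>s\<bar>)) * ?I * ?\<phi> = ?\<phi> / (2 * b) * ((exp (b * s) - exp (- (b * s))) / s)"
        by (simp add: mult_exp_exp)
      finally show "A s * (LINT w|?M2. k s w * B w)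
        = complex_of_real (?\<phi> / (2 * b)) * (iexp (s * x) * complex_of_real ((exp (b * s) - exp (- (b * s))) / s) * density_transform q s)"
        by (simp only: of_real_mult ac_simps)
    qed
  qed measurable
  also have "\<dots> = complex_of_real (?\<phi> / (2 * b)) * (LINT s|lborel. iexp (s * x) * complex_of_real ((exp (b * s) - exp (- (b * s))) / s) * density_transform q s)"
    by (rule integral_mult_right_zero)
  also have "(LINT s|lborel. iexp (s * x) * complex_of_real ((exp (b * s) - exp (- (b * s))) / s) * density_transform q s) = complex_of_real (4 * pi * Im (strip_extension q (Complex x b)))"
    using Im_strip_extension[OF q(1) decay b, of x] by simp
  finally have form_value: "(LINT z|?M2. ?dd z *\<^sub>R H z) = complex_of_real (?\<phi> / (2 * b) * (4 * pi * Im (strip_extension q (Complex x b))))"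
    by simp

  define u where "u n \<xi> = indicator {- real n..real n} \<xi> * e \<xi>" for n :: nat and \<xi>
  have u: "test_function (u n)" for n
  proof -
    have "u n \<in> borel_measurable borel" unfolding u_def by measurable
    moreover have "cmod (u n \<xi>) \<le> exp (b * real n)" for \<xi>
      using b by (auto simp: u_def e_def indicator_def norm_mult)
    moreover have "\<forall>\<xi>. \<bar>\<xi>\<bar> > real n \<longrightarrow> u n \<xi> = 0" by (auto simp: u_def indicator_def)
    ultimately show ?thesis unfolding test_function_def by blast
  qed
  have "(\<lambda>n. dd_form F q (u n)) \<longlonglongrightarrow> (LINT z|?M2. ?dd z *\<^sub>R H z)"
    unfolding dd_form_def
  proof (rule integral_dominated_convergence)
    show "integrable ?M2 (\<lambda>z. norm (?dd z *\<^sub>R H z))" using Hint by (rule integrable_norm)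
    have [measurable]: "u n \<in> borel_measurable borel" for n using u[of n] by (simp add: test_function_def)
    show "(\<lambda>z. cnj (u n (snd z)) * u n (fst z) * (complex_of_real (?dd z) * density_transform q (snd z - fst z))) \<in> borel_measurable ?M2" for n
      by measurable
    show "(\<lambda>z. ?dd z *\<^sub>R H z) \<in> borel_measurable ?M2" by measurable
    have un: "cnj (u n (snd z)) * u n (fst z) * (complex_of_real (?dd z) * density_transform q (snd z - fst z))
        = (if fst z \<in> {- real n..real n} \<and> snd z \<in> {- real n..real n} then ?dd z *\<^sub>R H z else 0)" for n z
      by (auto simp: u_def H_def scaleR_conv_of_real indicator_def)
    show "AE z in ?M2. (\<lambda>n. cnj (u n (snd z)) * u n (fst z) * (complex_of_real (?dd z) * density_transform q (snd z - fst z))) \<longlonglongrightarrow> ?dd z *\<^sub>R H z"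
    proof (rule AE_I2)
      fix z :: "real \<times> real"
      obtain m :: nat where m: "max \<bar>fst z\<bar> \<bar>snd z\<bar> \<le> real m" using real_arch_simple by blast
      have "\<forall>n\<ge>m. fst z \<in> {- real n..real n} \<and> snd z \<in> {- real n..real n}"
      proof (intro allI impI)
        fix n assume "m \<le> n"
        then have "max \<bar>fst z\<bar> \<bar>snd z\<bar> \<le> real n" using m by linarith
        then show "fst z \<in> {- real n..real n} \<and> snd z \<in> {- real n..real n}" by (auto simp: abs_le_iff)
      qed
      then have "\<forall>\<^sub>F n in sequentially. cnj (u n (snd z)) * u n (fst z) * (complex_of_real (?dd z) * density_transform q (snd z - fst z)) = ?dd z *\<^sub>R H z"
        unfolding un eventually_sequentially by auto
      then show "(\<lambda>n. cnj (u n (snd z)) * u n (fst z) * (complex_of_real (?dd z) * density_transform q (snd z - fst z))) \<longlonglongrightarrow> ?dd z *\<^sub>R H z"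
        by (rule tendsto_eventually)
    qed
    show "AE z in ?M2. norm (cnj (u n (snd z)) * u n (fst z) * (complex_of_real (?dd z) * density_transform q (snd z - fst z))) \<le> norm (?dd z *\<^sub>R H z)" for n
      by (rule AE_I2) (simp add: un)
  qed
  then have "(\<lambda>n. Re (dd_form F q (u n))) \<longlonglongrightarrow> Re (LINT z|?M2. ?dd z *\<^sub>R H z)" by (rule tendsto_Re)
  then have "0 \<le> Re (LINT z|?M2. ?dd z *\<^sub>R H z)"
    by (rule LIMSEQ_le_const) (use pos u in \<open>auto simp: dd_positive_def\<close>)
  then have "0 \<le> ?\<phi> / (2 * b) * (4 * pi * Im (strip_extension q (Complex x b)))" unfolding form_value Re_complex_of_real .
  then have "0 \<le> (?\<phi> / (2 * b) * (4 * pi)) * Im (strip_extension q (Complex x b))" by (simp only: mult.assoc)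
  moreover have "0 < ?\<phi> / (2 * b) * (4 * pi)" using wpos b by simp
  ultimately show ?thesis by (meson mult_pos_neg not_le)
qed

text \<open>The statement for one function, abstracted from operators: a positive kernel and exponential
  moments of the derivative of \<open>F\<close> place \<open>G\<close> in the Kato class.  Constant \<open>G\<close> is treated apart because
  the inversion formula normalizes the density.\<close>

theorem kato_class_if_dd_positive:
  assumes F: "monotone_density F p" and deriv: "AE t in lborel. (F has_real_derivative p t) (at t)"
    and G: "monotone_density G q" and pos: "dd_positive F q" and incr: "x0 < y0" "F x0 < F y0" and \<beta>: "0 < \<beta>"
    and w: "\<And>b. 0 < b \<Longrightarrow> b < \<beta> \<Longrightarrow> integrable lborel (\<lambda>t. p t * exp (2 * b * t))"
  shows "G \<in> kato_class \<beta>"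
proof -
  note q = monotone_densityD(3,2)[OF G]
  have "\<bar>G x\<bar> \<le> \<bar>G 0\<bar> + (LINT t|lborel. q t)" for x using monotone_density_bound[OF G, of x 0] by linarith
  then have bdd: "bounded (range G)" by (auto simp: bounded_iff)
  have "0 \<le> (LINT t|lborel. q t)" using q(2) by (intro integral_nonneg_AE) auto
  then consider "(LINT t|lborel. q t) = 0" | "0 < (LINT t|lborel. q t)" by linarith
  then show ?thesis
  proof cases
    case 1
    then have "G x = G 0" for x using monotone_density_bound[OF G, of x 0] by simp
    then have "\<forall>x. complex_of_real (G 0) = complex_of_real (G x)" by metis
    then show ?thesis using bdd unfolding kato_class_def
      by (intro CollectI conjI exI[of _ "\<lambda>z. complex_of_real (G 0)"]) auto
  next
    case g: 2
    have decay: "integrable lborel (\<lambda>s. exp (b * \<bar>s\<bar>) * cmod (density_transform q s))" if b: "0 \<le> b" "b < \<beta>" for b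
    proof (rule density_transform_decay[OF F deriv q pos incr _ b(1)])
      show "integrable lborel (\<lambda>t. p t * exp (2 * ((b + \<beta>) / 2) * t))" by (rule w) (use b \<beta> in auto)
      show "b < (b + \<beta>) / 2" using b by simp
    qed
    note ext = q(1) decay
    define \<Phi> where "\<Phi> z = strip_extension q z + complex_of_real (G 0)" for z
    have upper: "0 \<le> Im (\<Phi> z)" if z: "0 < Im z" "Im z < \<beta>" for z
    proof -
      let ?\<phi> = "LINT t|lborel. p t * exp (2 * Im z * t)"
      have wz: "integrable lborel (\<lambda>t. p t * exp (2 * Im z * t))" by (rule w[OF z])
      have "?\<phi> \<noteq> 0"
      proof
        assume "?\<phi> = 0"
        then have "AE t in lborel. p t * exp (2 * Im z * t) = 0"
          using integral_nonneg_eq_0_iff_AE[OF wz] monotone_densityD(2)[OF F] by simp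
        then have "AE t in lborel. indicator {x0..y0} t * p t = 0" by eventually_elim simp
        then have "(LINT t|lborel. indicator {x0..y0} t * p t) = 0" by (rule integral_eq_zero_AE)
        then show False using monotone_densityD(4)[OF F, of x0 y0] incr by simp
      qed
      moreover have "0 \<le> ?\<phi>" using monotone_densityD(2)[OF F] by (intro integral_nonneg_AE) auto
      ultimately have "0 \<le> Im (strip_extension q (Complex (Re z) (Im z)))"
        by (intro Im_strip_extension_nonneg[OF F q pos decay z wz]) auto
      then show ?thesis by (simp add: \<Phi>_def)
    qed
    have "\<Phi> holomorphic_on {z. \<bar>Im z\<bar> < \<beta>}"
      unfolding \<Phi>_def by (intro holomorphic_intros strip_extension_holomorphic[OF ext])
    moreover have "\<forall>x. \<Phi> (complex_of_real x) = complex_of_real (G x)"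
      unfolding \<Phi>_def by (simp add: strip_extension_real[OF ext G g \<beta>])
    moreover have "Im (\<Phi> z) * Im z \<ge> 0" if z: "\<bar>Im z\<bar> < \<beta>" for z
    proof -
      consider "0 < Im z" | "Im z = 0" | "Im z < 0" by linarith
      then show ?thesis
      proof cases
        case 1 then show ?thesis using upper[of z] z by simp
      next
        case 3
        have "cnj (\<Phi> z) = \<Phi> (cnj z)" using cnj_strip_extension[OF ext] by (simp add: \<Phi>_def)
        then have "Im (\<Phi> z) = - Im (\<Phi> (cnj z))" by (metis complex_cnj_cnj cnj.simps(2))
        then have "Im (\<Phi> z) \<le> 0" using upper[of "cnj z"] 3 z by simp
        then show ?thesis using 3 by (simp add: mult_nonpos_nonpos)
      qed simp
    qed
    ultimately show ?thesis using bdd unfolding kato_class_def by blast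
  qed
qed

text \<open>Passes from the given functions to their absolutely continuous versions.\<close>

lemma kato_positive_cong_AE:
  assumes f: "f \<in> borel_measurable lebesgue" "bounded (range f)" and g: "g \<in> borel_measurable lebesgue" "bounded (range g)"
    and fF: "AE x in lebesgue. f x = F x" and gG: "AE x in lebesgue. g x = G x" and pos: "kato_positive f g"
  shows "kato_positive F G"
  unfolding kato_positive_def
proof
  fix u assume u: "u \<in> L1_L2"
  let ?fu = "\<lambda>\<xi>. complex_of_real (f \<xi>) * u \<xi>" and ?gu = "\<lambda>x. complex_of_real (g x) * inverse_integral u x"
  have fu: "?fu \<in> L1_L2" by (rule L1_L2_bounded_multiplier[OF f u])
  have "fourier_integral (\<lambda>\<xi>. complex_of_real (F \<xi>) * u \<xi>) = fourier_integral ?fu"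
    by (rule fourier_integral_cong_AE[OF L2_measurable[OF L1_L2_D(1)[OF fu]]]) (use fF in \<open>auto elim: eventually_mono\<close>)
  then have 1: "inverse_integral (\<lambda>\<xi>. complex_of_real (F \<xi>) * u \<xi>) = inverse_integral ?fu"
    unfolding inverse_integral_def[abs_def] by simp
  have "l2_inner (\<lambda>x. complex_of_real (G x) * inverse_integral u x) (inverse_integral ?fu) = l2_inner ?gu (inverse_integral ?fu)"
    by (rule l2_inner_cong_AE[OF bounded_multiplier_L2[OF g inverse_integral_L2[OF u]] inverse_integral_L2[OF fu]])
       (use gG in \<open>auto elim: eventually_mono\<close>)
  then show "0 \<le> Im (l2_inner (\<lambda>x. complex_of_real (G x) * inverse_integral u x)
      (inverse_integral (\<lambda>\<xi>. complex_of_real (F \<xi>) * u \<xi>)))"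
    unfolding 1 using pos u by (simp add: kato_positive_def)
qed

lemma nonconstant_increase:
  fixes f F :: "real \<Rightarrow> real"
  assumes "mono F" "\<not> (AE x in lebesgue. f x = c)" "AE x in lebesgue. f x = F x" "c = F 0"
  obtains x0 y0 where "x0 < y0" "F x0 < F y0"
proof -
  have "\<exists>x. F x \<noteq> F 0"
  proof (rule ccontr)
    assume "\<nexists>x. F x \<noteq> F 0"
    then have "AE x in lebesgue. f x = c" using assms(3,4) by (auto elim: eventually_mono)
    then show False using assms(2) by simp
  qed
  then obtain x where x: "F x \<noteq> F 0" by blast
  show ?thesis
  proof (cases "x < 0")
    case True
    then have "F x < F 0" using monoD[OF assms(1), of x 0] x by simp
    with True show ?thesis by (rule that)
  next
    case False
    then have "0 < x" using x by (cases "x = 0") auto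
    moreover have "F 0 < F x" using monoD[OF assms(1), of 0 x] x False by simp
    ultimately show ?thesis by (rule that)
  qed
qed

lemma weight_integrable:
  assumes p: "p \<in> borel_measurable borel" "\<And>t. 0 \<le> p t" and eq: "AE t in lebesgue. F' t = p t"
    and fin: "(\<integral>\<^sup>+ t. ennreal (F' t * exp (2 * b * t)) \<partial>lebesgue) < \<infinity>"
  shows "integrable lborel (\<lambda>t. p t * exp (2 * b * t))"
proof (rule integrableI_nonneg)
  show "(\<lambda>t. p t * exp (2 * b * t)) \<in> borel_measurable lborel" using p(1) by measurable
  have "(\<integral>\<^sup>+ t. ennreal (p t * exp (2 * b * t)) \<partial>lborel) = (\<integral>\<^sup>+ t. ennreal (p t * exp (2 * b * t)) \<partial>lebesgue)"
    by (rule nn_integral_completion[symmetric])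
  also have "\<dots> = (\<integral>\<^sup>+ t. ennreal (F' t * exp (2 * b * t)) \<partial>lebesgue)"
    by (rule nn_integral_cong_AE) (use eq in \<open>auto elim: eventually_mono\<close>)
  finally show "(\<integral>\<^sup>+ t. ennreal (p t * exp (2 * b * t)) \<partial>lborel) < \<infinity>" using fin by simp
qed (use p(2) in simp)

text \<open>Both conclusions are instances of \<open>kato_class_if_dd_positive\<close>: the first uses the kernel in the
  momentum representation, the second the kernel in the position representation.\<close>

theorem theorem1p4:
  fixes a ahat :: real and f g F G F' G' :: "real \<Rightarrow> real"
  assumes "a > 0" and "ahat = pi / (2 * a)"
    and "f \<in> borel_measurable lebesgue" and "bounded (range f)"
    and "g \<in> borel_measurable lebesgue" and "bounded (range g)"
    and "positive_op (i_commutator f g)" and "nonzero_op (i_commutator f g)"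
    and "ac_version f F F'" and "ac_version g G G'"
    and "mono F" and "mono G"
    and "\<forall>b\<in>{0<..<ahat}. (\<integral>\<^sup>+ t. ennreal (F' t * exp (2 * b * t)) \<partial>lebesgue) < \<infinity>"
  shows "G \<in> kato_class ahat \<and>
    ((\<forall>b\<in>{0<..<a}. (\<integral>\<^sup>+ t. ennreal (G' t * exp (2 * b * t)) \<partial>lebesgue) < \<infinity>)
      \<longrightarrow> F \<in> kato_class a \<and> a * ahat = pi / 2 \<and> kato_conclusion F G)"
proof -
  note fb = assms(3,4) and gb = assms(5,6)
  have fF: "AE t in lebesgue. f t = F t" and gG: "AE t in lebesgue. g t = G t"
    using assms(9,10) by (auto simp: ac_version_def)
  obtain p where p: "monotone_density F p" "AE t in lborel. (F has_real_derivative p t) (at t)" "AE t in lebesgue. F' t = p t"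
    by (rule ac_version_density[OF assms(9,11)])
  obtain q where q: "monotone_density G q" "AE t in lborel. (G has_real_derivative q t) (at t)" "AE t in lebesgue. G' t = q t"
    by (rule ac_version_density[OF assms(10,12)])
  note F = p(1) and G = q(1)
  have bddI: "bounded (range H)" if H: "monotone_density H r" for H r
  proof -
    have "\<bar>H x\<bar> \<le> \<bar>H 0\<bar> + (LINT t|lborel. r t)" for x using monotone_density_bound[OF H, of x 0] by linarith
    then show ?thesis by (auto simp: bounded_iff)
  qed
  have Fb: "bounded (range F)" and Gb: "bounded (range G)" using bddI F G by auto
  have "kato_positive F G"
    by (rule kato_positive_cong_AE[OF fb gb fF gG kato_positive_momentum[OF fb gb assms(7)]])
  then have FG: "dd_positive F q" by (rule dd_positive_if_kato_positive[OF _ F Fb G Gb])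
  have "kato_positive G F"
    by (rule kato_positive_cong_AE[OF gb fb gG fF kato_positive_position[OF fb gb assms(7)]])
  then have GF: "dd_positive G p" by (rule dd_positive_if_kato_positive[OF _ G Gb F Fb])
  obtain x0 y0 where incrF: "x0 < y0" "F x0 < F y0"
    by (rule nonconstant_increase[OF assms(11) _ fF refl]) (use commutator_const_zero[OF fb gb] assms(8) in auto)
  obtain x1 y1 where incrG: "x1 < y1" "G x1 < G y1"
    by (rule nonconstant_increase[OF assms(12) _ gG refl]) (use commutator_const_zero[OF fb gb] assms(8) in auto)
  have ahat: "0 < ahat" "a * ahat = pi / 2" using assms(1,2) by auto
  have 1: "G \<in> kato_class ahat"
    by (rule kato_class_if_dd_positive[OF F p(2) G FG incrF ahat(1) weight_integrable[OF monotone_densityD(1,2)[OF F] p(3)]])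
       (use assms(13) in auto)
  moreover have "F \<in> kato_class a"
    if wG: "\<forall>b\<in>{0<..<a}. (\<integral>\<^sup>+ t. ennreal (G' t * exp (2 * b * t)) \<partial>lebesgue) < \<infinity>"
    by (rule kato_class_if_dd_positive[OF G q(2) F GF incrG assms(1) weight_integrable[OF monotone_densityD(1,2)[OF G] q(3)]])
       (use wG in auto)
  ultimately show ?thesis using ahat assms(1) unfolding kato_conclusion_def by blast
qed

end
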